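(* Let $\mu$ be an extremal order-invariant measure on $(\Omega,\mathcal{F})$ (with $\mu$-almost surely distinct labels). Then there is a poset $Q=(Z,<)$, which is either a causal set or a finite poset, together with a marked set $M\subseteq Z$ of maximal elements of $Q$ (where the unmarked elements are points of $[0,1]$, i.e. $Z\setminus M\subseteq[0,1]$), such that, if $Q'$ is obtained from $Q$ by replacing each element $z\in M$ with a countably infinite antichain $A_z$, then the random poset $\Pi$ generated by $\mu$ is $\mu$-almost surely equal to $Q'$, except for the labels on the antichains $A_z$. That is: for $\mu$-almost every $\omega\in\Omega$ there are countably infinite sets $A_z=A_z(\omega)\subseteq[0,1]$ $(z\in M)$, pairwise disjoint and disjoint from $Z\setminus M$, such that $\Pi(\omega)$ is the poset with ground-set $(Z\setminus M)\cup\bigcup_{z\in M}A_z$ in which: $Z\setminus M$ carries the restriction of $<$; for $y\in Z\setminus M$, $z\in M$ and $a\in A_z$, $y$ is below $a$ if and only if $y<z$ in $Q$, and $a$ is not below $y$; and any two distinct elements of $\bigcup_{z\in M}A_z$ are incomparable.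
   Context: Notation: $\mathbb{N}=\{1,2,\dots\}$, $[k]=\{1,\dots,k\}$. Partial orders are strict (transitive and irreflexive). A causal set is a poset on a countably infinite ground-set in which every element is above only finitely many others. A suborder of $\mathbb{N}$ (or of $[k]$) is a partial order $<^{\mathbb{N}}$ on $\mathbb{N}$ (or $<^{[k]}$ on $[k]$) such that if $i$ is below $j$ in it then $i<j$ in the standard order. For a suborder $<^{\mathbb N}$, $<^{\mathbb N}_{[k]}$ denotes its restriction to $[k]$. The space: $\Omega$ is the set of pairs $\omega=(x_1x_2\cdots,<^{\mathbb{N}})$, where $x_1x_2\cdots$ is an infinite sequence of elements of $[0,1]$ and $<^{\mathbb{N}}$ is a suborder of $\mathbb{N}$. For Borel sets $B_1,\dots,B_k\subseteq[0,1]$ and a suborder $<^{[k]}$ of $[k]$, the basic event $E(B_1\cdots B_k,<^{[k]})$ is the set of $\omega=(x_1x_2\cdots,<^{\mathbb{N}})\in\Omega$ with $x_i\in B_i$ for $i=1,\dots,k$ and $<^{\mathbb{N}}_{[k]}$ equal to $<^{[k]}$. $\mathcal{F}$ is the $\sigma$-field on $\Omega$ generated by all basic events. For $\omega=(x_1x_2\cdots,<^{\mathbb N})$ with distinct $x_i$, $\Pi(\omega)$ is the poset on the set $\{x_1,x_2,\dots\}$ in which $x_i$ is below $x_j$ if and only if $i<^{\mathbb{N}}j$. Order-invariance: a linear extension of a suborder $<^{[k]}$ is a permutation $\lambda$ of $[k]$ such that $\lambda(i)<^{[k]}\lambda(j)$ implies $i<j$; $\lambda[<^{[k]}]$ is the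 suborder of $[k]$ in which $i$ is below $j$ if and only if $\lambda(i)<^{[k]}\lambda(j)$. A probability measure $\mu$ on $(\Omega,\mathcal{F})$ is order-invariant if $\mu(E(B_1\cdots B_k,<^{[k]}))=\mu(E(B_{\lambda(1)}\cdots B_{\lambda(k)},\lambda[<^{[k]}]))$ for all $k$, all Borel sets $B_1,\dots,B_k\subseteq[0,1]$, all suborders $<^{[k]}$ of $[k]$ and all linear extensions $\lambda$ of $<^{[k]}$. It is extremal if it cannot be written as $r\mu_1+(1-r)\mu_2$ with $r\in(0,1)$ and $\mu_1\neq\mu_2$ order-invariant measures. Almost surely distinct labels means $\mu(\{(x_1x_2\cdots,<^{\mathbb N}):x_i=x_j\text{ for some }i\neq j\})=0$. *)

theory Defs
  imports "HOL-Probability.Probability" "HOL-Combinatorics.Permutations"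
begin

text \<open>
  Index sets are shifted by one: the positive integers are represented by the type \<^typ>\<open>nat\<close>
  and the initial segment of length \<open>k\<close> by \<open>{..<k}\<close>. Strict orders are relations, with
  \<open>(i, j) \<in> r\<close> meaning that \<open>i\<close> is below \<open>j\<close>.
\<close>

definition poset_on :: "'a set \<Rightarrow> 'a rel \<Rightarrow> bool" where
  "poset_on Z r \<longleftrightarrow> r \<subseteq> Z \<times> Z \<and> irrefl r \<and> trans r"

definition causal_set :: "'a set \<Rightarrow> 'a rel \<Rightarrow> bool" where
  "causal_set Z r \<longleftrightarrow>
     poset_on Z r \<and> countable Z \<and> infinite Z \<and> (\<forall>z\<in>Z. finite {y. (y, z) \<in> r})"

definition suborder_on :: "nat set \<Rightarrow> nat rel \<Rightarrow> bool" where
  "suborder_on A r \<longleftrightarrow> poset_on A r \<and> (\<forall>i j. (i, j) \<in> r \<longrightarrow> i < j)"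

definition Omega :: "((nat \<Rightarrow> real) \<times> nat rel) set" where
  "Omega = {(x, r). (\<forall>i. x i \<in> {0..1}) \<and> suborder_on UNIV r}"

definition basic_event ::
    "nat \<Rightarrow> (nat \<Rightarrow> real set) \<Rightarrow> nat rel \<Rightarrow> ((nat \<Rightarrow> real) \<times> nat rel) set" where
  "basic_event k B s =
     {(x, r) \<in> Omega. (\<forall>i<k. x i \<in> B i) \<and> r \<inter> ({..<k} \<times> {..<k}) = s}"

definition borel_labels :: "nat \<Rightarrow> (nat \<Rightarrow> real set) \<Rightarrow> bool" where
  "borel_labels k B \<longleftrightarrow> (\<forall>i<k. B i \<in> sets borel \<and> B i \<subseteq> {0..1})"

definition Omega_space :: "((nat \<Rightarrow> real) \<times> nat rel) measure" where
  "Omega_space =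
     sigma Omega {basic_event k B s | k B s. borel_labels k B \<and> suborder_on {..<k} s}"

lemma space_Omega_space: "space Omega_space = Omega"
  unfolding Omega_space_def by (rule space_measure_of) (auto simp: basic_event_def)

lemma sets_Omega_space:
  "sets Omega_space =
     sigma_sets Omega {basic_event k B s | k B s. borel_labels k B \<and> suborder_on {..<k} s}"
  unfolding Omega_space_def by (rule sets_measure_of) (auto simp: basic_event_def)

definition linear_extension :: "nat \<Rightarrow> nat rel \<Rightarrow> (nat \<Rightarrow> nat) \<Rightarrow> bool" where
  "linear_extension k s l \<longleftrightarrow>
     l permutes {..<k} \<and> (\<forall>i<k. \<forall>j<k. (l i, l j) \<in> s \<longrightarrow> i < j)"

definition reorder :: "nat \<Rightarrow> (nat \<Rightarrow> nat) \<Rightarrow> nat rel \<Rightarrow> nat rel" where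
  "reorder k l s = {(i, j). i < k \<and> j < k \<and> (l i, l j) \<in> s}"

definition order_invariant :: "((nat \<Rightarrow> real) \<times> nat rel) measure \<Rightarrow> bool" where
  "order_invariant \<mu> \<longleftrightarrow>
     prob_space \<mu> \<and> sets \<mu> = sets Omega_space \<and>
     (\<forall>k B s l. borel_labels k B \<longrightarrow> suborder_on {..<k} s \<longrightarrow> linear_extension k s l \<longrightarrow>
        measure \<mu> (basic_event k B s) =
        measure \<mu> (basic_event k (\<lambda>i. B (l i)) (reorder k l s)))"

definition extremal_order_invariant :: "((nat \<Rightarrow> real) \<times> nat rel) measure \<Rightarrow> bool" where
  "extremal_order_invariant \<mu> \<longleftrightarrow>
     order_invariant \<mu> \<and>
     \<not> (\<exists>r \<mu>1 \<mu>2. 0 < r \<and> r < 1 \<and> order_invariant \<mu>1 \<and> order_invariant \<mu>2 \<and> \<mu>1 \<noteq> \<mu>2 \<and>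
          (\<forall>A\<in>sets Omega_space. measure \<mu> A = r * measure \<mu>1 A + (1 - r) * measure \<mu>2 A))"

definition as_distinct_labels :: "((nat \<Rightarrow> real) \<times> nat rel) measure \<Rightarrow> bool" where
  "as_distinct_labels \<mu> \<longleftrightarrow> {(x, r) \<in> Omega. \<exists>i j. i \<noteq> j \<and> x i = x j} \<in> null_sets \<mu>"

text \<open>
  A poset is returned as the pair of its ground-set and its strict order. The following
  is only meaningful when the labels \<open>x i\<close> are distinct.
\<close>

definition generated_poset :: "(nat \<Rightarrow> real) \<times> nat rel \<Rightarrow> real set \<times> real rel" where
  "generated_poset = (\<lambda>(x, r). (range x, {(x i, x j) | i j. (i, j) \<in> r}))"

text \<open>
  Replacing each \<open>z \<in> M\<close> by the antichain \<open>A z\<close>: the relation lists exactly the comparable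
  pairs, so no element of an \<open>A z\<close> is below anything.
\<close>

definition replace_by_antichains ::
    "'a set \<Rightarrow> 'a rel \<Rightarrow> 'a set \<Rightarrow> ('a \<Rightarrow> 'a set) \<Rightarrow> 'a set \<times> 'a rel" where
  "replace_by_antichains Z r M A =
     ((Z - M) \<union> (\<Union>z\<in>M. A z),
      (r \<inter> (Z - M) \<times> (Z - M)) \<union>
      {(y, a) | y a z. y \<in> Z - M \<and> z \<in> M \<and> a \<in> A z \<and> (y, z) \<in> r})"

end

theory Submission
  imports Defs
begin

text \<open>
  An event that depends only on the labelled poset, and not on the order in which its elements
  are listed, has probability 0 or 1 under an extremal order-invariant measure: conditioning on
  it and on its complement would otherwise split the measure (\<open>zero_one\<close>). Call a label fixed if
  it occurs almost surely; every other label occurs with probability 0. There are only countably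
  many fixed labels, so the order between them is almost surely one and the same relation, and
  so is the collection of those finite sets \<open>D\<close> of fixed labels for which some non-fixed element
  lies above exactly the elements of \<open>D\<close>. Such an element then exists infinitely often: if there
  were finitely many, the smallest of their labels would be a non-random number, hence a fixed
  label (\<open>AE_infinite_type\<close>). The sets \<open>D\<close> become the marked elements of \<open>Q\<close>.

  All of this describes the poset as soon as one knows that a non-fixed element is never below
  another element (\<open>AE_nonmaximal_fixed\<close>), and this is the heart of the proof. A counterexample
  that is minimal among the non-fixed elements has only fixed labels below it; list these labels
  first, then the counterexample, at position \<open>k\<close>, and some element above it within the next
  \<open>t\<close> positions. Let \<open>B\<close> be the event that this happens at the first \<open>k + t + 1\<close> positions.
  By order-invariance, the conditional probability of an event given the unordered poset of the
  first \<open>n\<close> elements is its frequency among the linear extensions of that poset. So fix a finite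
  poset, enumerate it uniformly at random, and let \<open>y\<close> be a minimal element that comes first with
  probability \<open>\<rho>\<close>. The number of places at which \<open>y\<close> can be inserted into a random enumeration
  of the other elements has mean \<open>1 / \<rho>\<close>. Deleting minimal elements can only decrease this mean,
  so that the waiting time for an element above \<open>y\<close> cannot be small with a large probability and
  huge otherwise; the outcome is that \<open>y\<close> comes first and is followed by an element above it
  within \<open>t\<close> steps with probability at most \<open>t * \<rho>\<^sup>2\<close> (\<open>card_early_le\<close>). Summing over \<open>y\<close>, the
  square of the frequency of \<open>B\<close> is at most \<open>t\<close> times the sum, over the intervals of a
  partition of \<open>[0, 1]\<close>, of the squared frequencies of a non-fixed label from that interval at
  position \<open>k\<close>. As \<open>n\<close> grows, squared frequencies converge in mean to squared probabilities, by
  the zero-one law (\<open>integral_avg_square_tendsto\<close>). Since the non-fixed label at position \<open>k\<close> has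
  an atomless distribution, the sum of squares vanishes as the partition is refined, and \<open>B\<close> is
  a null event.

  That the mean number of places decreases is the inequality
  \<open>e(R - a) * e(R - b) \<le> e(R) * e(R - a - b)\<close> for the number \<open>e\<close> of linear extensions and
  distinct minimal elements \<open>a\<close>, \<open>b\<close> of \<open>R\<close> (\<open>lin_exts_log_supermodular\<close>), a weak form of Fishburn's
  correlation inequality. It follows from the four functions theorem, applied to chains of
  up-closed sets.
\<close>

section \<open>The four functions theorem on a power set\<close>

text \<open>
  The case of a two-element chain. With \<open>z = c1 * d0\<close> dominating both cross terms \<open>u\<close> and \<open>v\<close>,
  the inequality \<open>(z - u) * (z - v) \<ge> 0\<close> gives \<open>u + v \<le> z + u * v / z\<close>, and \<open>u * v\<close> is controlled by
  the product of the diagonal hypotheses.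
\<close>

lemma four_numbers:
  fixes a0 a1 b0 b1 c0 c1 d0 d1 :: real
  assumes nn: "0 \<le> a0" "0 \<le> a1" "0 \<le> b0" "0 \<le> b1" "0 \<le> c0" "0 \<le> c1" "0 \<le> d0" "0 \<le> d1"
    and h: "a0 * b0 \<le> c0 * d0" "a0 * b1 \<le> c1 * d0" "a1 * b0 \<le> c1 * d0" "a1 * b1 \<le> c1 * d1"
  shows "(a0 + a1) * (b0 + b1) \<le> (c0 + c1) * (d0 + d1)"
proof -
  define z where "z = c1 * d0"
  define u where "u = a0 * b1"
  define v where "v = a1 * b0"
  have z: "0 \<le> z" "u \<le> z" "v \<le> z" "0 \<le> u" "0 \<le> v"
    using nn h by (auto simp: z_def u_def v_def)
  have uv: "u * v \<le> z * (c0 * d1)"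
    using mult_mono[OF h(1) h(4)] nn by (simp add: u_def v_def z_def mult_ac)
  have "u + v \<le> z + c0 * d1"
  proof (cases "z = 0")
    case True
    then show ?thesis using z nn by simp
  next
    case False
    have "0 \<le> (z - u) * (z - v)" using z by simp
    then have "z * (u + v) \<le> z * z + u * v" by (simp add: algebra_simps)
    also have "\<dots> \<le> z * (z + c0 * d1)" using uv by (simp add: algebra_simps)
    finally show ?thesis using False z by (simp add: mult_le_cancel_left)
  qed
  then show ?thesis using h by (simp add: u_def v_def z_def algebra_simps)
qed

lemma sum_Pow_insert:
  fixes f :: "'a set \<Rightarrow> 'b::comm_monoid_add"
  assumes "finite S" "s \<notin> S"
  shows "sum f (Pow (insert s S)) = (\<Sum>X\<in>Pow S. f X + f (insert s X))"
proof -
  have inj: "inj_on (insert s) (Pow S)" using assms(2) by (auto simp: inj_on_def)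
  have "sum f (Pow (insert s S)) = sum f (Pow S) + sum f (insert s ` Pow S)"
    unfolding Pow_insert using assms by (intro sum.union_disjoint) auto
  then show ?thesis by (simp add: sum.reindex[OF inj] sum.distrib)
qed

text \<open>
  The Ahlswede--Daykin inequality for power sets. Splitting off one element replaces each
  function \<open>f\<close> by \<open>X \<mapsto> f X + f (insert s X)\<close>, and \<open>four_numbers\<close> says that this preserves the
  hypothesis.
\<close>

lemma four_functions:
  fixes f1 f2 f3 f4 :: "'a set \<Rightarrow> real"
  assumes "finite S"
    and "\<And>X. 0 \<le> f1 X" "\<And>X. 0 \<le> f2 X" "\<And>X. 0 \<le> f3 X" "\<And>X. 0 \<le> f4 X"
    and "\<And>X Y. X \<subseteq> S \<Longrightarrow> Y \<subseteq> S \<Longrightarrow> f1 X * f2 Y \<le> f3 (X \<union> Y) * f4 (X \<inter> Y)"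
  shows "sum f1 (Pow S) * sum f2 (Pow S) \<le> sum f3 (Pow S) * sum f4 (Pow S)"
  using assms
proof (induction S arbitrary: f1 f2 f3 f4 rule: finite_induct)
  case empty
  show ?case using empty.prems(5)[of "{}" "{}"] by simp
next
  case (insert s S)
  define g where "g f X = f X + f (insert s X)" for f :: "'a set \<Rightarrow> real" and X
  have "sum (g f1) (Pow S) * sum (g f2) (Pow S) \<le> sum (g f3) (Pow S) * sum (g f4) (Pow S)"
  proof (rule insert.IH)
    fix X Y assume XY: "X \<subseteq> S" "Y \<subseteq> S"
    with insert.hyps have s: "s \<notin> X" "s \<notin> Y" by auto
    have sub: "X \<subseteq> insert s S" "Y \<subseteq> insert s S" "insert s X \<subseteq> insert s S" "insert s Y \<subseteq> insert s S"
      using XY by auto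
    have h: "X \<union> insert s Y = insert s (X \<union> Y)" "insert s X \<union> Y = insert s (X \<union> Y)"
      "insert s X \<union> insert s Y = insert s (X \<union> Y)" "X \<inter> insert s Y = X \<inter> Y"
      "insert s X \<inter> Y = X \<inter> Y" "insert s X \<inter> insert s Y = insert s (X \<inter> Y)" using s by auto
    show "g f1 X * g f2 Y \<le> g f3 (X \<union> Y) * g f4 (X \<inter> Y)"
      unfolding g_def
      using insert.prems(5)[OF sub(1,2)] insert.prems(5)[OF sub(1,4)]
        insert.prems(5)[OF sub(3,2)] insert.prems(5)[OF sub(3,4)]
      by (intro four_numbers insert.prems(1-4)) (simp_all add: h)
  qed (auto simp: g_def insert.prems)
  then show ?case using insert.hyps by (simp add: sum_Pow_insert g_def)
qed

section \<open>Linear extensions of finite posets\<close>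

definition lin_exts :: "'a rel \<Rightarrow> 'a set \<Rightarrow> 'a list set" where
  "lin_exts r R = {xs. distinct xs \<and> set xs = R \<and> sorted_wrt (\<lambda>a b. (b, a) \<notin> r) xs}"

definition minimals :: "'a rel \<Rightarrow> 'a set \<Rightarrow> 'a set" where
  "minimals r R = {a \<in> R. \<forall>b\<in>R. (b, a) \<notin> r}"

text \<open>
  Relative to the ambient set \<open>R\<close>: what remains of \<open>R\<close> after the first few elements of an
  enumeration have been taken away is up-closed in \<open>R\<close>.
\<close>

definition up_closed :: "'a rel \<Rightarrow> 'a set \<Rightarrow> 'a set \<Rightarrow> bool" where
  "up_closed r R Y \<longleftrightarrow> Y \<subseteq> R \<and> (\<forall>a\<in>Y. \<forall>b\<in>R. (a, b) \<in> r \<longrightarrow> b \<in> Y)"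

lemma finite_lin_exts: "finite R \<Longrightarrow> finite (lin_exts r R)"
  by (rule finite_subset[OF _ finite_subset_distinct]) (auto simp: lin_exts_def)

lemma finite_minimals: "finite R \<Longrightarrow> finite (minimals r R)"
  by (simp add: minimals_def)

lemma length_lin_ext: "xs \<in> lin_exts r R \<Longrightarrow> length xs = card R"
  by (auto simp: lin_exts_def distinct_card)

lemma lin_exts_empty: "lin_exts r {} = {[]}"
  by (auto simp: lin_exts_def)

lemma Cons_mem_lin_exts_iff:
  assumes "wf r"
  shows "a # zs \<in> lin_exts r R \<longleftrightarrow> a \<in> minimals r R \<and> zs \<in> lin_exts r (R - {a})"
proof -
  have "(a, a) \<notin> r" using assms by auto
  then show ?thesis by (auto simp: lin_exts_def minimals_def)
qed

lemma card_lin_exts_rec: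
  assumes "wf r" "finite R" "R \<noteq> {}"
  shows "card {xs \<in> lin_exts r R. P xs} =
    (\<Sum>a\<in>minimals r R. card {zs \<in> lin_exts r (R - {a}). P (a # zs)})"
proof -
  have eq: "{xs \<in> lin_exts r R. P xs} =
     (\<Union>a\<in>minimals r R. (#) a ` {zs \<in> lin_exts r (R - {a}). P (a # zs)})" (is "?L = ?U")
  proof (intro equalityI subsetI)
    fix xs assume xs: "xs \<in> ?L"
    with assms(3) obtain a zs where "xs = a # zs" by (cases xs) (auto simp: lin_exts_def)
    with xs Cons_mem_lin_exts_iff[OF assms(1)] show "xs \<in> ?U" by blast
  next
    fix xs assume "xs \<in> ?U"
    then show "xs \<in> ?L" using Cons_mem_lin_exts_iff[OF assms(1)] by blast
  qed
  have "card ?U = (\<Sum>a\<in>minimals r R. card ((#) a ` {zs \<in> lin_exts r (R - {a}). P (a # zs)}))"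
    using assms by (intro card_UN_disjoint) (auto simp: finite_minimals finite_lin_exts)
  then show ?thesis unfolding eq by (simp add: card_image)
qed

lemma minimals_nonempty:
  assumes "wf r" "R \<noteq> {}"
  shows "minimals r R \<noteq> {}"
proof -
  from wfE_min'[OF assms] obtain a where "a \<in> R" "\<And>b. (b, a) \<in> r \<Longrightarrow> b \<notin> R" by blast
  then show ?thesis by (auto simp: minimals_def)
qed

lemma lin_exts_nonempty:
  assumes "wf r" "finite R"
  shows "lin_exts r R \<noteq> {}"
  using assms(2)
proof (induction R rule: finite_psubset_induct)
  case (psubset R)
  show ?case
  proof (cases "R = {}")
    case False
    from minimals_nonempty[OF assms(1) this] obtain a where a: "a \<in> minimals r R" by blast
    then have "R - {a} \<subset> R" by (auto simp: minimals_def)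
    from psubset.IH[OF this] obtain zs where "zs \<in> lin_exts r (R - {a})" by blast
    with a have "a # zs \<in> lin_exts r R" using Cons_mem_lin_exts_iff[OF assms(1)] by blast
    then show ?thesis by blast
  qed (simp add: lin_exts_empty)
qed

lemma card_lin_exts_pos:
  "wf r \<Longrightarrow> finite R \<Longrightarrow> 0 < card (lin_exts r R)"
  using lin_exts_nonempty finite_lin_exts by (metis card_gt_0_iff)

lemma append_mem_lin_exts:
  assumes "up_closed r R Y" "xs \<in> lin_exts r (R - Y)" "ys \<in> lin_exts r Y"
  shows "xs @ ys \<in> lin_exts r R"
  using assms by (auto simp: lin_exts_def up_closed_def sorted_wrt_append)

text \<open>
  Each linear extension of an up-closed set \<open>Y\<close> is the tail of a linear extension of \<open>R\<close>, and the
  tail determines \<open>Y\<close>.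
\<close>

lemma sum_card_lin_exts_up_closed:
  assumes "wf r" "finite R"
  shows "(\<Sum>Y | up_closed r R Y \<and> card Y = k. card (lin_exts r Y)) \<le> card (lin_exts r R)"
proof -
  define U where "U = {Y. up_closed r R Y \<and> card Y = k}"
  have finU: "finite U" by (rule finite_subset[of _ "Pow R"]) (auto simp: U_def up_closed_def assms)
  have finY: "finite Y" if "Y \<in> U" for Y
    using that assms(2) by (auto simp: U_def up_closed_def intro: finite_subset)
  have "(\<Sum>Y\<in>U. card (lin_exts r Y)) = card (\<Union>Y\<in>U. lin_exts r Y)"
    using finU finY by (intro card_UN_disjoint[symmetric]) (auto simp: finite_lin_exts, auto simp: lin_exts_def)
  also have "\<dots> \<le> card (drop (card R - k) ` lin_exts r R)"
  proof (intro card_mono finite_imageI finite_lin_exts assms subsetI)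
    fix ys assume "ys \<in> (\<Union>Y\<in>U. lin_exts r Y)"
    then obtain Y where Y: "Y \<in> U" "ys \<in> lin_exts r Y" by blast
    obtain xs where xs: "xs \<in> lin_exts r (R - Y)"
      using lin_exts_nonempty[OF assms(1), of "R - Y"] assms(2) by blast
    have "xs @ ys \<in> lin_exts r R" using Y xs by (intro append_mem_lin_exts) (auto simp: U_def)
    moreover have "length xs = card R - k"
      using length_lin_ext[OF xs] Y(1) finY[OF Y(1)] by (auto simp: U_def up_closed_def card_Diff_subset)
    ultimately show "ys \<in> drop (card R - k) ` lin_exts r R" by (intro image_eqI[of _ _ "xs @ ys"]) auto
  qed
  also have "\<dots> \<le> card (lin_exts r R)" by (intro card_image_le finite_lin_exts assms)
  finally show ?thesis by (simp add: U_def)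
qed

section \<open>Correlation of two minimal elements\<close>

text \<open>
  The number of chains \<open>X \<supseteq> Y\<^sub>1 \<supseteq> \<dots> \<supseteq> Y\<^sub>m = {}\<close> of up-closed subsets of \<open>P\<close>; for up-closed \<open>X\<close>
  these are the weakly order-preserving maps from \<open>X\<close> to an \<open>m\<close>-element chain. In contrast to the
  number of linear extensions, this number satisfies a recursion to which the four functions
  theorem applies directly, and it determines the number of linear extensions asymptotically
  as \<open>m\<close> grows.
\<close>

primrec up_chains :: "'a rel \<Rightarrow> 'a set \<Rightarrow> nat \<Rightarrow> 'a set \<Rightarrow> real" where
  "up_chains r P 0 X = of_bool (X = {})"
| "up_chains r P (Suc m) X =
     (\<Sum>Y\<in>Pow P. of_bool (Y \<subseteq> X \<and> up_closed r P Y) * up_chains r P m Y)"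

lemma up_chains_nonneg: "0 \<le> up_chains r P m X"
  by (induction m arbitrary: X) (auto intro!: sum_nonneg)

text \<open>
  The recursion sums \<open>up_chains\<close> against the indicator of \<open>Y \<subseteq> X\<close> and \<open>Y\<close> up-closed, which is
  itself log-supermodular because up-closed sets form a lattice.
\<close>

lemma up_chains_supermodular:
  assumes "finite P"
  shows "up_chains r P m A * up_chains r P m B \<le> up_chains r P m (A \<union> B) * up_chains r P m (A \<inter> B)"
proof (induction m arbitrary: A B)
  case 0
  then show ?case by auto
next
  case (Suc m)
  have up: "up_closed r P (X \<union> Y)" "up_closed r P (X \<inter> Y)"
    if "up_closed r P X" "up_closed r P Y" for X Y
    using that by (auto simp: up_closed_def)
  show ?case unfolding up_chains.simps
  proof (rule four_functions[OF assms])
    fix X Y assume "X \<subseteq> P" "Y \<subseteq> P"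
    show "of_bool (X \<subseteq> A \<and> up_closed r P X) * up_chains r P m X *
        (of_bool (Y \<subseteq> B \<and> up_closed r P Y) * up_chains r P m Y)
      \<le> of_bool (X \<union> Y \<subseteq> A \<union> B \<and> up_closed r P (X \<union> Y)) * up_chains r P m (X \<union> Y) *
        (of_bool (X \<inter> Y \<subseteq> A \<inter> B \<and> up_closed r P (X \<inter> Y)) * up_chains r P m (X \<inter> Y))"
    proof (cases "X \<subseteq> A \<and> up_closed r P X \<and> Y \<subseteq> B \<and> up_closed r P Y")
      case True
      then have "X \<union> Y \<subseteq> A \<union> B" "X \<inter> Y \<subseteq> A \<inter> B" by auto
      with True show ?thesis using Suc.IH[of X Y] up by simp
    next
      case False
      then show ?thesis by (auto simp: up_chains_nonneg)
    qed
  qed (auto simp: up_chains_nonneg)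
qed

lemma up_closed_minus_minimal:
  "up_closed r P X \<Longrightarrow> a \<in> minimals r X \<Longrightarrow> up_closed r P (X - {a})"
  unfolding up_closed_def minimals_def by blast

text \<open>
  Keep only the chains in which each step removes at most one element: they consist of a linear
  extension and a choice of the steps that remove something.
\<close>

lemma up_chains_ge:
  assumes "wf r" "finite P" "up_closed r P X"
  shows "real (card (lin_exts r X) * (m choose card X)) \<le> up_chains r P m X"
  using assms(3)
proof (induction m arbitrary: X)
  case 0
  then show ?case using finite_subset[OF _ assms(2), of X]
    by (cases "X = {}") (auto simp: lin_exts_empty up_closed_def card_gt_0_iff binomial_eq_0)
next
  case (Suc m)
  let ?Z = "\<lambda>Y. of_bool (Y \<subseteq> X \<and> up_closed r P Y) * up_chains r P m Y"
  have finX: "finite X" using Suc.prems assms(2) by (auto simp: up_closed_def intro: finite_subset)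
  have pos: "0 \<le> ?Z Y" for Y by (simp add: up_chains_nonneg)
  show ?case
  proof (cases "X = {}")
    case True
    have "1 \<le> up_chains r P m {}" using Suc.IH[OF Suc.prems] True by (simp add: lin_exts_empty)
    also have "\<dots> = ?Z {}" using Suc.prems True by simp
    also have "\<dots> \<le> sum ?Z (Pow P)"
      using assms(2) by (intro member_le_sum) (auto simp: up_chains_nonneg)
    finally show ?thesis using True by (simp add: lin_exts_empty)
  next
    case False
    then obtain k where k: "card X = Suc k" using finX by (cases "card X") auto
    have rec: "card (lin_exts r X) = (\<Sum>a\<in>minimals r X. card (lin_exts r (X - {a})))"
      using card_lin_exts_rec[OF assms(1) finX False, of "\<lambda>_. True"] by simp
    have inj: "inj_on (\<lambda>a. X - {a}) (minimals r X)" by (auto simp: inj_on_def minimals_def)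
    have "real (card (lin_exts r X) * (Suc m choose card X)) =
      real (card (lin_exts r X) * (m choose card X)) +
      real ((m choose k) * card (lin_exts r X))"
      by (simp add: k algebra_simps)
    also have "real ((m choose k) * card (lin_exts r X)) =
       (\<Sum>a\<in>minimals r X. real (card (lin_exts r (X - {a})) * (m choose card (X - {a}))))"
      unfolding rec sum_distrib_left of_nat_sum
      using k finX by (intro sum.cong) (auto simp: minimals_def card_Diff_singleton)
    also have "\<dots> \<le> (\<Sum>a\<in>minimals r X. up_chains r P m (X - {a}))"
      using Suc.IH[OF up_closed_minus_minimal[OF Suc.prems]] by (intro sum_mono) simp
    also have "\<dots> = sum ?Z ((\<lambda>a. X - {a}) ` minimals r X)"
      unfolding sum.reindex[OF inj] using up_closed_minus_minimal[OF Suc.prems]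
      by (intro sum.cong) auto
    also have "real (card (lin_exts r X) * (m choose card X)) \<le> ?Z X"
      using Suc.IH[OF Suc.prems] Suc.prems by simp
    finally have "real (card (lin_exts r X) * (Suc m choose card X)) \<le>
      ?Z X + sum ?Z ((\<lambda>a. X - {a}) ` minimals r X)" by simp
    \<comment> \<open>Of the sum defining \<open>up_chains\<close>, only the terms for \<open>X\<close> and for \<open>X - {a}\<close> are used, matching Pascal's rule.\<close>
    also have "\<dots> = sum ?Z (insert X ((\<lambda>a. X - {a}) ` minimals r X))"
      using finX by (subst sum.insert) (auto simp: finite_minimals minimals_def)
    also have "\<dots> \<le> sum ?Z (Pow P)"
      using Suc.prems assms(2) by (intro sum_mono2) (auto simp: up_chains_nonneg up_closed_def)
    finally show ?thesis by simp
  qed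
qed

text \<open>
  Every weakly order-preserving map is compatible with some linear extension, and along a linear
  extension it is a weakly monotone sequence. In the induction, sets \<open>Y\<close> of equal size are
  collected by \<open>sum_card_lin_exts_up_closed\<close>, and the binomial coefficients add up by the hockey
  stick identity.
\<close>

lemma up_chains_le:
  assumes "wf r" "finite P" "up_closed r P X"
  shows "up_chains r P m X \<le> real (card (lin_exts r X) * ((m + card X) choose card X))"
  using assms(3)
proof (induction m arbitrary: X)
  case 0
  have "finite X" using 0 assms(2) by (auto simp: up_closed_def intro: finite_subset)
  then have "1 \<le> card (lin_exts r X)" using card_lin_exts_pos[OF assms(1)] by (simp add: Suc_leI)
  then show ?case by (auto simp: lin_exts_empty)
next
  case (Suc m)
  have finX: "finite X" and XP: "X \<subseteq> P" using Suc.prems assms(2) by (auto simp: up_closed_def intro: finite_subset)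
  have up: "up_closed r X Y \<longleftrightarrow> Y \<subseteq> X \<and> up_closed r P Y" for Y
    using Suc.prems unfolding up_closed_def by blast
  define c where "c Y = card (lin_exts r Y) * ((m + card Y) choose card Y)" for Y
  define U where "U = {Y. up_closed r X Y}"
  have finU: "finite U" by (rule finite_subset[of _ "Pow X"]) (auto simp: U_def up_closed_def finX)
  have "up_chains r P (Suc m) X = (\<Sum>Y\<in>U. up_chains r P m Y)"
    unfolding up_chains.simps using assms(2) XP
    by (intro sum.mono_neutral_cong_right) (auto simp: U_def up)
  also have "\<dots> \<le> (\<Sum>Y\<in>U. real (c Y))"
    using Suc.IH unfolding c_def U_def by (intro sum_mono) (auto simp: up)
  also have "\<dots> = real (\<Sum>k\<le>card X. \<Sum>Y | Y \<in> U \<and> card Y = k. c Y)"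
    unfolding of_nat_sum using finU finX
    by (subst sum.group) (auto simp: U_def up_closed_def intro: card_mono)
  also have "(\<Sum>k\<le>card X. \<Sum>Y | Y \<in> U \<and> card Y = k. c Y) \<le>
      (\<Sum>k\<le>card X. card (lin_exts r X) * ((m + k) choose k))"
  proof (rule sum_mono)
    fix k
    have "(\<Sum>Y | Y \<in> U \<and> card Y = k. c Y) =
      (\<Sum>Y | Y \<in> U \<and> card Y = k. card (lin_exts r Y)) * ((m + k) choose k)"
      unfolding sum_distrib_right by (intro sum.cong) (auto simp: c_def)
    then show "(\<Sum>Y | Y \<in> U \<and> card Y = k. c Y) \<le> card (lin_exts r X) * ((m + k) choose k)"
      using sum_card_lin_exts_up_closed[OF assms(1) finX, of k] by (simp add: U_def)
  qed
  also have "\<dots> = card (lin_exts r X) * ((Suc m + card X) choose card X)"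
    using sum_choose_lower[of m "card X"] by (simp flip: sum_distrib_left)
  finally show ?case by simp
qed

lemma binomial_asymptotic:
  "(\<lambda>m. real ((m + c) choose j) / real m ^ j) \<longlonglongrightarrow> 1 / fact j"
proof -
  have "(\<lambda>m. (\<Prod>i=0..<j. (real (m + c) - real i) / real m) / fact j) \<longlonglongrightarrow> (\<Prod>i=0..<j. 1) / fact j"
  proof (intro tendsto_divide tendsto_prod tendsto_const)
    fix i
    have "(\<lambda>m. 1 + (real c - real i) * inverse (real m)) \<longlonglongrightarrow> 1 + (real c - real i) * 0"
      by (intro tendsto_intros LIMSEQ_inverse_real_of_nat lim_inverse_n)
    moreover have "eventually (\<lambda>m. 1 + (real c - real i) * inverse (real m) = (real (m + c) - real i) / real m) sequentially"
      using eventually_gt_at_top[of 0] by eventually_elim (auto simp: field_simps)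
    ultimately show "(\<lambda>m. (real (m + c) - real i) / real m) \<longlonglongrightarrow> 1"
      using Lim_transform_eventually by fastforce
  qed auto
  then show ?thesis
    by (simp add: binomial_gbinomial gbinomial_prod_rev prod_dividef mult.commute)
qed

text \<open>
  Read as \<open>e(R - a) / e(R) \<le> e(R - b - a) / e(R - b)\<close>: in a uniformly random linear extension,
  taking away the minimal element \<open>b\<close> makes it more likely that \<open>a\<close> comes first. The bounds on
  \<open>up_chains\<close> differ by a factor tending to 1 as \<open>m\<close> grows, so the inequality passes from
  \<open>up_chains\<close> to linear extensions with the additional constant
  \<open>(q + 2)! * q! / (q + 1)!\<^sup>2 \<ge> 1\<close> on the left, where \<open>q = card R - 2\<close>.
\<close>

lemma lin_exts_log_supermodular:
  assumes "wf r" "finite R" "a \<in> minimals r R" "b \<in> minimals r R" "a \<noteq> b"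
  shows "card (lin_exts r (R - {a})) * card (lin_exts r (R - {b})) \<le>
     card (lin_exts r R) * card (lin_exts r (R - {a} - {b}))"
proof -
  let ?e = "\<lambda>X. real (card (lin_exts r X))"
  have R: "up_closed r R R" by (simp add: up_closed_def)
  have ab: "b \<in> minimals r (R - {a})" using assms by (auto simp: minimals_def)
  note up = R up_closed_minus_minimal[OF R assms(3)] up_closed_minus_minimal[OF R assms(4)]
    up_closed_minus_minimal[OF up_closed_minus_minimal[OF R assms(3)] ab]
  have mem: "a \<in> R" "b \<in> R" using assms by (auto simp: minimals_def)
  have "card {a, b} \<le> card R" using mem assms(2) by (intro card_mono) auto
  then obtain q where q: "card R = q + 2" using assms(5) by (metis card_2_iff le_iff_add add.commute)
  have cards: "card (R - {a}) = q + 1" "card (R - {b}) = q + 1" "card (R - {a} - {b}) = q"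
    using q mem assms(2,5) by auto
  have ineq: "?e (R - {a}) * ?e (R - {b}) * ((real (m choose (q + 1)) / real m ^ (q + 1)))\<^sup>2 \<le>
     ?e R * ?e (R - {a} - {b}) * ((real ((m + (q + 2)) choose (q + 2)) / real m ^ (q + 2)) * (real ((m + q) choose q) / real m ^ q))"
    for m
  proof -
    note ge = up_chains_ge[OF assms(1,2) up(2), of m] up_chains_ge[OF assms(1,2) up(3), of m]
    note le = up_chains_le[OF assms(1,2) up(1), of m] up_chains_le[OF assms(1,2) up(4), of m]
    have "real (card (lin_exts r (R - {a})) * (m choose (q + 1))) * real (card (lin_exts r (R - {b})) * (m choose (q + 1)))
       \<le> up_chains r R m (R - {a}) * up_chains r R m (R - {b})"
      using ge by (intro mult_mono) (auto simp: cards up_chains_nonneg)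
    also have "\<dots> \<le> up_chains r R m ((R - {a}) \<union> (R - {b})) * up_chains r R m ((R - {a}) \<inter> (R - {b}))"
      by (rule up_chains_supermodular[OF assms(2)])
    also have "(R - {a}) \<union> (R - {b}) = R" using assms(5) mem by auto
    also have "(R - {a}) \<inter> (R - {b}) = R - {a} - {b}" by auto
    also have "up_chains r R m R * up_chains r R m (R - {a} - {b}) \<le>
       real (card (lin_exts r R) * ((m + (q + 2)) choose (q + 2))) * real (card (lin_exts r (R - {a} - {b})) * ((m + q) choose q))"
      using le unfolding q cards by (intro mult_mono) (auto simp: up_chains_nonneg)
    finally have "?e (R - {a}) * ?e (R - {b}) * (real (m choose (q + 1)))\<^sup>2 \<le>
      ?e R * ?e (R - {a} - {b}) * (real ((m + (q + 2)) choose (q + 2)) * real ((m + q) choose q))"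
      by (simp add: power2_eq_square algebra_simps)
    then have "(?e (R - {a}) * ?e (R - {b}) * (real (m choose (q + 1)))\<^sup>2) / real m ^ (2 * q + 2) \<le>
      (?e R * ?e (R - {a} - {b}) * (real ((m + (q + 2)) choose (q + 2)) * real ((m + q) choose q))) / real m ^ (2 * q + 2)"
      by (rule divide_right_mono) simp
    moreover have "real m ^ (2 * q + 2) = (real m ^ (q + 1))\<^sup>2" "real m ^ (2 * q + 2) = real m ^ (q + 2) * real m ^ q"
      by (simp_all add: power_add power_mult power2_eq_square algebra_simps)
    ultimately show ?thesis by (simp add: power_divide)
  qed
  have "?e (R - {a}) * ?e (R - {b}) * (1 / fact (q + 1))\<^sup>2 \<le> ?e R * ?e (R - {a} - {b}) * ((1 / fact (q + 2)) * (1 / fact q))"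
    using binomial_asymptotic[of 0 "q + 1"] ineq
    by (intro tendsto_le[OF _ tendsto_mult[OF tendsto_const tendsto_mult[OF binomial_asymptotic[of "q + 2" "q + 2"] binomial_asymptotic[of q q]]]
          tendsto_mult[OF tendsto_const tendsto_power[of "\<lambda>m. real (m choose (q + 1)) / real m ^ (q + 1)"]]])
       (auto intro!: always_eventually simp del: power_Suc)
  also have "\<dots> \<le> ?e R * ?e (R - {a} - {b}) * (1 / fact (q + 1))\<^sup>2"
  proof (rule mult_left_mono)
    have "(fact (q + 1) :: real)\<^sup>2 \<le> fact (q + 2) * fact q"
      by (simp add: power2_eq_square field_simps)
    then show "(1 / fact (q + 2)) * (1 / fact q) \<le> (1 / fact (q + 1) :: real)\<^sup>2"
      by (simp add: power_divide frac_le)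
  qed simp
  finally have "?e (R - {a}) * ?e (R - {b}) \<le> ?e R * ?e (R - {a} - {b})" by (simp add: mult_le_cancel_right)
  then show ?thesis by (metis of_nat_le_iff of_nat_mult)
qed

section \<open>A minimal element followed closely by an upper one\<close>

text \<open>
  To be read with \<open>zs\<close> as the elements listed after \<open>y\<close>.
\<close>

definition early :: "'a rel \<Rightarrow> 'a \<Rightarrow> nat \<Rightarrow> 'a list \<Rightarrow> bool" where
  "early r y t zs \<longleftrightarrow> (\<exists>z\<in>set (take t zs). (y, z) \<in> r)"

text \<open>
  Write \<open>e(R)\<close> for the number of linear extensions and put \<open>E = e(R) / e(R - y)\<close>, the mean number of
  places at which \<open>y\<close> can be inserted into a random linear extension of \<open>R - y\<close>; this number is
  one more than the number of elements preceding the first element above \<open>y\<close>. After \<open>t\<close> steps that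
  avoid the elements above \<open>y\<close>, what is left is a poset of the same kind, whose mean is at most \<open>E\<close>
  by \<open>lin_exts_log_supermodular\<close>. Hence \<open>E \<le> t + p * E\<close>, where \<open>p\<close> is the probability that the
  first \<open>t\<close> elements are not above \<open>y\<close>; the statement is this inequality multiplied by \<open>e(R - y)\<close>.
\<close>

lemma lin_exts_insertion_bound:
  assumes "wf r" "finite R" "y \<in> minimals r R"
  shows "real (card (lin_exts r R)) \<le> real t * real (card (lin_exts r (R - {y}))) +
    real (card (lin_exts r R)) / real (card (lin_exts r (R - {y}))) *
    real (card {zs \<in> lin_exts r (R - {y}). \<not> early r y t zs})"
  using assms(2,3)
proof (induction t arbitrary: R)
  case 0
  then have "0 < card (lin_exts r (R - {y}))" using card_lin_exts_pos[OF assms(1)] by simp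
  then show ?case by (simp add: early_def)
next
  case (Suc t)
  define e where "e X = real (card (lin_exts r X))" for X
  define g where "g X t = real (card {zs \<in> lin_exts r (X - {y}). \<not> early r y t zs})" for X t
  have epos: "0 < e X" if "finite X" for X
    using card_lin_exts_pos[OF assms(1) that] by (simp add: e_def)
  have yR: "y \<in> R" using Suc.prems by (simp add: minimals_def)
  let ?M = "minimals r R - {y}"
  have finM: "finite (minimals r R)" by (simp add: finite_minimals Suc.prems)
  have IH: "e (R - {c}) \<le> real t * e (R - {c} - {y}) + e R / e (R - {y}) * g (R - {c}) t"
    if c: "c \<in> ?M" for c
  proof -
    have ne: "y \<noteq> c" using c by auto
    have y: "y \<in> minimals r (R - {c})" using c Suc.prems by (auto simp: minimals_def)
    have "e (R - {y}) * e (R - {c}) \<le> e R * e (R - {y} - {c})"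
      using lin_exts_log_supermodular[OF assms(1) Suc.prems, of c] c ne
      unfolding e_def by (simp flip: of_nat_mult)
    moreover have "R - {y} - {c} = R - {c} - {y}" by auto
    ultimately have "e (R - {c}) / e (R - {c} - {y}) \<le> e R / e (R - {y})"
      using epos Suc.prems(1) by (simp add: field_simps)
    then have "e (R - {c}) / e (R - {c} - {y}) * g (R - {c}) t \<le> e R / e (R - {y}) * g (R - {c}) t"
      by (rule mult_right_mono) (simp add: g_def)
    then show ?thesis using Suc.IH[OF _ y] Suc.prems(1) unfolding e_def g_def by simp
  qed
  have rec: "card (lin_exts r R) = (\<Sum>c\<in>minimals r R. card (lin_exts r (R - {c})))"
    using card_lin_exts_rec[OF assms(1) Suc.prems(1), of "\<lambda>_. True"] yR by auto
  have Mfree: "{c \<in> minimals r (R - {y}). (y, c) \<notin> r} = ?M"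
    using Suc.prems(2) by (auto simp: minimals_def)
  have sub: "?M \<subseteq> minimals r (R - {y})" by (auto simp: minimals_def)
  have finM': "finite (minimals r (R - {y}))" by (simp add: finite_minimals Suc.prems)
  have sum_e: "(\<Sum>c\<in>?M. e (R - {c} - {y})) \<le> e (R - {y})"
  proof (cases "R - {y} = {}")
    case True
    then have M: "?M = {}" by (auto simp: minimals_def)
    show ?thesis unfolding M by (simp add: e_def)
  next
    case False
    have "(\<Sum>c\<in>?M. e (R - {c} - {y})) = (\<Sum>c\<in>?M. e (R - {y} - {c}))"
      by (intro sum.cong arg_cong[where f = e]) auto
    also have "\<dots> \<le> (\<Sum>c\<in>minimals r (R - {y}). e (R - {y} - {c}))"
      using sub finM' by (intro sum_mono2) (auto simp: e_def)
    also have "\<dots> = e (R - {y})"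
      using card_lin_exts_rec[OF assms(1) _ False, of "\<lambda>_. True"] Suc.prems(1) by (simp add: e_def)
    finally show ?thesis .
  qed
  have sum_g: "(\<Sum>c\<in>?M. g (R - {c}) t) \<le> g R (Suc t)"
  proof (cases "R - {y} = {}")
    case True
    then have M: "?M = {}" by (auto simp: minimals_def)
    show ?thesis unfolding M by (simp add: g_def)
  next
    case False
    have "(\<Sum>c\<in>?M. g (R - {c}) t) = (\<Sum>c\<in>?M. real (card {zs \<in> lin_exts r (R - {y} - {c}). \<not> early r y (Suc t) (c # zs)}))"
    proof (intro sum.cong refl)
      fix c assume c: "c \<in> ?M"
      then have "(y, c) \<notin> r" using Mfree by auto
      moreover have "R - {c} - {y} = R - {y} - {c}" by auto
      ultimately show "g (R - {c}) t = real (card {zs \<in> lin_exts r (R - {y} - {c}). \<not> early r y (Suc t) (c # zs)})"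
        by (simp add: g_def early_def)
    qed
    also have "\<dots> \<le> (\<Sum>c\<in>minimals r (R - {y}). real (card {zs \<in> lin_exts r (R - {y} - {c}). \<not> early r y (Suc t) (c # zs)}))"
      using sub finM' by (intro sum_mono2) auto
    also have "\<dots> = g R (Suc t)"
      using card_lin_exts_rec[OF assms(1) _ False, of "\<lambda>zs. \<not> early r y (Suc t) zs"] Suc.prems(1)
      by (simp add: g_def)
    finally show ?thesis .
  qed
  have "e R = e (R - {y}) + (\<Sum>c\<in>?M. e (R - {c}))"
    using rec Suc.prems(2) finM by (simp add: e_def sum.remove)
  also have "(\<Sum>c\<in>?M. e (R - {c})) \<le>
      (\<Sum>c\<in>?M. real t * e (R - {c} - {y}) + e R / e (R - {y}) * g (R - {c}) t)"
    by (intro sum_mono IH)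
  also have "\<dots> = real t * (\<Sum>c\<in>?M. e (R - {c} - {y})) + e R / e (R - {y}) * (\<Sum>c\<in>?M. g (R - {c}) t)"
    by (simp add: sum.distrib sum_distrib_left)
  also have "\<dots> \<le> real t * e (R - {y}) + e R / e (R - {y}) * g R (Suc t)"
    using sum_e sum_g by (intro add_mono mult_left_mono) (auto simp: e_def)
  finally show ?case unfolding e_def g_def by (simp add: algebra_simps)
qed

text \<open>
  Divided by \<open>e(R)\<^sup>2\<close>: the probability that \<open>y\<close> comes first and is followed within \<open>t\<close> steps by an
  element above it is at most \<open>t\<close> times the squared probability that \<open>y\<close> comes first.
\<close>

lemma card_early_le:
  assumes "wf r" "finite R" "y \<in> minimals r R"
  shows "real (card {zs \<in> lin_exts r (R - {y}). early r y t zs}) * real (card (lin_exts r R))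
    \<le> real t * (real (card (lin_exts r (R - {y}))))\<^sup>2"
proof -
  define e where "e = real (card (lin_exts r R))"
  define e' where "e' = real (card (lin_exts r (R - {y})))"
  define h where "h = real (card {zs \<in> lin_exts r (R - {y}). early r y t zs})"
  define g where "g = real (card {zs \<in> lin_exts r (R - {y}). \<not> early r y t zs})"
  have "0 < e'" using card_lin_exts_pos[OF assms(1)] assms(2) by (simp add: e'_def)
  have "lin_exts r (R - {y}) = {zs \<in> lin_exts r (R - {y}). early r y t zs} \<union>
     {zs \<in> lin_exts r (R - {y}). \<not> early r y t zs}" by auto
  then have "card (lin_exts r (R - {y})) = card {zs \<in> lin_exts r (R - {y}). early r y t zs} +
     card {zs \<in> lin_exts r (R - {y}). \<not> early r y t zs}"
    by (subst card_Un_disjoint[symmetric]) (auto simp: finite_lin_exts assms)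
  then have "e' = h + g" by (simp add: e'_def h_def g_def)
  moreover have "e \<le> t * e' + e / e' * g"
    using lin_exts_insertion_bound[OF assms, of t] by (simp add: e_def e'_def g_def)
  then have "e * e' \<le> (t * e' + e / e' * g) * e'" using \<open>0 < e'\<close> by (intro mult_right_mono) auto
  then have "e * e' \<le> t * e' * e' + e * g" using \<open>0 < e'\<close> by (simp add: algebra_simps)
  ultimately have "h * e \<le> t * e'\<^sup>2" by (simp add: algebra_simps power2_eq_square)
  then show ?thesis by (simp add: e_def e'_def h_def)
qed

text \<open>
  The classes \<open>c = i\<close> are needed later because single labels carry no probability, while small
  intervals of labels do. Within a class, a sum of squares is at most the square of the sum.
\<close>

lemma square_card_early_le:
  fixes c :: "'a \<Rightarrow> nat"
  assumes "wf r" "finite R" "R \<noteq> {}" and c: "\<And>y. y \<in> R \<Longrightarrow> Q y \<Longrightarrow> c y < m"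
  shows "(real (card {ys \<in> lin_exts r R. Q (hd ys) \<and> early r (hd ys) t (tl ys)}))\<^sup>2 \<le>
    real t * (\<Sum>i<m. (real (card {ys \<in> lin_exts r R. Q (hd ys) \<and> c (hd ys) = i}))\<^sup>2)"
proof -
  define e where "e X = real (card (lin_exts r X))" for X
  define h where "h y = real (card {zs \<in> lin_exts r (R - {y}). early r y t zs})" for y
  let ?M = "{y \<in> minimals r R. Q y}"
  let ?B = "real (card {ys \<in> lin_exts r R. Q (hd ys) \<and> early r (hd ys) t (tl ys)})"
  have finM: "finite (minimals r R)" by (simp add: finite_minimals assms)
  have split: "real (card {zs \<in> lin_exts r (R - {y}). Q y \<and> P zs}) =
      (if Q y then real (card {zs \<in> lin_exts r (R - {y}). P zs}) else 0)" for y P by simp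
  have B: "?B = (\<Sum>y\<in>?M. h y)"
    unfolding card_lin_exts_rec[OF assms(1-3)] of_nat_sum list.sel split h_def
    using finM by (simp add: sum.If_cases Int_def)
  have C: "real (card {ys \<in> lin_exts r R. Q (hd ys) \<and> c (hd ys) = i}) = (\<Sum>y\<in>{y\<in>?M. c y = i}. e (R - {y}))" for i
  proof -
    have "real (card {ys \<in> lin_exts r R. Q (hd ys) \<and> c (hd ys) = i}) =
      (\<Sum>y\<in>minimals r R. if Q y \<and> c y = i then e (R - {y}) else 0)"
      unfolding card_lin_exts_rec[OF assms(1-3)] of_nat_sum list.sel
      by (intro sum.cong) (auto simp: e_def)
    then show ?thesis using finM by (simp add: sum.If_cases Int_def conj_ac)
  qed
  have "?B \<le> e R" unfolding e_def by (intro of_nat_mono card_mono) (auto simp: finite_lin_exts assms)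
  then have "?B\<^sup>2 \<le> ?B * e R" by (simp add: power2_eq_square mult_left_mono)
  also have "\<dots> = (\<Sum>y\<in>?M. h y * e R)" unfolding B by (simp add: sum_distrib_right)
  also have "\<dots> \<le> (\<Sum>y\<in>?M. real t * (e (R - {y}))\<^sup>2)"
    using card_early_le[OF assms(1,2)] unfolding h_def e_def by (intro sum_mono) auto
  also have "\<dots> = real t * (\<Sum>y\<in>?M. (e (R - {y}))\<^sup>2)" by (simp add: sum_distrib_left)
  also have "(\<Sum>y\<in>?M. (e (R - {y}))\<^sup>2) = (\<Sum>i<m. \<Sum>y\<in>{y\<in>?M. c y = i}. (e (R - {y}))\<^sup>2)"
    using assms(2) c by (subst sum.group) (auto simp: minimals_def)
  also have "\<dots> \<le> (\<Sum>i<m. (\<Sum>y\<in>{y\<in>?M. c y = i}. e (R - {y}))\<^sup>2)"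
  proof (intro sum_mono)
    fix i
    let ?N = "{y\<in>?M. c y = i}"
    have "(\<Sum>y\<in>?N. (e (R - {y}))\<^sup>2) \<le> (\<Sum>y\<in>?N. e (R - {y}) * (\<Sum>y\<in>?N. e (R - {y})))"
      unfolding power2_eq_square using finM
      by (intro sum_mono mult_left_mono member_le_sum) (auto simp: e_def)
    then show "(\<Sum>y\<in>?N. (e (R - {y}))\<^sup>2) \<le> (\<Sum>y\<in>?N. e (R - {y}))\<^sup>2"
      by (simp add: power2_eq_square sum_distrib_right)
  qed
  finally show ?thesis unfolding C by (simp add: mult_left_mono)
qed

section \<open>Linear extensions as lists and as permutations\<close>

lemma linear_extension_of_list:
  assumes xs: "xs \<in> lin_exts r {..<n}" and less: "\<And>i j. (i, j) \<in> r \<Longrightarrow> i < j"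
  shows "linear_extension n r (\<lambda>i. if i < n then xs ! i else i)" (is "linear_extension n r ?l")
proof -
  have d: "distinct xs" "set xs = {..<n}" and s: "sorted_wrt (\<lambda>a b. (b, a) \<notin> r) xs"
    using xs by (auto simp: lin_exts_def)
  have len: "length xs = n" using length_lin_ext[OF xs] by simp
  have "bij_betw ((!) xs) {..<n} {..<n}" using bij_betw_nth[OF d(1)] len d(2) by simp
  then have "bij_betw ?l {..<n} {..<n}" by (rule bij_betw_cong[THEN iffD1, rotated]) simp
  then have "?l permutes {..<n}" by (rule bij_imp_permutes) simp
  moreover have "i < j" if "i < n" "j < n" "(xs ! i, xs ! j) \<in> r" for i j
  proof (rule ccontr)
    assume "\<not> i < j"
    then consider "j < i" | "i = j" by linarith
    then show False
    proof cases
      case 1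
      then show False using sorted_wrt_nth_less[OF s 1] that len by auto
    next
      case 2
      then show False using that(3) less by fastforce
    qed
  qed
  ultimately show ?thesis by (auto simp: linear_extension_def)
qed

lemma list_of_linear_extension:
  assumes l: "linear_extension n r l"
  shows "map l [0..<n] \<in> lin_exts r {..<n}"
proof -
  have p: "l permutes {..<n}" using l by (simp add: linear_extension_def)
  have "distinct (map l [0..<n])"
    using permutes_inj_on[OF p] by (simp add: distinct_map)
  moreover have "set (map l [0..<n]) = {..<n}"
    using permutes_image[OF p] by (simp add: atLeast0LessThan)
  moreover have "sorted_wrt (\<lambda>a b. (b, a) \<notin> r) (map l [0..<n])"
    unfolding sorted_wrt_iff_nth_less
  proof (intro allI impI notI)
    fix i j assume "i < j" "j < length (map l [0..<n])" "(map l [0..<n] ! j, map l [0..<n] ! i) \<in> r"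
    then have "i < j" "i < n" "j < n" "(l j, l i) \<in> r" by auto
    then have "j < i" using l by (simp add: linear_extension_def)
    then show False using \<open>i < j\<close> by simp
  qed
  ultimately show ?thesis by (simp add: lin_exts_def)
qed

lemma lin_exts_suffix: "p @ q \<in> lin_exts r X \<Longrightarrow> q \<in> lin_exts r (X - set p)"
  by (auto simp: lin_exts_def sorted_wrt_append)

lemma lin_exts_replace_suffix:
  "p @ q \<in> lin_exts r X \<Longrightarrow> q' \<in> lin_exts r (set q) \<Longrightarrow> p @ q' \<in> lin_exts r X"
  by (auto simp: lin_exts_def sorted_wrt_append)

text \<open>
  Fixing how a linear extension starts leaves a linear extension of the remaining elements,
  without further restriction.
\<close>

lemma bij_betw_linear_extensions_prefix:
  assumes less: "\<And>i j. (i, j) \<in> r \<Longrightarrow> i < j" and l0: "linear_extension n r l0" and "k \<le> n"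
  shows "bij_betw (\<lambda>l. map l [k..<n]) {l. linear_extension n r l \<and> (\<forall>i<k. l i = l0 i)}
    (lin_exts r ({..<n} - l0 ` {..<k}))"
proof (rule bij_betw_imageI)
  let ?B = "{l. linear_extension n r l \<and> (\<forall>i<k. l i = l0 i)}"
  have upt: "[0..<n] = [0..<k] @ [k..<n]" using \<open>k \<le> n\<close> by (metis le0 le_Suc_ex upt_add_eq_append)
  note xs0 = list_of_linear_extension[OF l0]
  have img: "set (map l0 [0..<k]) = l0 ` {..<k}" by (simp add: atLeast0LessThan)
  show "inj_on (\<lambda>l. map l [k..<n]) ?B"
  proof (rule inj_onI, rule ext)
    fix l l' i assume B: "l \<in> ?B" "l' \<in> ?B" and eq: "map l [k..<n] = map l' [k..<n]"
    from B have p: "l permutes {..<n}" "l' permutes {..<n}" by (simp_all add: linear_extension_def)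
    from B have low: "l i = l' i" if "i < k" using that by simp
    have mid: "l i = l' i" if "k \<le> i" "i < n"
    proof -
      have "\<forall>j\<in>set [k..<n]. l j = l' j" using eq by (simp only: map_eq_conv)
      then show ?thesis using that by simp
    qed
    have high: "l i = l' i" if "n \<le> i" using that permutes_not_in[OF p(1)] permutes_not_in[OF p(2)] by simp
    show "l i = l' i" using low mid high by linarith
  qed
  show "(\<lambda>l. map l [k..<n]) ` ?B = lin_exts r ({..<n} - l0 ` {..<k})"
  proof (intro equalityI subsetI)
    fix ys assume "ys \<in> (\<lambda>l. map l [k..<n]) ` ?B"
    then obtain l where l: "linear_extension n r l" "\<forall>i<k. l i = l0 i" and ys: "ys = map l [k..<n]" by auto
    have eq: "map l [0..<k] = map l0 [0..<k]" using l(2) by auto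
    have "map l0 [0..<k] @ ys \<in> lin_exts r {..<n}"
      using list_of_linear_extension[OF l(1)] by (simp only: upt map_append eq ys)
    then show "ys \<in> lin_exts r ({..<n} - l0 ` {..<k})"
      unfolding img[symmetric] by (rule lin_exts_suffix)
  next
    fix ys assume ys: "ys \<in> lin_exts r ({..<n} - l0 ` {..<k})"
    let ?xs = "map l0 [0..<k] @ ys"
    have pq: "map l0 [0..<k] @ map l0 [k..<n] \<in> lin_exts r {..<n}" using xs0 by (simp only: upt map_append)
    have "set (map l0 [k..<n]) = {..<n} - l0 ` {..<k}"
      using lin_exts_suffix[OF pq] unfolding img[symmetric] by (simp add: lin_exts_def)
    then have xs: "?xs \<in> lin_exts r {..<n}"
      using ys by (intro lin_exts_replace_suffix[OF pq]) simp
    let ?l = "\<lambda>i. if i < n then ?xs ! i else i"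
    have "?l \<in> ?B" using linear_extension_of_list[OF xs less] \<open>k \<le> n\<close> by (auto simp: nth_append)
    moreover have "map ?l [k..<n] = ys"
    proof (rule nth_equalityI)
      have "length ?xs = n" using length_lin_ext[OF xs] by simp
      then show len: "length (map ?l [k..<n]) = length ys" by simp
    qed (auto simp: nth_append)
    ultimately show "ys \<in> (\<lambda>l. map l [k..<n]) ` ?B" by (metis (no_types, lifting) image_eqI)
  qed
qed

section \<open>Re-enumerating a labelled causal set\<close>

text \<open>
  The same labelled poset with its elements listed in the order \<open>l 0, l 1, \<dots>\<close>; it stays in
  \<open>Omega\<close> exactly when \<open>l\<close> lists every element after those below it.
\<close>

definition relabel :: "(nat \<Rightarrow> nat) \<Rightarrow> (nat \<Rightarrow> real) \<times> nat rel \<Rightarrow> (nat \<Rightarrow> real) \<times> nat rel" where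
  "relabel l = (\<lambda>(x, r). (\<lambda>i. x (l i), {(i, j). (l i, l j) \<in> r}))"

lemma fst_relabel [simp]: "fst (relabel l \<omega>) i = fst \<omega> (l i)"
  by (simp add: relabel_def case_prod_beta)

lemma mem_snd_relabel [simp]: "(i, j) \<in> snd (relabel l \<omega>) \<longleftrightarrow> (l i, l j) \<in> snd \<omega>"
  by (simp add: relabel_def case_prod_beta)

lemma Omega_eqI:
  "(\<And>i. fst \<omega> i = fst \<omega>' i) \<Longrightarrow> (\<And>i j. (i, j) \<in> snd \<omega> \<longleftrightarrow> (i, j) \<in> snd \<omega>') \<Longrightarrow> \<omega> = \<omega>'"
  by (intro prod_eqI) auto

lemma relabel_relabel: "relabel m (relabel l \<omega>) = relabel (l \<circ> m) \<omega>"
  by (rule Omega_eqI) auto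

lemma relabel_id: "relabel id \<omega> = \<omega>"
  by (rule Omega_eqI) auto

lemma Omega_less: "\<omega> \<in> Omega \<Longrightarrow> (i, j) \<in> snd \<omega> \<Longrightarrow> i < j"
  by (auto simp: Omega_def suborder_on_def)

lemma Omega_trans: "\<omega> \<in> Omega \<Longrightarrow> (i, j) \<in> snd \<omega> \<Longrightarrow> (j, k) \<in> snd \<omega> \<Longrightarrow> (i, k) \<in> snd \<omega>"
  by (auto simp: Omega_def suborder_on_def poset_on_def dest: transD)

lemma Omega_label: "\<omega> \<in> Omega \<Longrightarrow> fst \<omega> i \<in> {0..1}"
  by (auto simp: Omega_def)

lemma Omega_iff:
  "\<omega> \<in> Omega \<longleftrightarrow> (\<forall>i. fst \<omega> i \<in> {0..1}) \<and> (\<forall>i j. (i, j) \<in> snd \<omega> \<longrightarrow> i < j) \<and>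
     (\<forall>i j k. (i, j) \<in> snd \<omega> \<longrightarrow> (j, k) \<in> snd \<omega> \<longrightarrow> (i, k) \<in> snd \<omega>)"
  by (cases \<omega>) (auto simp: Omega_def suborder_on_def poset_on_def irrefl_def trans_def)

lemma permutes_lessThan_iff: "l permutes {..<n} \<Longrightarrow> l i < (n::nat) \<longleftrightarrow> i < n"
  using permutes_in_image[of l "{..<n}" i] by simp

text \<open>
  A permutation of the first \<open>n\<close> indices that is a linear extension there is one of the whole
  order: an index from \<open>n\<close> on stays in place, and nothing at a later position is below it.
\<close>

lemma linear_extension_less:
  assumes "linear_extension n r l" "\<And>i j. (i, j) \<in> r \<Longrightarrow> i < j" "(l i, l j) \<in> r"
  shows "i < j"
proof -
  have l: "l permutes {..<n}" using assms(1) by (simp add: linear_extension_def)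
  note iff = permutes_lessThan_iff[OF l]
  have lt: "l i < l j" by (rule assms(2)[OF assms(3)])
  show ?thesis
  proof (cases "j < n")
    case True
    then have "i < n" using lt iff[of i] iff[of j] by linarith
    then show ?thesis using True assms by (auto simp: linear_extension_def)
  next
    case False
    then have lj: "l j = j" using l by (auto simp: permutes_def)
    show ?thesis
    proof (cases "i < n")
      case False
      then have "l i = i" using l by (auto simp: permutes_def)
      then show ?thesis using lt lj by simp
    qed (use False in simp)
  qed
qed

lemma linear_extension_mono:
  assumes "linear_extension n r l" "\<And>i j. (i, j) \<in> r \<Longrightarrow> i < j" "n \<le> m"
  shows "linear_extension m r l"
  using linear_extension_less[OF assms(1,2)] assms(1,3)
  by (auto simp: linear_extension_def intro: permutes_subset)

lemma linear_extension_restrict: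
  "linear_extension n (r \<inter> ({..<n} \<times> {..<n})) l \<longleftrightarrow> linear_extension n r l"
  by (auto simp: linear_extension_def permutes_lessThan_iff)

lemma relabel_Omega:
  assumes "\<omega> \<in> Omega" "linear_extension n (snd \<omega>) l"
  shows "relabel l \<omega> \<in> Omega"
  unfolding Omega_iff
  using linear_extension_less[OF assms(2) Omega_less[OF assms(1)]] assms(1)
  by (auto simp: Omega_label[unfolded atLeastAtMost_iff] dest: Omega_trans)

lemma linear_extension_inv:
  assumes "\<omega> \<in> Omega" "linear_extension n (snd \<omega>) l"
  shows "linear_extension n (snd (relabel l \<omega>)) (inv l)"
proof -
  have l: "l permutes {..<n}" using assms by (simp add: linear_extension_def)
  then show ?thesis using Omega_less[OF assms(1)]
    by (auto simp: linear_extension_def permutes_inv permutes_inverses)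
qed

lemma relabel_inv:
  assumes "linear_extension n r l"
  shows "relabel (inv l) (relabel l \<omega>) = \<omega>"
proof -
  have "l permutes {..<n}" using assms by (simp add: linear_extension_def)
  then have "l \<circ> inv l = id" by (rule permutes_inv_o)
  then show ?thesis by (simp add: relabel_relabel relabel_id)
qed

lemma linear_extension_relabel_iff:
  assumes "l permutes {..<n}"
  shows "linear_extension n (snd (relabel l \<omega>)) m \<longleftrightarrow> linear_extension n (snd \<omega>) (l \<circ> m)"
proof -
  have "m permutes {..<n} \<longleftrightarrow> (l \<circ> m) permutes {..<n}"
  proof
    assume "(l \<circ> m) permutes {..<n}"
    then have "(inv l \<circ> (l \<circ> m)) permutes {..<n}"
      by (rule permutes_compose) (rule permutes_inv[OF assms])
    then show "m permutes {..<n}" by (simp add: o_assoc permutes_inv_o[OF assms])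
  qed (rule permutes_compose[OF _ assms])
  then show ?thesis by (auto simp: linear_extension_def)
qed

lemma finite_suborders: "finite {s. suborder_on {..<k} s}"
  by (rule finite_subset[of _ "Pow ({..<k} \<times> {..<k})"]) (auto simp: suborder_on_def poset_on_def)

lemma suborder_on_restrict:
  assumes "\<omega> \<in> Omega"
  shows "suborder_on {..<k} (snd \<omega> \<inter> ({..<k} \<times> {..<k}))"
proof -
  have "irrefl (snd \<omega> \<inter> ({..<k} \<times> {..<k}))"
    using Omega_less[OF assms] by (fastforce simp: irrefl_def)
  moreover have "trans (snd \<omega> \<inter> ({..<k} \<times> {..<k}))"
    by (rule transI) (use Omega_trans[OF assms] in blast)
  ultimately show ?thesis
    using Omega_less[OF assms] by (auto simp: suborder_on_def poset_on_def)
qed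

lemma basic_event_sets:
  "borel_labels k B \<Longrightarrow> suborder_on {..<k} s \<Longrightarrow> basic_event k B s \<in> sets Omega_space"
  unfolding sets_Omega_space by (intro sigma_sets.Basic) blast

lemma mem_basic_event:
  "\<omega> \<in> basic_event k B s \<longleftrightarrow> \<omega> \<in> Omega \<and> (\<forall>i<k. fst \<omega> i \<in> B i) \<and> snd \<omega> \<inter> ({..<k} \<times> {..<k}) = s"
  by (auto simp: basic_event_def case_prod_beta)

section \<open>Measurability of labels, order and re-enumeration\<close>

lemma label_measurable [measurable]: "(\<lambda>\<omega>. fst \<omega> i) \<in> borel_measurable Omega_space"
proof (rule measurableI)
  fix B :: "real set" assume B: "B \<in> sets borel"
  define C where "C = (\<lambda>i'. if i' = i then B \<inter> {0..1} else {0..1::real})"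
  have C: "borel_labels (Suc i) C" using B by (auto simp: borel_labels_def C_def)
  have "(\<lambda>\<omega>. fst \<omega> i) -` B \<inter> space Omega_space = (\<Union>s\<in>{s. suborder_on {..<Suc i} s}. basic_event (Suc i) C s)"
  proof (intro equalityI subsetI)
    fix \<omega> assume "\<omega> \<in> (\<lambda>\<omega>. fst \<omega> i) -` B \<inter> space Omega_space"
    then show "\<omega> \<in> (\<Union>s\<in>{s. suborder_on {..<Suc i} s}. basic_event (Suc i) C s)"
      using suborder_on_restrict[of \<omega> "Suc i"] Omega_label[of \<omega>]
      by (auto simp: mem_basic_event space_Omega_space C_def simp del: lessThan_Suc)
  next
    fix \<omega> assume "\<omega> \<in> (\<Union>s\<in>{s. suborder_on {..<Suc i} s}. basic_event (Suc i) C s)"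
    then have "\<omega> \<in> Omega" "fst \<omega> i \<in> C i" by (auto simp: mem_basic_event)
    then show "\<omega> \<in> (\<lambda>\<omega>. fst \<omega> i) -` B \<inter> space Omega_space"
      by (auto simp: space_Omega_space C_def)
  qed
  also have "\<dots> \<in> sets Omega_space"
    using C finite_suborders by (intro sets.finite_UN basic_event_sets) auto
  finally show "(\<lambda>\<omega>. fst \<omega> i) -` B \<inter> space Omega_space \<in> sets Omega_space" .
qed auto

lemma restrict_measurable [measurable]:
  "Measurable.pred Omega_space (\<lambda>\<omega>. snd \<omega> \<inter> ({..<k} \<times> {..<k}) = s)"
proof -
  have "{\<omega> \<in> space Omega_space. snd \<omega> \<inter> ({..<k} \<times> {..<k}) = s} \<in> sets Omega_space"
  proof (cases "suborder_on {..<k} s")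
    case True
    have "{\<omega> \<in> space Omega_space. snd \<omega> \<inter> ({..<k} \<times> {..<k}) = s} = basic_event k (\<lambda>_. {0..1}) s"
      using Omega_label by (auto simp: mem_basic_event space_Omega_space)
    then show ?thesis using True basic_event_sets[of k "\<lambda>_. {0..1}" s] by (simp add: borel_labels_def)
  next
    case False
    then have eq: "{\<omega> \<in> space Omega_space. snd \<omega> \<inter> ({..<k} \<times> {..<k}) = s} = {}"
      using suborder_on_restrict by (auto simp: space_Omega_space)
    show ?thesis unfolding eq by simp
  qed
  then show ?thesis by (simp add: pred_def)
qed

lemma below_measurable [measurable]: "Measurable.pred Omega_space (\<lambda>\<omega>. (i, j) \<in> snd \<omega>)"
proof -
  define k where "k = Suc (max i j)"
  have ij: "i < k" "j < k" by (auto simp: k_def)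
  have "Measurable.pred Omega_space (\<lambda>\<omega>. \<exists>s\<in>{s\<in>Pow ({..<k} \<times> {..<k}). (i, j) \<in> s}. snd \<omega> \<inter> ({..<k} \<times> {..<k}) = s)"
    by measurable
  also have "(\<lambda>\<omega>. \<exists>s\<in>{s\<in>Pow ({..<k} \<times> {..<k}). (i, j) \<in> s}. snd \<omega> \<inter> ({..<k} \<times> {..<k}) = s) = (\<lambda>\<omega>. (i, j) \<in> snd \<omega>)"
    using ij by (intro ext) auto
  finally show ?thesis .
qed

lemma restrict_eq_iff:
  "s \<subseteq> K \<times> K \<Longrightarrow> r \<inter> (K \<times> K) = s \<longleftrightarrow> (\<forall>i\<in>K. \<forall>j\<in>K. (i, j) \<in> r \<longleftrightarrow> (i, j) \<in> s)"
  by blast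

lemma measurable_Omega_spaceI:
  assumes "\<And>\<omega>. \<omega> \<in> space N \<Longrightarrow> f \<omega> \<in> Omega"
    and [measurable]: "\<And>i. (\<lambda>\<omega>. fst (f \<omega>) i) \<in> borel_measurable N"
    and [measurable]: "\<And>i j. Measurable.pred N (\<lambda>\<omega>. (i, j) \<in> snd (f \<omega>))"
  shows "f \<in> measurable N Omega_space"
  unfolding Omega_space_def
proof (rule measurable_measure_of)
  show "f \<in> space N \<rightarrow> Omega" using assms(1) by auto
  fix E assume "E \<in> {basic_event k B s |k B s. borel_labels k B \<and> suborder_on {..<k} s}"
  then obtain k B s where E: "E = basic_event k B s" and B: "borel_labels k B" and s: "suborder_on {..<k} s"
    by auto
  have [measurable]: "B i \<in> sets borel" if "i < k" for i using B that by (auto simp: borel_labels_def)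
  have sk: "s \<subseteq> {..<k} \<times> {..<k}" using s by (auto simp: suborder_on_def poset_on_def)
  have "f -` E \<inter> space N = {\<omega>\<in>space N. (\<forall>i\<in>{..<k}. fst (f \<omega>) i \<in> B i) \<and>
     (\<forall>i\<in>{..<k}. \<forall>j\<in>{..<k}. (i, j) \<in> snd (f \<omega>) \<longleftrightarrow> (i, j) \<in> s)}"
    using assms(1) unfolding E by (auto simp: mem_basic_event restrict_eq_iff[OF sk])
  also have "\<dots> \<in> sets N" by measurable
  finally show "f -` E \<inter> space N \<in> sets N" .
qed (auto simp: basic_event_def)

lemma linear_extension_measurable [measurable]:
  "Measurable.pred Omega_space (\<lambda>\<omega>. linear_extension n (snd \<omega>) l)"
  unfolding linear_extension_def by measurable

text \<open>
  A total version of \<open>relabel\<close> that maps \<open>Omega\<close> to itself, as required for image measures.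
\<close>

definition relabel_if :: "nat \<Rightarrow> (nat \<Rightarrow> nat) \<Rightarrow> (nat \<Rightarrow> real) \<times> nat rel \<Rightarrow> (nat \<Rightarrow> real) \<times> nat rel" where
  "relabel_if n l \<omega> = (if linear_extension n (snd \<omega>) l then relabel l \<omega> else \<omega>)"

lemma relabel_if_measurable [measurable]: "relabel_if n l \<in> measurable Omega_space Omega_space"
proof (rule measurable_Omega_spaceI)
  fix \<omega> assume "\<omega> \<in> space Omega_space"
  then show "relabel_if n l \<omega> \<in> Omega" by (auto simp: relabel_if_def space_Omega_space relabel_Omega)
next
  fix i
  have "(\<lambda>\<omega>. fst (relabel_if n l \<omega>) i) = (\<lambda>\<omega>. if linear_extension n (snd \<omega>) l then fst \<omega> (l i) else fst \<omega> i)"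
    by (auto simp: relabel_if_def)
  then show "(\<lambda>\<omega>. fst (relabel_if n l \<omega>) i) \<in> borel_measurable Omega_space" by simp
next
  fix i j
  have "(\<lambda>\<omega>. (i, j) \<in> snd (relabel_if n l \<omega>)) = (\<lambda>\<omega>. if linear_extension n (snd \<omega>) l then (l i, l j) \<in> snd \<omega> else (i, j) \<in> snd \<omega>)"
    by (auto simp: relabel_if_def)
  then show "Measurable.pred Omega_space (\<lambda>\<omega>. (i, j) \<in> snd (relabel_if n l \<omega>))" by simp
qed

definition cell :: "nat \<Rightarrow> nat rel \<Rightarrow> ((nat \<Rightarrow> real) \<times> nat rel) set" where
  "cell n s = {\<omega> \<in> Omega. snd \<omega> \<inter> ({..<n} \<times> {..<n}) = s}"

lemma cell_sets [measurable]: "cell n s \<in> sets Omega_space"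
proof -
  have "cell n s = {\<omega> \<in> space Omega_space. snd \<omega> \<inter> ({..<n} \<times> {..<n}) = s}"
    by (auto simp: cell_def space_Omega_space)
  then show ?thesis by simp
qed

lemma cell_linear_extension: "\<omega> \<in> cell n s \<Longrightarrow> linear_extension n (snd \<omega>) l \<longleftrightarrow> linear_extension n s l"
  using linear_extension_restrict[of n "snd \<omega>" l] by (auto simp: cell_def)

lemma relabel_mem_cell:
  assumes "\<omega> \<in> cell n s" "linear_extension n s l"
  shows "relabel l \<omega> \<in> cell n (reorder n l s)"
proof -
  have l: "l permutes {..<n}" using assms by (simp add: linear_extension_def)
  have "linear_extension n (snd \<omega>) l" using assms cell_linear_extension by blast
  then have "relabel l \<omega> \<in> Omega" using assms(1) by (intro relabel_Omega) (auto simp: cell_def)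
  moreover have "snd (relabel l \<omega>) \<inter> ({..<n} \<times> {..<n}) = reorder n l s"
  proof -
    have s: "s = snd \<omega> \<inter> ({..<n} \<times> {..<n})" using assms(1) by (simp add: cell_def)
    have "(i, j) \<in> snd (relabel l \<omega>) \<inter> ({..<n} \<times> {..<n}) \<longleftrightarrow> (i, j) \<in> reorder n l s" for i j
      by (auto simp: reorder_def s permutes_lessThan_iff[OF l])
    then show ?thesis by (intro subset_antisym subrelI) blast+
  qed
  ultimately show ?thesis by (simp add: cell_def)
qed

lemma reorder_suborder:
  assumes "suborder_on {..<n} s" "linear_extension n s l"
  shows "suborder_on {..<n} (reorder n l s)" and "linear_extension n (reorder n l s) (inv l)"
    and "reorder n (inv l) (reorder n l s) = s"
proof -
  have l: "l permutes {..<n}" using assms by (simp add: linear_extension_def)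
  have sn: "s \<subseteq> {..<n} \<times> {..<n}" "\<And>i j. (i, j) \<in> s \<Longrightarrow> i < j" "trans s" "irrefl s"
    using assms by (auto simp: suborder_on_def poset_on_def)
  have "irrefl (reorder n l s)" using sn(4) by (auto simp: reorder_def irrefl_def)
  moreover have "trans (reorder n l s)"
  proof (rule transI)
    fix i j k assume "(i, j) \<in> reorder n l s" "(j, k) \<in> reorder n l s"
    then show "(i, k) \<in> reorder n l s"
      using transD[OF sn(3), of "l i" "l j" "l k"] by (simp add: reorder_def)
  qed
  moreover have "i < j" if "(i, j) \<in> reorder n l s" for i j
    using that assms(2) by (auto simp: reorder_def linear_extension_def)
  moreover have "reorder n l s \<subseteq> {..<n} \<times> {..<n}" by (auto simp: reorder_def)
  ultimately show "suborder_on {..<n} (reorder n l s)"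
    by (simp add: suborder_on_def poset_on_def)
  show "linear_extension n (reorder n l s) (inv l)"
    using sn l by (auto simp: linear_extension_def reorder_def permutes_inv permutes_inverses)
  show "reorder n (inv l) (reorder n l s) = s"
    using sn l permutes_lessThan_iff[OF permutes_inv[OF l]]
    by (auto simp: reorder_def permutes_inverses)
qed

text \<open>
  Basic events that look beyond the first \<open>n\<close> elements. They still generate the
  \<open>\<sigma>\<close>-algebra, and they have the advantage that each determines the order of the first \<open>n\<close>
  elements, which decides whether \<open>l\<close> is a linear extension.
\<close>

definition late_events :: "nat \<Rightarrow> ((nat \<Rightarrow> real) \<times> nat rel) set set" where
  "late_events n = {basic_event k B s | k B s. n < k \<and> borel_labels k B \<and> suborder_on {..<k} s}"

lemma late_eventsI:
  "n < k \<Longrightarrow> borel_labels k B \<Longrightarrow> suborder_on {..<k} s \<Longrightarrow> basic_event k B s \<in> late_events n"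
  by (auto simp: late_events_def)

lemma late_events_subset: "late_events n \<subseteq> sets Omega_space"
  by (auto simp: late_events_def basic_event_sets)

lemma late_events_Pow: "late_events n \<subseteq> Pow Omega"
  by (auto simp: late_events_def mem_basic_event)

lemma Int_stable_late_events: "Int_stable (late_events n)"
proof (rule Int_stableI)
  have wlog: "basic_event k B s \<inter> basic_event k' B' s' \<in> late_events n"
    if "n < k" "borel_labels k B" "suborder_on {..<k} s" "k \<le> k'"
      "borel_labels k' B'" "suborder_on {..<k'} s'" for k B s k' B' s'
  proof (cases "s' \<inter> ({..<k} \<times> {..<k}) = s")
    case True
    have "{..<k} \<subseteq> {..<k'}" using that by auto
    then have "basic_event k B s \<inter> basic_event k' B' s' = basic_event k' (\<lambda>i. if i < k then B i \<inter> B' i else B' i) s'"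
    proof -
      have lab: "(\<forall>i<k. f i \<in> B i) \<and> (\<forall>i<k'. f i \<in> B' i) \<longleftrightarrow>
        (\<forall>i<k'. f i \<in> (if i < k then B i \<inter> B' i else B' i))" for f
        using \<open>k \<le> k'\<close> by (smt (verit, best) Int_iff less_le_trans)
      show ?thesis
        using that True \<open>{..<k} \<subseteq> {..<k'}\<close> by (intro set_eqI) (auto simp: mem_basic_event lab[symmetric])
    qed
    moreover have "borel_labels k' (\<lambda>i. if i < k then B i \<inter> B' i else B' i)"
      using that by (auto simp: borel_labels_def)
    ultimately show ?thesis using that by (auto intro!: late_eventsI)
  next
    case False
    have "{..<k} \<subseteq> {..<k'}" using that by auto
    then have "basic_event k B s \<inter> basic_event k' B' s' = {}"
      using that False by (auto simp: mem_basic_event)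
    also have "\<dots> = basic_event k (\<lambda>_. {}) s" using that(1) by (auto simp: mem_basic_event)
    finally show ?thesis using that by (auto simp: borel_labels_def intro!: late_eventsI)
  qed
  fix a b assume "a \<in> late_events n" "b \<in> late_events n"
  then obtain k B s k' B' s' where *: "a = basic_event k B s" "n < k" "borel_labels k B" "suborder_on {..<k} s"
      "b = basic_event k' B' s'" "n < k'" "borel_labels k' B'" "suborder_on {..<k'} s'"
    by (auto simp: late_events_def)
  show "a \<inter> b \<in> late_events n"
    using wlog[of k B s k' B' s'] wlog[of k' B' s' k B s] * by (cases "k \<le> k'") (auto simp: Int_commute)
qed

lemma basic_event_eq_UN:
  assumes "k \<le> m" "borel_labels k B"
  shows "basic_event k B s = (\<Union>u\<in>{u. suborder_on {..<m} u \<and> u \<inter> ({..<k} \<times> {..<k}) = s}.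
      basic_event m (\<lambda>i. if i < k then B i else {0..1}) u)" (is "_ = ?U")
proof (intro equalityI subsetI)
  have sub: "{..<k} \<subseteq> {..<m}" using assms by auto
  {
    fix \<omega> assume w: "\<omega> \<in> basic_event k B s"
    then have "suborder_on {..<m} (snd \<omega> \<inter> ({..<m} \<times> {..<m}))"
      by (intro suborder_on_restrict) (auto simp: mem_basic_event)
    moreover have "(snd \<omega> \<inter> ({..<m} \<times> {..<m})) \<inter> ({..<k} \<times> {..<k}) = s"
      using w sub by (auto simp: mem_basic_event)
    ultimately show "\<omega> \<in> ?U" using w Omega_label[of \<omega>]
      by (intro UN_I[of "snd \<omega> \<inter> ({..<m} \<times> {..<m})"]) (auto simp: mem_basic_event)
  }
  fix \<omega> assume "\<omega> \<in> ?U"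
  then show "\<omega> \<in> basic_event k B s" using assms(1) sub by (auto simp: mem_basic_event split: if_splits)
qed

lemma sets_late_events: "sigma_sets Omega (late_events n) = sets Omega_space"
proof
  show "sigma_sets Omega (late_events n) \<subseteq> sets Omega_space"
    using sets.sigma_sets_subset[OF late_events_subset[of n]] by (simp add: space_Omega_space)
  let ?N = "sigma Omega (late_events n)"
  have N: "sets ?N = sigma_sets Omega (late_events n)" by (rule sets_measure_of[OF late_events_Pow])
  show "sets Omega_space \<subseteq> sigma_sets Omega (late_events n)"
    unfolding sets_Omega_space
  proof (rule sigma_sets_mono, rule subsetI)
    fix E assume "E \<in> {basic_event k B s |k B s. borel_labels k B \<and> suborder_on {..<k} s}"
    then obtain k B s where E: "E = basic_event k B s" and B: "borel_labels k B" by auto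
    define m where "m = Suc (max k n)"
    have "borel_labels m (\<lambda>i. if i < k then B i else {0..1})" using B by (auto simp: borel_labels_def)
    then have "basic_event m (\<lambda>i. if i < k then B i else {0..1}) u \<in> sets ?N" if "suborder_on {..<m} u" for u
      unfolding N using that by (intro sigma_sets.Basic late_eventsI) (auto simp: m_def)
    moreover have "finite {u. suborder_on {..<m} u \<and> u \<inter> ({..<k} \<times> {..<k}) = s}"
      by (rule finite_subset[OF _ finite_suborders[of m]]) auto
    ultimately have "E \<in> sets ?N" unfolding E
      using B by (subst basic_event_eq_UN[of k m]) (auto simp: m_def)
    then show "E \<in> sigma_sets Omega (late_events n)" using N by simp
  qed
qed

text \<open>
  Order-invariance only speaks of basic events at the level of the permutation; this pullback
  makes it available at every higher level.
\<close>

lemma relabel_vimage_basic_event: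
  assumes s: "suborder_on {..<n} s" and l: "linear_extension n s l" and "n \<le> k"
    and u: "u \<inter> ({..<n} \<times> {..<n}) = reorder n l s" and uk: "u \<subseteq> {..<k} \<times> {..<k}"
  shows "{\<omega> \<in> cell n s. relabel l \<omega> \<in> basic_event k B u} =
    basic_event k (\<lambda>i. B (inv l i)) (reorder k (inv l) u)"
proof -
  have ln: "l permutes {..<n}" using l by (simp add: linear_extension_def)
  have sn: "s \<subseteq> {..<n} \<times> {..<n}" using s by (auto simp: suborder_on_def poset_on_def)
  have lk: "l permutes {..<k}" using \<open>n \<le> k\<close> by (intro permutes_subset[OF ln]) auto
  note iff = permutes_lessThan_iff[OF lk] permutes_lessThan_iff[OF permutes_inv[OF lk]]
    permutes_lessThan_iff[OF ln] permutes_lessThan_iff[OF permutes_inv[OF ln]] permutes_inverses[OF lk]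
  have w: "reorder k (inv l) u \<inter> ({..<n} \<times> {..<n}) = s" (is "?w \<inter> _ = s")
  proof -
    have "(i, j) \<in> ?w \<inter> ({..<n} \<times> {..<n}) \<longleftrightarrow> (i, j) \<in> s" for i j
    proof (cases "i < n \<and> j < n")
      case True
      then have "(i, j) \<in> ?w \<longleftrightarrow> (inv l i, inv l j) \<in> u \<inter> ({..<n} \<times> {..<n})"
        using \<open>n \<le> k\<close> by (auto simp: reorder_def iff)
      also have "\<dots> \<longleftrightarrow> (i, j) \<in> s" unfolding u using True by (auto simp: reorder_def iff)
      finally show ?thesis using True by auto
    qed (use sn in auto)
    then show ?thesis by auto
  qed
  show ?thesis
  proof (intro equalityI subsetI)
    fix \<omega> assume "\<omega> \<in> {\<omega> \<in> cell n s. relabel l \<omega> \<in> basic_event k B u}"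
    then have om: "\<omega> \<in> Omega" "\<And>i. i < k \<Longrightarrow> fst \<omega> (l i) \<in> B i"
       and r: "snd (relabel l \<omega>) \<inter> ({..<k} \<times> {..<k}) = u"
      by (auto simp: mem_basic_event cell_def)
    have "fst \<omega> i \<in> B (inv l i)" if "i < k" for i using om(2)[of "inv l i"] that by (simp add: iff)
    moreover have "snd \<omega> \<inter> ({..<k} \<times> {..<k}) = ?w"
      by (auto simp: reorder_def r[symmetric] iff)
    ultimately show "\<omega> \<in> basic_event k (\<lambda>i. B (inv l i)) ?w" using om by (simp add: mem_basic_event)
  next
    fix \<omega> assume "\<omega> \<in> basic_event k (\<lambda>i. B (inv l i)) ?w"
    then have om: "\<omega> \<in> Omega" "\<And>i. i < k \<Longrightarrow> fst \<omega> i \<in> B (inv l i)"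
       and r: "snd \<omega> \<inter> ({..<k} \<times> {..<k}) = ?w"
      by (auto simp: mem_basic_event)
    have "snd \<omega> \<inter> ({..<n} \<times> {..<n}) = (snd \<omega> \<inter> ({..<k} \<times> {..<k})) \<inter> ({..<n} \<times> {..<n})"
      using \<open>n \<le> k\<close> by auto
    then have cell: "\<omega> \<in> cell n s" using om r w by (simp add: cell_def)
    then have "relabel l \<omega> \<in> Omega" using relabel_mem_cell[OF _ l] by (auto simp: cell_def)
    moreover have "fst \<omega> (l i) \<in> B i" if "i < k" for i using om(2)[of "l i"] that by (simp add: iff)
    moreover have "snd (relabel l \<omega>) \<inter> ({..<k} \<times> {..<k}) = u"
    proof -
      have "(i, j) \<in> snd (relabel l \<omega>) \<inter> ({..<k} \<times> {..<k}) \<longleftrightarrow> (i, j) \<in> u" for i j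
      proof -
        have "(i, j) \<in> snd (relabel l \<omega>) \<inter> ({..<k} \<times> {..<k}) \<longleftrightarrow> (l i, l j) \<in> snd \<omega> \<inter> ({..<k} \<times> {..<k})"
          by (auto simp: iff)
        also have "\<dots> \<longleftrightarrow> (i, j) \<in> u" unfolding r using uk by (auto simp: reorder_def iff)
        finally show ?thesis .
      qed
      then show ?thesis by (intro subset_antisym subrelI) blast+
    qed
    ultimately show "\<omega> \<in> {\<omega> \<in> cell n s. relabel l \<omega> \<in> basic_event k B u}"
      using cell by (simp add: mem_basic_event)
  qed
qed

lemma relabel_if_cell: "\<omega> \<in> cell n s \<Longrightarrow> linear_extension n s l \<Longrightarrow> relabel_if n l \<omega> = relabel l \<omega>"
  by (simp add: relabel_if_def cell_linear_extension)

section \<open>Averages over re-enumerations\<close>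

lemma finite_linear_extensions: "finite {l. linear_extension n r l \<and> P l}"
  by (rule finite_subset[OF _ finite_permutations[of "{..<n}"]]) (auto simp: linear_extension_def)

definition hits :: "nat \<Rightarrow> ((nat \<Rightarrow> real) \<times> nat rel) set \<Rightarrow> (nat \<Rightarrow> real) \<times> nat rel \<Rightarrow> nat" where
  "hits n A \<omega> = card {l. linear_extension n (snd \<omega>) l \<and> relabel l \<omega> \<in> A}"

text \<open>
  The frequency of \<open>A\<close> among all enumerations of the poset formed by the first \<open>n\<close> elements, hence
  a version of the conditional probability of \<open>A\<close> given that poset and everything later.
\<close>

definition avg :: "nat \<Rightarrow> ((nat \<Rightarrow> real) \<times> nat rel) set \<Rightarrow> (nat \<Rightarrow> real) \<times> nat rel \<Rightarrow> real" where
  "avg n A \<omega> = real (hits n A \<omega>) / real (hits n UNIV \<omega>)"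

lemma linear_extension_id: "\<omega> \<in> Omega \<Longrightarrow> linear_extension n (snd \<omega>) id"
  using Omega_less by (auto simp: linear_extension_def permutes_id)

lemma hits_UNIV_pos: "\<omega> \<in> Omega \<Longrightarrow> 0 < hits n UNIV \<omega>"
  using linear_extension_id[of \<omega> n] finite_linear_extensions[of n "snd \<omega>" "\<lambda>_. True"]
  by (auto simp: hits_def card_gt_0_iff)

lemma hits_le: "hits n A \<omega> \<le> hits n UNIV \<omega>"
  unfolding hits_def by (intro card_mono finite_linear_extensions) auto

lemma avg_bounds: "0 \<le> avg n A \<omega>" "avg n A \<omega> \<le> 1"
  using hits_le[of n A \<omega>] by (auto simp: avg_def divide_le_eq)

lemma hits_relabel:
  assumes w: "\<omega> \<in> Omega" and l: "linear_extension k (snd \<omega>) l" and "k \<le> n"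
  shows "hits n A (relabel l \<omega>) = hits n A \<omega>"
proof -
  have "linear_extension n (snd \<omega>) l"
    using linear_extension_mono[OF l Omega_less[OF w] \<open>k \<le> n\<close>] .
  then have ln: "l permutes {..<n}" by (simp add: linear_extension_def)
  note iff = linear_extension_relabel_iff[OF ln]
  have c: "l \<circ> (inv l \<circ> m) = m" "inv l \<circ> (l \<circ> m) = m" for m
    by (simp_all add: o_assoc permutes_inv_o[OF ln])
  have "bij_betw ((\<circ>) l) {m. linear_extension n (snd (relabel l \<omega>)) m \<and> relabel m (relabel l \<omega>) \<in> A}
     {m. linear_extension n (snd \<omega>) m \<and> relabel m \<omega> \<in> A}"
    by (rule bij_betw_byWitness[where f' = "(\<circ>) (inv l)"]) (auto simp: iff relabel_relabel c)
  then show ?thesis unfolding hits_def by (rule bij_betw_same_card)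
qed

lemma avg_relabel:
  "\<omega> \<in> Omega \<Longrightarrow> linear_extension k (snd \<omega>) l \<Longrightarrow> k \<le> n \<Longrightarrow> avg n A (relabel l \<omega>) = avg n A \<omega>"
  by (simp add: avg_def hits_relabel)

lemma hits_measurable:
  "A \<in> sets Omega_space \<Longrightarrow> (\<lambda>\<omega>. real (hits n A \<omega>)) \<in> borel_measurable Omega_space"
  and hits_UNIV_measurable [measurable]:
    "(\<lambda>\<omega>. real (hits n UNIV \<omega>)) \<in> borel_measurable Omega_space"
proof -
  have fin: "finite {l. l permutes {..<n}}" by (rule finite_permutations) simp
  {
  assume [measurable]: "A \<in> sets Omega_space"
  have "real (hits n A \<omega>) = (\<Sum>l | l permutes {..<n}. if linear_extension n (snd \<omega>) l \<and> relabel_if n l \<omega> \<in> A then 1 else 0)"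
    if "\<omega> \<in> space Omega_space" for \<omega>
    unfolding hits_def card_eq_sum of_nat_sum using fin
    by (intro sum.mono_neutral_cong_left) (auto simp: relabel_if_def linear_extension_def)
  moreover have "(\<lambda>\<omega>. \<Sum>l | l permutes {..<n}. if linear_extension n (snd \<omega>) l \<and> relabel_if n l \<omega> \<in> A then 1 else 0 :: real)
      \<in> borel_measurable Omega_space" by measurable
  ultimately show "(\<lambda>\<omega>. real (hits n A \<omega>)) \<in> borel_measurable Omega_space"
    by (subst measurable_cong)
  }
  have "real (hits n UNIV \<omega>) = (\<Sum>l | l permutes {..<n}. if linear_extension n (snd \<omega>) l then 1 else 0)" for \<omega>
    unfolding hits_def card_eq_sum of_nat_sum using fin
    by (intro sum.mono_neutral_cong_left) (auto simp: linear_extension_def)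
  moreover have "(\<lambda>\<omega>. \<Sum>l | l permutes {..<n}. if linear_extension n (snd \<omega>) l then 1 else 0 :: real)
      \<in> borel_measurable Omega_space" by measurable
  ultimately show "(\<lambda>\<omega>. real (hits n UNIV \<omega>)) \<in> borel_measurable Omega_space"
    by (subst measurable_cong)
qed

lemma avg_measurable [measurable]:
  "A \<in> sets Omega_space \<Longrightarrow> avg n A \<in> borel_measurable Omega_space"
  unfolding avg_def[abs_def] by (intro borel_measurable_divide hits_measurable hits_UNIV_measurable)

text \<open>
  Since labels are distinct, prescribing labels amounts to prescribing the elements listed first,
  and what remains to be counted are linear extensions of the other elements.
\<close>

lemma hits_prefix:
  assumes w: "\<omega> \<in> Omega" and inj: "inj (fst \<omega>)" and "k \<le> n"
    and l0: "linear_extension n (snd \<omega>) l0" "\<forall>i<k. fst \<omega> (l0 i) = ds i"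
    and A: "\<And>l. linear_extension n (snd \<omega>) l \<Longrightarrow>
      relabel l \<omega> \<in> A \<longleftrightarrow> (\<forall>i<k. fst \<omega> (l i) = ds i) \<and> Q (map l [k..<n])"
  shows "hits n A \<omega> = card {ys \<in> lin_exts (snd \<omega>) ({..<n} - l0 ` {..<k}). Q ys}"
proof -
  have pre: "(\<forall>i<k. fst \<omega> (l i) = ds i) \<longleftrightarrow> (\<forall>i<k. l i = l0 i)" for l
    using l0(2) injD[OF inj] by metis
  have bij: "bij_betw (\<lambda>l. map l [k..<n]) {l. linear_extension n (snd \<omega>) l \<and> (\<forall>i<k. l i = l0 i)}
      (lin_exts (snd \<omega>) ({..<n} - l0 ` {..<k}))" (is "bij_betw ?f ?B ?L")
    using bij_betw_linear_extensions_prefix[OF _ l0(1) \<open>k \<le> n\<close>] Omega_less[OF w] by blast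
  have "{ys \<in> ?L. Q ys} = ?f ` {l \<in> ?B. Q (?f l)}"
    using bij_betw_imp_surj_on[OF bij] by auto
  moreover have "inj_on ?f {l \<in> ?B. Q (?f l)}"
    using bij_betw_imp_inj_on[OF bij] by (rule inj_on_subset) auto
  moreover have "{l. linear_extension n (snd \<omega>) l \<and> relabel l \<omega> \<in> A} = {l \<in> ?B. Q (?f l)}"
    using A pre by auto
  ultimately show ?thesis by (simp add: hits_def card_image)
qed

text \<open>
  Labels are prescribed at the first \<open>k\<close> positions, so that \<open>P\<close> is about what happens from
  position \<open>k\<close> on.
\<close>

definition prefix_event :: "nat \<Rightarrow> (nat \<Rightarrow> real) \<Rightarrow> ((nat \<Rightarrow> real) \<times> nat rel \<Rightarrow> bool) \<Rightarrow> ((nat \<Rightarrow> real) \<times> nat rel) set" where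
  "prefix_event k ds P = {\<omega> \<in> Omega. (\<forall>i<k. fst \<omega> i = ds i) \<and> P \<omega>}"

lemma prefix_event_sets [measurable]:
  assumes [measurable]: "Measurable.pred Omega_space P"
  shows "prefix_event k ds P \<in> sets Omega_space"
proof -
  have "prefix_event k ds P = {\<omega> \<in> space Omega_space. (\<forall>i\<in>{..<k}. fst \<omega> i = ds i) \<and> P \<omega>}"
    by (auto simp: prefix_event_def space_Omega_space)
  also have "\<dots> \<in> sets Omega_space" by measurable
  finally show ?thesis .
qed

definition followed :: "nat \<Rightarrow> nat \<Rightarrow> (nat \<Rightarrow> real) \<times> nat rel \<Rightarrow> bool" where
  "followed k t \<omega> \<longleftrightarrow> (\<exists>j. k < j \<and> j \<le> k + t \<and> (k, j) \<in> snd \<omega>)"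

lemma followed_measurable [measurable]: "Measurable.pred Omega_space (followed k t)"
  unfolding followed_def[abs_def] by measurable

text \<open>
  The combinatorial estimate, read for the frequencies among enumerations of the first \<open>n\<close> elements.
  An element at position \<open>k\<close> of an enumeration is minimal once the \<open>k\<close> elements before it are
  removed.
\<close>

lemma avg_followed_square_le:
  fixes c :: "real \<Rightarrow> nat"
  assumes w: "\<omega> \<in> Omega" and inj: "inj (fst \<omega>)" and n: "k + t < n"
    and c: "\<And>x. x \<in> {0..1} \<Longrightarrow> c x < m"
  shows "(avg n (prefix_event k ds (\<lambda>\<omega>. fst \<omega> k \<notin> F \<and> followed k t \<omega>)) \<omega>)\<^sup>2 \<le>
    real t * (\<Sum>i<m. (avg n (prefix_event k ds (\<lambda>\<omega>. fst \<omega> k \<notin> F \<and> c (fst \<omega> k) = i)) \<omega>)\<^sup>2)"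
    (is "(avg n ?B \<omega>)\<^sup>2 \<le> real t * (\<Sum>i<m. (avg n (?A i) \<omega>)\<^sup>2)")
proof -
  have "(real (hits n ?B \<omega>))\<^sup>2 \<le> real t * (\<Sum>i<m. (real (hits n (?A i) \<omega>))\<^sup>2)"
  proof (cases "\<exists>l0. linear_extension n (snd \<omega>) l0 \<and> (\<forall>i<k. fst \<omega> (l0 i) = ds i)")
    case False
    then have none: "{l. linear_extension n (snd \<omega>) l \<and> relabel l \<omega> \<in> ?B} = {}"
      by (auto simp: prefix_event_def)
    have "hits n ?B \<omega> = 0" by (simp only: hits_def none card.empty)
    then show ?thesis by (simp add: sum_nonneg)
  next
    case True
    then obtain l0 where l0: "linear_extension n (snd \<omega>) l0" "\<forall>i<k. fst \<omega> (l0 i) = ds i" by blast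
    let ?R = "{..<n} - l0 ` {..<k}"
    have wf: "wf (snd \<omega>)" by (rule wf_subset[OF wf_less]) (auto dest: Omega_less[OF w])
    have "card (l0 ` {..<k}) < card {..<n}" using card_image_le[of "{..<k}" l0] n by simp
    then have ne: "?R \<noteq> {}" by (metis Diff_eq_empty_iff card_mono finite_imageI finite_lessThan not_less)
    have upt: "[k..<n] = k # [Suc k..<n]" using n by (simp add: upt_conv_Cons)
    have hB: "hits n ?B \<omega> = card {ys \<in> lin_exts (snd \<omega>) ?R. fst \<omega> (hd ys) \<notin> F \<and> early (snd \<omega>) (hd ys) t (tl ys)}"
    proof (rule hits_prefix[OF w inj _ l0])
      fix l assume l: "linear_extension n (snd \<omega>) l"
      have "take t [Suc k..<n] = [Suc k..<Suc k + t]" using n by (simp add: take_upt)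
      then have "early (snd \<omega>) (l k) t (map l [Suc k..<n]) \<longleftrightarrow> (\<exists>j\<in>{Suc k..<Suc k + t}. (l k, l j) \<in> snd \<omega>)"
        by (simp add: early_def take_map del: upt_Suc)
      also have "\<dots> \<longleftrightarrow> followed k t (relabel l \<omega>)"
        by (auto simp: followed_def Bex_def Suc_le_eq less_Suc_eq_le)
      finally show "relabel l \<omega> \<in> ?B \<longleftrightarrow> (\<forall>i<k. fst \<omega> (l i) = ds i) \<and>
          fst \<omega> (hd (map l [k..<n])) \<notin> F \<and> early (snd \<omega>) (hd (map l [k..<n])) t (tl (map l [k..<n]))"
        using relabel_Omega[OF w l] by (simp add: prefix_event_def upt)
    qed (use n in simp)
    have hA: "hits n (?A i) \<omega> = card {ys \<in> lin_exts (snd \<omega>) ?R. fst \<omega> (hd ys) \<notin> F \<and> c (fst \<omega> (hd ys)) = i}" for i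
    proof (rule hits_prefix[OF w inj _ l0])
      fix l assume l: "linear_extension n (snd \<omega>) l"
      show "relabel l \<omega> \<in> ?A i \<longleftrightarrow> (\<forall>i<k. fst \<omega> (l i) = ds i) \<and>
          fst \<omega> (hd (map l [k..<n])) \<notin> F \<and> c (fst \<omega> (hd (map l [k..<n]))) = i"
        using relabel_Omega[OF w l] by (simp add: prefix_event_def upt)
    qed (use n in simp)
    show ?thesis unfolding hB hA
      using square_card_early_le[OF wf _ ne, of "\<lambda>y. fst \<omega> y \<notin> F" "\<lambda>y. c (fst \<omega> y)" m t] c Omega_label[OF w]
      by simp
  qed
  then have "(real (hits n ?B \<omega>))\<^sup>2 / (real (hits n UNIV \<omega>))\<^sup>2 \<le>
      real t * (\<Sum>i<m. (real (hits n (?A i) \<omega>))\<^sup>2) / (real (hits n UNIV \<omega>))\<^sup>2"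
    by (rule divide_right_mono) simp
  then show ?thesis by (simp add: avg_def power_divide flip: sum_divide_distrib)
qed

section \<open>Order-invariant measures\<close>

locale order_invariant_measure = prob_space \<mu> for \<mu> :: "((nat \<Rightarrow> real) \<times> nat rel) measure" +
  assumes sets_eq [measurable_cong]: "sets \<mu> = sets Omega_space"
    and invariant: "\<And>k B s l. borel_labels k B \<Longrightarrow> suborder_on {..<k} s \<Longrightarrow> linear_extension k s l \<Longrightarrow>
      measure \<mu> (basic_event k B s) = measure \<mu> (basic_event k (\<lambda>i. B (l i)) (reorder k l s))"
begin

lemma space_eq: "space \<mu> = Omega"
  using sets_eq_imp_space_eq[OF sets_eq] by (simp add: space_Omega_space)

text \<open>
  Order-invariance as an identity of measures: re-enumeration by \<open>l\<close> carries \<open>\<mu>\<close> on the set where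
  the first \<open>n\<close> elements have order \<open>s\<close> to \<open>\<mu>\<close> on the set where they have the reordered order.
\<close>

lemma distr_relabel:
  assumes s: "suborder_on {..<n} s" and l: "linear_extension n s l"
  shows "distr (density \<mu> (indicator (cell n s))) Omega_space (relabel_if n l) =
    density \<mu> (indicator (cell n (reorder n l s)))" (is "?N1 = ?N2")
proof -
  have [simp]: "sets ?N2 = sets Omega_space" by (simp add: sets_eq)
  have N1: "emeasure ?N1 A = emeasure \<mu> {\<omega> \<in> cell n s. relabel l \<omega> \<in> A}"
    and A: "{\<omega> \<in> cell n s. relabel l \<omega> \<in> A} \<in> sets \<mu>" if A[measurable]: "A \<in> sets Omega_space" for A
  proof -
    have eq: "(relabel_if n l -` A \<inter> space \<mu>) \<inter> cell n s = {\<omega> \<in> cell n s. relabel l \<omega> \<in> A}"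
    proof -
      have "relabel_if n l \<omega> = relabel l \<omega>" if "\<omega> \<in> cell n s" for \<omega>
        using that l by (simp add: relabel_if_def cell_linear_extension)
      moreover have "cell n s \<subseteq> Omega" by (auto simp: cell_def)
      ultimately show ?thesis by (auto simp: space_eq)
    qed
    have [measurable]: "relabel_if n l -` A \<inter> space \<mu> \<in> sets \<mu>"
      by (rule measurable_sets[OF _ A]) measurable
    show "{\<omega> \<in> cell n s. relabel l \<omega> \<in> A} \<in> sets \<mu>" unfolding eq[symmetric] by measurable
    have "emeasure ?N1 A = emeasure (density \<mu> (indicator (cell n s))) (relabel_if n l -` A \<inter> space \<mu>)"
      using A by (subst emeasure_distr) (auto simp: measurable_cong_sets[OF sets_eq])
    also have "\<dots> = (\<integral>\<^sup>+\<omega>. indicator (cell n s) \<omega> * indicator (relabel_if n l -` A \<inter> space \<mu>) \<omega> \<partial>\<mu>)"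
      by (rule emeasure_density) measurable
    also have "\<dots> = (\<integral>\<^sup>+\<omega>. indicator ((relabel_if n l -` A \<inter> space \<mu>) \<inter> cell n s) \<omega> \<partial>\<mu>)"
      by (intro nn_integral_cong) (simp split: split_indicator)
    also have "\<dots> = emeasure \<mu> {\<omega> \<in> cell n s. relabel l \<omega> \<in> A}"
      unfolding eq using \<open>{\<omega> \<in> cell n s. relabel l \<omega> \<in> A} \<in> sets \<mu>\<close> by simp
    finally show "emeasure ?N1 A = emeasure \<mu> {\<omega> \<in> cell n s. relabel l \<omega> \<in> A}" .
  qed
  have N2: "emeasure ?N2 A = emeasure \<mu> (A \<inter> cell n (reorder n l s))" if [measurable]: "A \<in> sets Omega_space" for A
  proof -
    have "emeasure ?N2 A = (\<integral>\<^sup>+\<omega>. indicator (cell n (reorder n l s)) \<omega> * indicator A \<omega> \<partial>\<mu>)"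
      by (rule emeasure_density) measurable
    also have "\<dots> = (\<integral>\<^sup>+\<omega>. indicator (A \<inter> cell n (reorder n l s)) \<omega> \<partial>\<mu>)"
      by (intro nn_integral_cong) (simp split: split_indicator)
    finally have "emeasure ?N2 A = (\<integral>\<^sup>+\<omega>. indicator (A \<inter> cell n (reorder n l s)) \<omega> \<partial>\<mu>)" .
    then show ?thesis by simp
  qed
  show ?thesis
  proof (rule measure_eqI_generator_eq_countable[OF Int_stable_late_events late_events_Pow])
    show "sets ?N1 = sigma_sets Omega (late_events n)" "sets ?N2 = sigma_sets Omega (late_events n)"
      by (simp_all add: sets_late_events sets_eq)
    let ?A = "basic_event (Suc n) (\<lambda>_. {0..1}) ` {s. suborder_on {..<Suc n} s}"
    show "?A \<subseteq> late_events n" by (auto simp: borel_labels_def simp del: lessThan_Suc intro!: late_eventsI)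
    show "countable ?A" using finite_suborders by (intro countable_finite) simp
    show "\<Union> ?A = Omega"
      using suborder_on_restrict[of _ "Suc n"] Omega_label by (auto simp: mem_basic_event simp del: lessThan_Suc)
    fix a assume "a \<in> ?A"
    then have "a \<in> sets Omega_space" by (auto simp: basic_event_sets borel_labels_def simp del: lessThan_Suc)
    then show "emeasure ?N1 a \<noteq> \<infinity>" using N1 by simp
  next
    fix X assume "X \<in> late_events n"
    then obtain k B u where X: "X = basic_event k B u" and k: "n < k" and B: "borel_labels k B" and u: "suborder_on {..<k} u"
      by (auto simp: late_events_def)
    have Xs: "X \<in> sets Omega_space" using X B u by (simp add: basic_event_sets)
    have restr: "\<omega> \<in> Omega \<and> snd \<omega> \<inter> ({..<n} \<times> {..<n}) = u \<inter> ({..<n} \<times> {..<n})" if "\<omega> \<in> X" for \<omega>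
    proof -
      have sub: "snd \<omega> \<inter> ({..<n} \<times> {..<n}) = (snd \<omega> \<inter> ({..<k} \<times> {..<k})) \<inter> ({..<n} \<times> {..<n})"
        using k by (intro subset_antisym subrelI) auto
      have "snd \<omega> \<inter> ({..<k} \<times> {..<k}) = u" "\<omega> \<in> Omega" using that by (auto simp: X mem_basic_event)
      then show ?thesis unfolding sub by simp
    qed
    show "emeasure ?N1 X = emeasure ?N2 X"
    proof (cases "u \<inter> ({..<n} \<times> {..<n}) = reorder n l s")
      case True
      let ?w = "reorder k (inv l) u"
      have ln: "l permutes {..<n}" using l by (simp add: linear_extension_def)
      have lk: "l permutes {..<k}" using k by (intro permutes_subset[OF ln]) auto
      have uk: "u \<subseteq> {..<k} \<times> {..<k}" and uless: "\<And>i j. (i, j) \<in> u \<Longrightarrow> i < j" using u by (auto simp: suborder_on_def poset_on_def)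
      have wn: "linear_extension n (reorder n l s) (inv l)" by (rule reorder_suborder[OF s l])
      then have "linear_extension n u (inv l)" using linear_extension_restrict[of n u "inv l"] True by simp
      then have linv: "linear_extension k u (inv l)" using uless k by (auto intro: linear_extension_mono)
      note w = reorder_suborder[OF u linv, unfolded inv_inv_eq[OF permutes_bij[OF lk]]]
      have "emeasure ?N1 X = emeasure \<mu> (basic_event k (\<lambda>i. B (inv l i)) ?w)"
        unfolding N1[OF Xs] unfolding X using relabel_vimage_basic_event[OF s l _ True uk, of B] k by simp
      also have "\<dots> = emeasure \<mu> (basic_event k (\<lambda>i. B (inv l (l i))) (reorder k l ?w))"
      proof -
        have "inv l i < k" if "i < k" for i using that permutes_lessThan_iff[OF permutes_inv[OF lk]] by simp
        then have "borel_labels k (\<lambda>i. B (inv l i))" using B by (auto simp: borel_labels_def)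
        then show ?thesis using invariant[OF _ w(1,2)] by (simp add: emeasure_eq_measure)
      qed
      also have "\<dots> = emeasure \<mu> X" unfolding X w(3) by (simp add: permutes_inverses[OF lk])
      finally have "emeasure ?N1 X = emeasure \<mu> X" .
      moreover have "\<omega> \<in> cell n (reorder n l s)" if "\<omega> \<in> X" for \<omega>
        using restr[OF that] True by (simp add: cell_def)
      then have "X \<inter> cell n (reorder n l s) = X" by blast
      ultimately show ?thesis using N2[OF Xs] by simp
    next
      case False
      have "\<omega> \<notin> cell n (reorder n l s)" if "\<omega> \<in> X" for \<omega>
        using restr[OF that] False by (simp add: cell_def)
      then have "X \<inter> cell n (reorder n l s) = {}" by blast
      then show ?thesis unfolding N1[OF Xs] N2[OF Xs] using relabel_mem_cell[OF _ l] 
        by (intro arg_cong[where f = "emeasure \<mu>"]) blast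
    qed
  qed
qed

lemma borel_measurable_eq: "borel_measurable \<mu> = borel_measurable Omega_space"
  by (rule measurable_cong_sets) (simp_all add: sets_eq)

lemma integrable_bounded:
  fixes f :: "_ \<Rightarrow> real"
  assumes "f \<in> borel_measurable Omega_space" "\<And>\<omega>. \<omega> \<in> Omega \<Longrightarrow> \<bar>f \<omega>\<bar> \<le> C"
  shows "integrable \<mu> f"
  using assms by (intro integrable_const_bound[of _ C]) (auto simp: borel_measurable_eq space_eq)

lemma integral_relabel:
  fixes f :: "_ \<Rightarrow> real"
  assumes s: "suborder_on {..<n} s" and l: "linear_extension n s l"
    and f [measurable]: "f \<in> borel_measurable Omega_space"
  shows "(\<integral>\<omega>. indicator (cell n s) \<omega> * f (relabel_if n l \<omega>) \<partial>\<mu>) =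
    (\<integral>\<omega>. indicator (cell n (reorder n l s)) \<omega> * f \<omega> \<partial>\<mu>)"
proof -
  have e: "density \<mu> (\<lambda>\<omega>. ennreal (indicator (cell n s) \<omega>)) = density \<mu> (indicator (cell n s))" for s
    by (intro arg_cong[where f = "density \<mu>"]) (auto split: split_indicator)
  have d: "(\<integral>\<omega>. g \<omega> \<partial>density \<mu> (indicator (cell n s))) = (\<integral>\<omega>. indicator (cell n s) \<omega> * g \<omega> \<partial>\<mu>)"
    if [measurable]: "g \<in> borel_measurable Omega_space" for g :: "_ \<Rightarrow> real" and s
    unfolding e[symmetric] by (subst integral_density) auto
  have "(\<integral>\<omega>. indicator (cell n s) \<omega> * f (relabel_if n l \<omega>) \<partial>\<mu>) =
    (\<integral>\<omega>. f (relabel_if n l \<omega>) \<partial>density \<mu> (indicator (cell n s)))"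
    by (rule d[symmetric]) measurable
  also have "\<dots> = (\<integral>\<omega>. f \<omega> \<partial>distr (density \<mu> (indicator (cell n s))) Omega_space (relabel_if n l))"
    by (rule integral_distr[symmetric]) measurable
  also have "\<dots> = (\<integral>\<omega>. f \<omega> \<partial>density \<mu> (indicator (cell n (reorder n l s))))"
    by (simp only: distr_relabel[OF s l])
  also have "\<dots> = (\<integral>\<omega>. indicator (cell n (reorder n l s)) \<omega> * f \<omega> \<partial>\<mu>)"
    by (rule d) measurable
  finally show ?thesis .
qed

lemma AE_relabel:
  assumes "N \<in> null_sets \<mu>"
  shows "AE \<omega> in \<mu>. \<forall>n l. linear_extension n (snd \<omega>) l \<longrightarrow> relabel l \<omega> \<notin> N"
proof -
  have N[measurable]: "N \<in> sets Omega_space" using assms sets_eq by auto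
  have *: "AE \<omega> in \<mu>. \<omega> \<in> cell n s \<longrightarrow> relabel l \<omega> \<notin> N"
    if s: "suborder_on {..<n} s" and l: "linear_extension n s l" for n s l
  proof -
    have "(\<integral>\<omega>. indicator (cell n s) \<omega> * indicator N (relabel_if n l \<omega>) \<partial>\<mu>) =
      (\<integral>\<omega>. indicator (cell n (reorder n l s)) \<omega> * indicator N \<omega> \<partial>\<mu>::real)"
      by (rule integral_relabel[OF s l]) measurable
    also have "\<dots> = 0"
      using AE_not_in[OF assms] by (intro integral_eq_zero_AE) auto
    finally have "(\<integral>\<omega>. indicator (cell n s) \<omega> * indicator N (relabel_if n l \<omega>) \<partial>\<mu>) = (0::real)" .
    moreover have "integrable \<mu> (\<lambda>\<omega>. indicator (cell n s) \<omega> * indicator N (relabel_if n l \<omega>) :: real)"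
      by (rule integrable_bounded[where C = 1]) (auto split: split_indicator)
    ultimately have "AE \<omega> in \<mu>. indicator (cell n s) \<omega> * indicator N (relabel_if n l \<omega>) = (0::real)"
      by (subst (asm) integral_nonneg_eq_0_iff_AE) auto
    then show ?thesis by eventually_elim (auto simp: relabel_if_cell[OF _ l])
  qed
  have "AE \<omega> in \<mu>. \<forall>n. \<forall>s\<in>{s. suborder_on {..<n} s}. \<forall>l\<in>{l. linear_extension n s l}.
      \<omega> \<in> cell n s \<longrightarrow> relabel l \<omega> \<notin> N"
    unfolding AE_all_countable
  proof (intro allI AE_finite_allI finite_suborders)
    fix n s show "finite {l. linear_extension n s l}"
      using finite_linear_extensions[of n s "\<lambda>_. True"] by simp
  qed (auto intro: *)
  then show ?thesis
  proof (rule AE_mp, intro AE_I2 impI allI)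
    fix \<omega> n l
    assume w: "\<omega> \<in> space \<mu>" and l: "linear_extension n (snd \<omega>) l"
     and all: "\<forall>n. \<forall>s\<in>{s. suborder_on {..<n} s}. \<forall>l\<in>{l. linear_extension n s l}.
      \<omega> \<in> cell n s \<longrightarrow> relabel l \<omega> \<notin> N"
    let ?s = "snd \<omega> \<inter> ({..<n} \<times> {..<n})"
    have "suborder_on {..<n} ?s" using w by (simp add: space_eq suborder_on_restrict)
    moreover have "\<omega> \<in> cell n ?s" using w by (simp add: space_eq cell_def)
    moreover have "linear_extension n ?s l" using l by (simp add: linear_extension_restrict)
    ultimately show "relabel l \<omega> \<notin> N" using all by blast
  qed
qed

text \<open>
  The defining property of the conditional probability. Both sides are sums over pairs of an
  order \<open>s\<close> on the first \<open>n\<close> indices and a linear extension \<open>l\<close> of \<open>s\<close>; order-invariance turns the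
  term of \<open>(s, l)\<close> into the one belonging to the reordered \<open>s\<close>, and \<open>(s, l) \<mapsto> (reorder n l s, inv l)\<close>
  is an involution on such pairs.
\<close>

lemma integral_avg:
  fixes g :: "_ \<Rightarrow> real"
  assumes A [measurable]: "A \<in> sets Omega_space" and g [measurable]: "g \<in> borel_measurable Omega_space"
    and bound: "\<And>\<omega>. \<omega> \<in> Omega \<Longrightarrow> \<bar>g \<omega>\<bar> \<le> 1"
    and inv: "\<And>\<omega> l. \<omega> \<in> Omega \<Longrightarrow> linear_extension n (snd \<omega>) l \<Longrightarrow> g (relabel l \<omega>) = g \<omega>"
  shows "(\<integral>\<omega>. avg n A \<omega> * g \<omega> \<partial>\<mu>) = (\<integral>\<omega>. indicator A \<omega> * g \<omega> \<partial>\<mu>)"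
proof -
  define h where "h \<omega> = indicator A \<omega> * g \<omega> / real (hits n UNIV \<omega>)" for \<omega>
  have h [measurable]: "h \<in> borel_measurable Omega_space" unfolding h_def[abs_def] by measurable
  have hb: "\<bar>h \<omega>\<bar> \<le> 1" if "\<omega> \<in> Omega" for \<omega>
  proof -
    have "1 \<le> real (hits n UNIV \<omega>)" using hits_UNIV_pos[OF that, of n] by linarith
    then show ?thesis using bound[OF that]
      by (auto simp: h_def abs_mult divide_le_eq split: split_indicator)
  qed
  define S where "S = {s. suborder_on {..<n} s}"
  define L where "L s = {l. linear_extension n s l}" for s
  have finS: "finite S" using finite_suborders by (simp add: S_def)
  have finL: "finite (L s)" for s using finite_linear_extensions[of n s "\<lambda>_. True"] by (simp add: L_def)
  \<comment> \<open>The cells partition \<open>Omega\<close>, so a sum over \<open>s\<close> reduces to the order that \<open>\<omega>\<close> has.\<close>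
  have only: "(\<Sum>s\<in>S. indicator (cell n s) \<omega> * F s) = F (snd \<omega> \<inter> ({..<n} \<times> {..<n}))"
    if w: "\<omega> \<in> Omega" for F :: "nat rel \<Rightarrow> real" and \<omega>
  proof -
    have zero: "indicator (cell n s) \<omega> = (0::real)" if "s \<noteq> snd \<omega> \<inter> ({..<n} \<times> {..<n})" for s
    proof -
      have "\<omega> \<notin> cell n s" using that unfolding cell_def by blast
      then show ?thesis by simp
    qed
    have "(\<Sum>s\<in>S. indicator (cell n s) \<omega> * F s) = (\<Sum>s\<in>{snd \<omega> \<inter> ({..<n} \<times> {..<n})}. indicator (cell n s) \<omega> * F s)"
      using finS suborder_on_restrict[OF w, of n]
      by (intro sum.mono_neutral_right) (simp_all add: S_def zero)
    then show ?thesis using w by (simp add: cell_def)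
  qed
  have int1: "integrable \<mu> (\<lambda>\<omega>. indicator (cell n s) \<omega> * h (relabel_if n l \<omega>))" for s l
  proof (rule integrable_bounded[where C = 1])
    fix \<omega> assume "\<omega> \<in> Omega"
    then have "relabel_if n l \<omega> \<in> Omega" by (auto simp: relabel_if_def relabel_Omega)
    from hb[OF this] show "\<bar>indicator (cell n s) \<omega> * h (relabel_if n l \<omega>)\<bar> \<le> 1"
      by (auto split: split_indicator)
  qed measurable
  have int2: "integrable \<mu> (\<lambda>\<omega>. indicator (cell n s) \<omega> * h \<omega>)" for s
    by (rule integrable_bounded[where C = 1]) (auto split: split_indicator dest: hb)
  define \<phi> where "\<phi> s = (\<integral>\<omega>. indicator (cell n s) \<omega> * h \<omega> \<partial>\<mu>)" for s
  have "(\<integral>\<omega>. avg n A \<omega> * g \<omega> \<partial>\<mu>) =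
    (\<integral>\<omega>. (\<Sum>s\<in>S. \<Sum>l\<in>L s. indicator (cell n s) \<omega> * h (relabel_if n l \<omega>)) \<partial>\<mu>)"
  proof (intro Bochner_Integration.integral_cong refl)
    fix \<omega> assume "\<omega> \<in> space \<mu>"
    then have w: "\<omega> \<in> Omega" by (simp add: space_eq)
    have "(\<Sum>s\<in>S. \<Sum>l\<in>L s. indicator (cell n s) \<omega> * h (relabel_if n l \<omega>)) =
       (\<Sum>l\<in>L (snd \<omega> \<inter> ({..<n} \<times> {..<n})). h (relabel_if n l \<omega>))"
      using only[OF w, of "\<lambda>s. \<Sum>l\<in>L s. h (relabel_if n l \<omega>)"] by (simp add: sum_distrib_left)
    also have "\<dots> = (\<Sum>l\<in>L (snd \<omega>). indicator A (relabel l \<omega>) * (g \<omega> / real (hits n UNIV \<omega>)))"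
      by (intro sum.cong)
        (auto simp: L_def linear_extension_restrict relabel_if_def h_def hits_relabel[OF w] inv[OF w])
    also have "\<dots> = real (hits n A \<omega>) * (g \<omega> / real (hits n UNIV \<omega>))"
    proof -
      have "(\<Sum>l\<in>L (snd \<omega>). indicator A (relabel l \<omega>)) = real (card {l \<in> L (snd \<omega>). relabel l \<omega> \<in> A})"
        using finL by (simp add: indicator_def sum.If_cases Int_def)
      then show ?thesis by (simp only: sum_distrib_right[symmetric] hits_def L_def mem_Collect_eq)
    qed
    finally show "avg n A \<omega> * g \<omega> = (\<Sum>s\<in>S. \<Sum>l\<in>L s. indicator (cell n s) \<omega> * h (relabel_if n l \<omega>))"
      by (simp add: avg_def)
  qed
  also have "\<dots> = (\<Sum>s\<in>S. \<Sum>l\<in>L s. \<phi> (reorder n l s))"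
    unfolding \<phi>_def using int1
    by (simp add: Bochner_Integration.integral_sum integrable_sum) (intro sum.cong refl integral_relabel; simp add: S_def L_def)
  also have "\<dots> = (\<Sum>(s, l)\<in>Sigma S L. \<phi> (reorder n l s))"
    using finS finL by (simp add: sum.Sigma)
  also have "\<dots> = (\<Sum>(s, l)\<in>Sigma S L. \<phi> s)"
  proof -
    have "reorder n (inv l) (reorder n l s) = s \<and> inv (inv l) = l \<and> reorder n l s \<in> S \<and> inv l \<in> L (reorder n l s)"
      if "s \<in> S" "l \<in> L s" for s l
    proof -
      have "l permutes {..<n}" using that by (simp add: L_def linear_extension_def)
      then have "inv (inv l) = l" by (simp add: inv_inv_eq permutes_bij)
      then show ?thesis using that reorder_suborder[of n s l] by (simp add: S_def L_def)
    qed
    then show ?thesis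
      by (intro sum.reindex_bij_witness[of _ "\<lambda>(s, l). (reorder n l s, inv l)" "\<lambda>(s, l). (reorder n l s, inv l)"]) auto
  qed
  also have "\<dots> = (\<Sum>s\<in>S. \<phi> s * real (card (L s)))"
    using finS finL by (simp add: sum.Sigma[symmetric] mult.commute)
  also have "\<dots> = (\<integral>\<omega>. (\<Sum>s\<in>S. indicator (cell n s) \<omega> * (h \<omega> * real (card (L s)))) \<partial>\<mu>)"
    unfolding \<phi>_def using int2 by (simp add: Bochner_Integration.integral_sum flip: mult.assoc)
  also have "\<dots> = (\<integral>\<omega>. indicator A \<omega> * g \<omega> \<partial>\<mu>)"
  proof (intro Bochner_Integration.integral_cong refl)
    fix \<omega> assume "\<omega> \<in> space \<mu>"
    then have w: "\<omega> \<in> Omega" by (simp add: space_eq)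
    have "real (card (L (snd \<omega> \<inter> ({..<n} \<times> {..<n})))) = real (hits n UNIV \<omega>)"
      by (simp add: L_def linear_extension_restrict hits_def)
    then show "(\<Sum>s\<in>S. indicator (cell n s) \<omega> * (h \<omega> * real (card (L s)))) = indicator A \<omega> * g \<omega>"
      using only[OF w, of "\<lambda>s. h \<omega> * real (card (L s))"] hits_UNIV_pos[OF w, of n] by (simp add: h_def)
  qed
  finally show ?thesis .
qed

text \<open>
  \<open>avg n A\<close> is invariant at level \<open>n\<close> and therefore at the lower level \<open>m\<close>, so both integrals equal
  the integral of \<open>avg n A\<close> over \<open>A\<close>.
\<close>

lemma integral_avg_mult:
  assumes A [measurable]: "A \<in> sets Omega_space" and "m \<le> n"
  shows "(\<integral>\<omega>. avg m A \<omega> * avg n A \<omega> \<partial>\<mu>) = (\<integral>\<omega>. (avg n A \<omega>)\<^sup>2 \<partial>\<mu>)"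
proof -
  have "(\<integral>\<omega>. avg k A \<omega> * avg n A \<omega> \<partial>\<mu>) = (\<integral>\<omega>. indicator A \<omega> * avg n A \<omega> \<partial>\<mu>)" if "k \<le> n" for k
    using that by (intro integral_avg) (auto simp: avg_bounds avg_relabel abs_le_iff intro: order_trans[OF _ avg_bounds(1)])
  from this[OF assms(2)] this[of n] show ?thesis by (simp add: power2_eq_square)
qed

lemma integrable_avg: "A \<in> sets Omega_space \<Longrightarrow> integrable \<mu> (avg n A)"
  by (rule integrable_bounded[where C = 1]) (auto simp: avg_bounds)

lemma integrable_avg_mult:
  "A \<in> sets Omega_space \<Longrightarrow> B \<in> sets Omega_space \<Longrightarrow> integrable \<mu> (\<lambda>\<omega>. avg m A \<omega> * avg n B \<omega>)"
  by (rule integrable_bounded[where C = 1]) (auto simp: avg_bounds abs_mult intro!: mult_le_one)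

lemma integrable_avg_square:
  "A \<in> sets Omega_space \<Longrightarrow> integrable \<mu> (\<lambda>\<omega>. (avg n A \<omega>)\<^sup>2)"
  unfolding power2_eq_square by (rule integrable_avg_mult)

lemma integral_avg_diff_square:
  assumes A [measurable]: "A \<in> sets Omega_space" and "m \<le> n"
  shows "(\<integral>\<omega>. (avg m A \<omega> - avg n A \<omega>)\<^sup>2 \<partial>\<mu>) = (\<integral>\<omega>. (avg m A \<omega>)\<^sup>2 \<partial>\<mu>) - (\<integral>\<omega>. (avg n A \<omega>)\<^sup>2 \<partial>\<mu>)"
proof -
  have "(\<integral>\<omega>. (avg m A \<omega> - avg n A \<omega>)\<^sup>2 \<partial>\<mu>) =
     (\<integral>\<omega>. ((avg m A \<omega>)\<^sup>2 + (avg n A \<omega>)\<^sup>2) - 2 * (avg m A \<omega> * avg n A \<omega>) \<partial>\<mu>)"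
    by (simp add: power2_diff mult.assoc)
  also have "\<dots> = (\<integral>\<omega>. (avg m A \<omega>)\<^sup>2 \<partial>\<mu>) + (\<integral>\<omega>. (avg n A \<omega>)\<^sup>2 \<partial>\<mu>) - 2 * (\<integral>\<omega>. avg m A \<omega> * avg n A \<omega> \<partial>\<mu>)"
    using integrable_avg_square[OF A] integrable_avg_mult[OF A A] by simp
  finally show ?thesis using integral_avg_mult[OF assms] by simp
qed

lemma integral_avg_eq: "A \<in> sets Omega_space \<Longrightarrow> (\<integral>\<omega>. avg n A \<omega> \<partial>\<mu>) = measure \<mu> A"
  using integral_avg[of A "\<lambda>_. 1" n] by (simp add: sets_eq)

end

section \<open>Extremality and the zero-one law\<close>

text \<open>
  Stability under passing from \<open>\<omega>\<close> to a re-enumeration suffices, because the inverse of a linear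
  extension is a linear extension of the reordered poset.
\<close>

definition invariant_event :: "((nat \<Rightarrow> real) \<times> nat rel) set \<Rightarrow> bool" where
  "invariant_event A \<longleftrightarrow> A \<in> sets Omega_space \<and>
     (\<forall>\<omega>\<in>A. \<forall>n l. linear_extension n (snd \<omega>) l \<longrightarrow> relabel l \<omega> \<in> A)"

lemma invariant_event_iff:
  assumes "invariant_event A" "\<omega> \<in> Omega" "linear_extension n (snd \<omega>) l"
  shows "relabel l \<omega> \<in> A \<longleftrightarrow> \<omega> \<in> A"
  using assms linear_extension_inv[OF assms(2,3)] relabel_inv[OF assms(3), of \<omega>]
  unfolding invariant_event_def by metis

lemma invariant_event_Compl:
  assumes "invariant_event A"
  shows "invariant_event (Omega - A)"
proof -
  have "Omega - A \<in> sets Omega_space"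
    using assms sets.compl_sets[of A Omega_space] by (simp add: invariant_event_def space_Omega_space)
  then show ?thesis using invariant_event_iff[OF assms] relabel_Omega
    by (auto simp: invariant_event_def)
qed

context order_invariant_measure
begin

lemma order_invariant_uniform_measure:
  assumes A: "invariant_event A" and pos: "measure \<mu> A \<noteq> 0"
  shows "order_invariant (uniform_measure \<mu> A)"
proof -
  have As [measurable]: "A \<in> sets Omega_space" using A by (simp add: invariant_event_def)
  have e0: "emeasure \<mu> A \<noteq> 0" using pos by (simp add: emeasure_eq_measure)
  have eq: "measure \<mu> (A \<inter> basic_event k B s) = measure \<mu> (A \<inter> basic_event k (\<lambda>i. B (l i)) (reorder k l s))"
    if B: "borel_labels k B" and s: "suborder_on {..<k} s" and l: "linear_extension k s l" for k B s l
  proof -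
    have lk: "l permutes {..<k}" using l by (simp add: linear_extension_def)
    let ?E = "basic_event k (\<lambda>i. B (l i)) (reorder k l s)"
    have "borel_labels k (\<lambda>i. B (l i))"
      using B permutes_lessThan_iff[OF lk] by (auto simp: borel_labels_def)
    then have [measurable]: "?E \<in> sets Omega_space" "basic_event k B s \<in> sets Omega_space"
      using reorder_suborder[OF s l] B s by (auto intro: basic_event_sets)
    have lab: "(\<forall>i<k. f (l i) \<in> B (l i)) \<longleftrightarrow> (\<forall>i<k. f i \<in> B i)" for f :: "nat \<Rightarrow> real"
      using permutes_lessThan_iff[OF lk] permutes_lessThan_iff[OF permutes_inv[OF lk]] permutes_inverses[OF lk] by metis
    have "relabel l \<omega> \<in> A \<inter> ?E \<longleftrightarrow> \<omega> \<in> A \<inter> basic_event k B s" if w: "\<omega> \<in> cell k s" for \<omega>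
    proof -
      have c: "relabel l \<omega> \<in> cell k (reorder k l s)" by (rule relabel_mem_cell[OF w l])
      have "linear_extension k (snd \<omega>) l" using l cell_linear_extension[OF w] by simp
      moreover have "\<omega> \<in> Omega" using w by (simp add: cell_def)
      ultimately have "relabel l \<omega> \<in> A \<longleftrightarrow> \<omega> \<in> A" using invariant_event_iff[OF A] by blast
      then show ?thesis using c w lab[of "fst \<omega>"] by (auto simp: mem_basic_event cell_def)
    qed
    then have 1: "indicator (cell k s) \<omega> * indicator (A \<inter> ?E) (relabel_if k l \<omega>) =
      (indicator (A \<inter> basic_event k B s) \<omega> :: real)" for \<omega>
      using relabel_if_cell[OF _ l] by (auto simp: mem_basic_event cell_def split: split_indicator)
    have 2: "indicator (cell k (reorder k l s)) \<omega> * indicator (A \<inter> ?E) \<omega> = (indicator (A \<inter> ?E) \<omega> :: real)" for \<omega>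
      by (auto simp: mem_basic_event cell_def split: split_indicator)
    have "(\<integral>\<omega>. indicator (A \<inter> basic_event k B s) \<omega> \<partial>\<mu>) = (\<integral>\<omega>. indicator (A \<inter> ?E) \<omega> \<partial>\<mu> :: real)"
      using integral_relabel[OF s l, of "indicator (A \<inter> ?E)"] unfolding 1 2 by simp
    then show ?thesis by simp
  qed
  have inE: "basic_event k B s \<in> sets \<mu>" if "borel_labels k B" "suborder_on {..<k} s" for k B s
    using that by (simp add: sets_eq basic_event_sets)
  show ?thesis
    unfolding order_invariant_def
  proof (intro conjI allI impI)
    show "prob_space (uniform_measure \<mu> A)" using e0 by (intro prob_space_uniform_measure) auto
    show "sets (uniform_measure \<mu> A) = sets Omega_space" by (simp add: sets_eq)
    fix k B s l assume *: "borel_labels k B" "suborder_on {..<k} s" "linear_extension k s l"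
    then have lk: "l permutes {..<k}" by (simp add: linear_extension_def)
    have "borel_labels k (\<lambda>i. B (l i))"
      using * permutes_lessThan_iff[OF lk] by (auto simp: borel_labels_def)
    then show "measure (uniform_measure \<mu> A) (basic_event k B s) =
       measure (uniform_measure \<mu> A) (basic_event k (\<lambda>i. B (l i)) (reorder k l s))"
      using * e0 eq[OF *] reorder_suborder[OF *(2,3)] by (simp add: inE emeasure_eq_measure)
  qed
qed

end

locale extremal_measure = order_invariant_measure +
  assumes extremal: "extremal_order_invariant \<mu>"
begin

text \<open>
  Conditioning on an invariant event preserves order-invariance, so a non-trivial one exhibits
  \<open>\<mu>\<close> as a proper mixture.
\<close>

lemma zero_one:
  assumes A: "invariant_event A"
  shows "measure \<mu> A = 0 \<or> measure \<mu> A = 1"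
proof (rule ccontr)
  assume "\<not> (measure \<mu> A = 0 \<or> measure \<mu> A = 1)"
  then have m: "0 < measure \<mu> A" "measure \<mu> A < 1"
    using measure_nonneg[of \<mu> A] prob_le_1[of A] by linarith+
  have As [measurable]: "A \<in> sets Omega_space" using A by (simp add: invariant_event_def)
  let ?C = "Omega - A"
  have Cs: "?C \<in> sets Omega_space" using invariant_event_Compl[OF A] by (simp add: invariant_event_def)
  have C: "measure \<mu> ?C = 1 - measure \<mu> A"
    using prob_compl[of A] As by (simp add: space_eq sets_eq)
  let ?m1 = "uniform_measure \<mu> A" and ?m2 = "uniform_measure \<mu> ?C"
  have e: "emeasure \<mu> A \<noteq> 0" "emeasure \<mu> ?C \<noteq> 0" using m C by (simp_all add: emeasure_eq_measure)
  have m1: "measure ?m1 B = measure \<mu> (A \<inter> B) / measure \<mu> A" if "B \<in> sets Omega_space" for B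
    using that e by (intro measure_uniform_measure) (auto simp: sets_eq emeasure_eq_measure)
  have m2: "measure ?m2 B = measure \<mu> (?C \<inter> B) / measure \<mu> ?C" if "B \<in> sets Omega_space" for B
    using that e by (intro measure_uniform_measure) (auto simp: sets_eq emeasure_eq_measure)
  have "order_invariant ?m1" "order_invariant ?m2"
    using m C by (auto intro!: order_invariant_uniform_measure A invariant_event_Compl)
  moreover have "?m1 \<noteq> ?m2"
  proof
    assume "?m1 = ?m2"
    then have "measure ?m1 A = measure ?m2 A" by simp
    moreover have "?C \<inter> A = {}" by auto
    ultimately show False unfolding m1[OF As] m2[OF As] using m by simp
  qed
  moreover have "measure \<mu> B = measure \<mu> A * measure ?m1 B + (1 - measure \<mu> A) * measure ?m2 B"
    if B [measurable]: "B \<in> sets Omega_space" for B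
  proof -
    have "B \<subseteq> Omega" using sets.sets_into_space[OF B] by (simp add: space_Omega_space)
    then have "B = (A \<inter> B) \<union> (?C \<inter> B)" by auto
    moreover have "measure \<mu> ((A \<inter> B) \<union> (?C \<inter> B)) = measure \<mu> (A \<inter> B) + measure \<mu> (?C \<inter> B)"
      using Cs by (intro finite_measure_Union) (auto simp: sets_eq)
    ultimately show ?thesis using m C by (simp add: m1 m2)
  qed
  ultimately show False using extremal m unfolding extremal_order_invariant_def by blast
qed

lemma zero_one_AE:
  assumes [measurable]: "Measurable.pred Omega_space P"
    and inv: "\<And>\<omega> n l. \<omega> \<in> Omega \<Longrightarrow> linear_extension n (snd \<omega>) l \<Longrightarrow> P \<omega> \<Longrightarrow> P (relabel l \<omega>)"
  shows "(AE \<omega> in \<mu>. P \<omega>) \<or> (AE \<omega> in \<mu>. \<not> P \<omega>)"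
proof -
  define A where "A = {\<omega> \<in> Omega. P \<omega>}"
  have A: "A = {\<omega> \<in> space Omega_space. P \<omega>}" by (simp add: A_def space_Omega_space)
  have As [measurable]: "A \<in> sets Omega_space" unfolding A by measurable
  have "invariant_event A"
    using inv relabel_Omega As unfolding invariant_event_def by (auto simp: A_def)
  then consider "measure \<mu> A = 0" | "measure \<mu> A = 1" using zero_one by blast
  then show ?thesis
  proof cases
    case 1
    then have "A \<in> null_sets \<mu>" by (auto simp: null_sets_def sets_eq emeasure_eq_measure)
    then have "AE \<omega> in \<mu>. \<omega> \<notin> A" by (rule AE_not_in)
    then have "AE \<omega> in \<mu>. \<not> P \<omega>" by (rule AE_mp) (auto simp: A_def space_eq)
    then show ?thesis ..
  next
    case 2
    then have "AE \<omega> in \<mu>. \<omega> \<in> A" by (subst (asm) prob_eq_1) (auto simp: sets_eq)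
    then have "AE \<omega> in \<mu>. P \<omega>" by (rule AE_mp) (auto simp: A_def)
    then show ?thesis ..
  qed
qed

lemma invariant_AE_const:
  fixes Y :: "_ \<Rightarrow> real"
  assumes Y [measurable]: "Y \<in> borel_measurable Omega_space"
    and inv: "\<And>\<omega> n l. \<omega> \<in> Omega \<Longrightarrow> linear_extension n (snd \<omega>) l \<Longrightarrow> Y (relabel l \<omega>) = Y \<omega>"
    and int: "integrable \<mu> Y"
  shows "AE \<omega> in \<mu>. Y \<omega> = (\<integral>\<omega>. Y \<omega> \<partial>\<mu>)"
proof -
  let ?m = "\<integral>\<omega>. Y \<omega> \<partial>\<mu>"
  have ne: "emeasure \<mu> (space \<mu>) \<noteq> 0" by (simp add: emeasure_space_1)
  have const: "(\<integral>\<omega>. ?m \<partial>\<mu>) = ?m" by (simp add: prob_space)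
  have "\<not> (AE \<omega> in \<mu>. Y \<omega> < ?m)"
    using integral_less_AE_space[OF int _ _ ne, of "\<lambda>_. ?m"] const by auto
  then have 1: "AE \<omega> in \<mu>. \<not> Y \<omega> < ?m"
    using zero_one_AE[of "\<lambda>\<omega>. Y \<omega> < ?m"] by (auto simp: inv)
  have "\<not> (AE \<omega> in \<mu>. ?m < Y \<omega>)"
    using integral_less_AE_space[OF _ int _ ne, of "\<lambda>_. ?m"] const by auto
  then have 2: "AE \<omega> in \<mu>. \<not> ?m < Y \<omega>"
    using zero_one_AE[of "\<lambda>\<omega>. ?m < Y \<omega>"] by (auto simp: inv)
  from 1 2 show ?thesis by eventually_elim auto
qed

text \<open>
  A reversed martingale argument. The second moments of \<open>avg n A\<close> decrease, and the squared
  distance in mean square between two averages is the difference of their second moments; so a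
  subsequence converges almost everywhere. The pointwise limit is unchanged by any
  re-enumeration, as each of those affects only finitely many terms; by extremality it is
  constant, namely \<open>\<mu>(A)\<close>. Monotonicity of the second moments extends the conclusion from the
  subsequence to the whole sequence.
\<close>

lemma integral_avg_square_tendsto:
  assumes A [measurable]: "A \<in> sets Omega_space"
  shows "(\<lambda>n. \<integral>\<omega>. (avg n A \<omega>)\<^sup>2 \<partial>\<mu>) \<longlonglongrightarrow> (measure \<mu> A)\<^sup>2"
proof -
  define V where "V n = (\<integral>\<omega>. (avg n A \<omega>)\<^sup>2 \<partial>\<mu>)" for n
  have diff: "(\<integral>\<omega>. (avg m A \<omega> - avg n A \<omega>)\<^sup>2 \<partial>\<mu>) = V m - V n" if "m \<le> n" for m n
    using integral_avg_diff_square[OF A that] by (simp add: V_def)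
  have "V n \<le> V m" if "m \<le> n" for m n
  proof -
    have "0 \<le> (\<integral>\<omega>. (avg m A \<omega> - avg n A \<omega>)\<^sup>2 \<partial>\<mu>)" by simp
    then show ?thesis using diff[OF that] by simp
  qed
  then have dec: "decseq V" by (auto simp: decseq_def)
  have "\<forall>n. 0 \<le> V n" by (simp add: V_def)
  from decseq_convergent[OF dec this] obtain v where v: "V \<longlonglongrightarrow> v" by blast
  have int: "integrable \<mu> (avg n A)" for n by (rule integrable_avg[OF A])
  have L1: "(\<integral>\<omega>. norm (avg i A \<omega> - avg j A \<omega>) \<partial>\<mu>) \<le> sqrt \<bar>V i - V j\<bar>" for i j
  proof -
    have i2: "integrable \<mu> (\<lambda>\<omega>. (avg i A \<omega> - avg j A \<omega>)\<^sup>2)"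
      using integrable_avg_square[OF A] integrable_avg_mult[OF A A] by (simp add: power2_diff mult.assoc)
    have "(\<integral>\<omega>. \<bar>avg i A \<omega> - avg j A \<omega>\<bar> \<partial>\<mu>)\<^sup>2 \<le> (\<integral>\<omega>. \<bar>avg i A \<omega> - avg j A \<omega>\<bar>\<^sup>2 \<partial>\<mu>)"
    proof -
      have "0 \<le> variance (\<lambda>\<omega>. \<bar>avg i A \<omega> - avg j A \<omega>\<bar>)" by simp
      then show ?thesis using int i2 by (subst (asm) variance_eq) auto
    qed
    also have "\<dots> = \<bar>V i - V j\<bar>"
    proof (cases "i \<le> j")
      case True
      then show ?thesis using diff[of i j] decseqD[OF dec, of i j] by simp
    next
      case False
      then have "j \<le> i" by simp
      then show ?thesis using diff[of j i] decseqD[OF dec, of j i] by (simp add: power2_commute)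
    qed
    finally show ?thesis by (simp add: real_le_rsqrt)
  qed
  have "\<exists>N. \<forall>i\<ge>N. \<forall>j\<ge>N. (\<integral>\<omega>. norm (avg i A \<omega> - avg j A \<omega>) \<partial>\<mu>) < e" if "0 < e" for e
  proof -
    have "Cauchy V" "0 < e\<^sup>2" using v that by (auto intro: LIMSEQ_imp_Cauchy)
    then obtain N where N: "\<And>i j. N \<le> i \<Longrightarrow> N \<le> j \<Longrightarrow> \<bar>V i - V j\<bar> < e\<^sup>2"
      unfolding Cauchy_def dist_real_def by blast
    have "(\<integral>\<omega>. norm (avg i A \<omega> - avg j A \<omega>) \<partial>\<mu>) < e" if "N \<le> i" "N \<le> j" for i j
      using L1[of i j] real_sqrt_less_mono[OF N[OF that]] \<open>0 < e\<close> by simp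
    then show ?thesis by blast
  qed
  from cauchy_L1_AE_cauchy_subseq[of \<mu> "\<lambda>n. avg n A", OF int this]
  obtain \<rho> where \<rho>: "strict_mono \<rho>" and cau: "AE \<omega> in \<mu>. Cauchy (\<lambda>i. avg (\<rho> i) A \<omega>)" by blast
  define Y where "Y \<omega> = lim (\<lambda>i. avg (\<rho> i) A \<omega>)" for \<omega>
  have Ym: "Y \<in> borel_measurable Omega_space" unfolding Y_def[abs_def] by measurable
  have lim: "AE \<omega> in \<mu>. (\<lambda>i. avg (\<rho> i) A \<omega>) \<longlonglongrightarrow> Y \<omega>"
    using cau by eventually_elim (simp add: Y_def Cauchy_convergent_iff convergent_LIMSEQ_iff)
  have Yinv: "Y (relabel l \<omega>) = Y \<omega>" if w: "\<omega> \<in> Omega" and l: "linear_extension n (snd \<omega>) l" for \<omega> n l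
  proof -
    have "eventually (\<lambda>i. avg (\<rho> i) A (relabel l \<omega>) = avg (\<rho> i) A \<omega>) sequentially"
      using eventually_ge_at_top[of n]
    proof eventually_elim
      case (elim i)
      have "n \<le> \<rho> i" using elim seq_suble[OF \<rho>, of i] by linarith
      then show ?case by (rule avg_relabel[OF w l])
    qed
    then have "(\<lambda>i. avg (\<rho> i) A (relabel l \<omega>)) \<longlonglongrightarrow> L \<longleftrightarrow> (\<lambda>i. avg (\<rho> i) A \<omega>) \<longlonglongrightarrow> L" for L
      by (rule tendsto_cong)
    then show ?thesis unfolding Y_def lim_def by (simp only:)
  qed
  have meas: "Y \<in> borel_measurable \<mu>" "avg (\<rho> i) A \<in> borel_measurable \<mu>" for i
    using Ym by (simp_all add: borel_measurable_eq)
  have le1: "AE \<omega> in \<mu>. norm (avg (\<rho> i) A \<omega>) \<le> 1" for i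
    by (simp add: avg_bounds)
  have "integrable \<mu> (\<lambda>_. 1 :: real)" by simp
  note dc = meas this lim le1
  have dom: "integrable \<mu> Y \<and> (\<lambda>i. \<integral>\<omega>. avg (\<rho> i) A \<omega> \<partial>\<mu>) \<longlonglongrightarrow> (\<integral>\<omega>. Y \<omega> \<partial>\<mu>)"
    using integrable_dominated_convergence[OF dc] integral_dominated_convergence[OF dc] by simp
  then have EY: "(\<integral>\<omega>. Y \<omega> \<partial>\<mu>) = measure \<mu> A"
    using LIMSEQ_unique[of "\<lambda>i. measure \<mu> A"] by (simp add: integral_avg_eq)
  have "AE \<omega> in \<mu>. Y \<omega> = measure \<mu> A"
    using invariant_AE_const[OF Ym Yinv] dom EY by simp
  with lim have lim': "AE \<omega> in \<mu>. (\<lambda>i. (avg (\<rho> i) A \<omega>)\<^sup>2) \<longlonglongrightarrow> (measure \<mu> A)\<^sup>2"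
    by eventually_elim (auto intro!: tendsto_power)
  have "(\<lambda>i. \<integral>\<omega>. (avg (\<rho> i) A \<omega>)\<^sup>2 \<partial>\<mu>) \<longlonglongrightarrow> (\<integral>\<omega>. (measure \<mu> A)\<^sup>2 \<partial>\<mu>)"
  proof (rule integral_dominated_convergence[where w = "\<lambda>_. 1"])
    show "(\<lambda>\<omega>. (avg (\<rho> i) A \<omega>)\<^sup>2) \<in> borel_measurable \<mu>" for i using meas(2) by simp
    show "AE \<omega> in \<mu>. norm ((avg (\<rho> i) A \<omega>)\<^sup>2) \<le> 1" for i by (simp add: avg_bounds power_le_one)
  qed (use lim' in simp_all)
  then have "(V \<circ> \<rho>) \<longlonglongrightarrow> (measure \<mu> A)\<^sup>2" by (simp add: V_def o_def prob_space)
  moreover have "(V \<circ> \<rho>) \<longlonglongrightarrow> v" by (rule LIMSEQ_subseq_LIMSEQ[OF v \<rho>])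
  ultimately show ?thesis using v LIMSEQ_unique unfolding V_def by blast
qed

lemma measure_square_le_integral_avg:
  assumes A: "A \<in> sets Omega_space"
  shows "(measure \<mu> A)\<^sup>2 \<le> (\<integral>\<omega>. (avg n A \<omega>)\<^sup>2 \<partial>\<mu>)"
proof -
  have "0 \<le> variance (avg n A)" by simp
  then show ?thesis
    using integrable_avg[OF A] integrable_avg_square[OF A] integral_avg_eq[OF A, of n]
    by (subst (asm) variance_eq) auto
qed

end

section \<open>Atomless measures on the real line\<close>

text \<open>
  The distribution function of an atomless measure is continuous, hence uniformly continuous on a
  compact interval. The half-open intervals start at \<open>-1 / m\<close>, so that the point 0 is covered too.
\<close>

lemma atomless_small_intervals:
  fixes \<kappa> :: "real measure"
  assumes "finite_measure \<kappa>" "sets \<kappa> = sets borel" and atomless: "\<And>p. measure \<kappa> {p} = 0" and "0 < e"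
  obtains m :: nat where "0 < m" "\<And>i. i \<le> m \<Longrightarrow> measure \<kappa> {(real i - 1) / real m <.. real i / real m} \<le> e"
proof -
  interpret finite_borel_measure \<kappa>
    using assms(1,2) by (simp add: finite_borel_measure_def finite_borel_measure_axioms_def)
  have "continuous_on {-1..1} (cdf \<kappa>)"
    using atomless by (intro continuous_at_imp_continuous_on ballI) (simp add: isCont_cdf)
  then have "uniformly_continuous_on {-1..1} (cdf \<kappa>)" by (rule compact_uniformly_continuous) simp
  then obtain d where d: "0 < d" "\<And>x y. x \<in> {-1..1} \<Longrightarrow> y \<in> {-1..1} \<Longrightarrow> dist y x < d \<Longrightarrow> dist (cdf \<kappa> y) (cdf \<kappa> x) < e"
    using \<open>0 < e\<close> unfolding uniformly_continuous_on_def by meson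
  obtain m where m: "inverse (real (Suc m)) < d" using reals_Archimedean[OF d(1)] by blast
  show thesis
  proof
    show "0 < Suc m" by simp
    fix i assume i: "i \<le> Suc m"
    let ?a = "(real i - 1) / real (Suc m)" and ?b = "real i / real (Suc m)"
    have ab: "?b - ?a = inverse (real (Suc m))" by (simp add: field_simps)
    then have lt: "?a < ?b" by (metis diff_gt_0_iff_gt of_nat_0_less_iff positive_imp_inverse_positive zero_less_Suc)
    have "-1 \<le> ?a" "?b \<le> 1" using i by (auto simp: field_simps)
    then have "dist (cdf \<kappa> ?b) (cdf \<kappa> ?a) < e"
      using lt ab m by (intro d(2)) (auto simp: dist_real_def)
    then show "measure \<kappa> {?a <.. ?b} \<le> e"
      unfolding cdf_diff_eq[OF lt, symmetric] dist_real_def by linarith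
  qed
qed

section \<open>Labels below an element\<close>

definition down :: "(nat \<Rightarrow> real) \<times> nat rel \<Rightarrow> nat \<Rightarrow> real set" where
  "down \<omega> i = fst \<omega> ` {j. (j, i) \<in> snd \<omega>}"

lemma finite_down: "\<omega> \<in> Omega \<Longrightarrow> finite (down \<omega> i)"
  unfolding down_def
  by (intro finite_imageI finite_subset[of "{j. (j, i) \<in> snd \<omega>}" "{..<i}"]) (auto dest: Omega_less)

lemma down_relabel:
  assumes "linear_extension n r l"
  shows "down (relabel l \<omega>) i = down \<omega> (l i)"
proof -
  have "surj l" using assms by (auto simp: linear_extension_def permutes_surj)
  then have "{j. (j, l i) \<in> snd \<omega>} = l ` {j. (l j, l i) \<in> snd \<omega>}"
    by (auto simp: image_iff surj_def)
  then show ?thesis by (auto simp: down_def)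
qed

lemma mem_down_measurable [measurable]: "Measurable.pred Omega_space (\<lambda>\<omega>. p \<in> down \<omega> i)"
proof -
  have "Measurable.pred Omega_space (\<lambda>\<omega>. \<exists>j. (j, i) \<in> snd \<omega> \<and> fst \<omega> j = p)" by measurable
  also have "(\<lambda>\<omega>. \<exists>j. (j, i) \<in> snd \<omega> \<and> fst \<omega> j = p) = (\<lambda>\<omega>. p \<in> down \<omega> i)"
    by (auto simp: down_def)
  finally show ?thesis .
qed

lemma down_eq_measurable:
  assumes "finite D"
  shows "Measurable.pred Omega_space (\<lambda>\<omega>. down \<omega> i = D)"
proof -
  have [measurable]: "D \<in> sets borel" using assms by (simp add: borel_closed finite_imp_closed)
  note [measurable] = countable_finite[OF assms]
  have "Measurable.pred Omega_space (\<lambda>\<omega>. (\<forall>j. (j, i) \<in> snd \<omega> \<longrightarrow> fst \<omega> j \<in> D) \<and> (\<forall>d\<in>D. d \<in> down \<omega> i))"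
    by measurable
  also have "(\<lambda>\<omega>. (\<forall>j. (j, i) \<in> snd \<omega> \<longrightarrow> fst \<omega> j \<in> D) \<and> (\<forall>d\<in>D. d \<in> down \<omega> i)) = (\<lambda>\<omega>. down \<omega> i = D)"
    by (auto simp: down_def)
  finally show ?thesis .
qed

section \<open>Labels that are almost surely present\<close>

context prob_space
begin

lemma AE_ex:
  assumes "AE \<omega> in M. P \<omega>"
  shows "\<exists>\<omega>. P \<omega>"
proof (rule ccontr)
  assume no: "\<not> (\<exists>\<omega>. P \<omega>)"
  from assms have "AE \<omega> in M. False" by eventually_elim (use no in blast)
  then show False by simp
qed

lemma AE_iff_AE:
  assumes "(AE \<omega> in M. P \<omega>) \<or> (AE \<omega> in M. \<not> P \<omega>)"
  shows "AE \<omega> in M. P \<omega> \<longleftrightarrow> (AE \<omega> in M. P \<omega>)"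
  using assms
proof
  assume "AE \<omega> in M. P \<omega>"
  then show ?thesis by simp
next
  assume no: "AE \<omega> in M. \<not> P \<omega>"
  have "\<not> (AE \<omega> in M. P \<omega>)"
  proof
    assume "AE \<omega> in M. P \<omega>"
    with no have "AE \<omega> in M. False" by eventually_elim simp
    then show False by simp
  qed
  then show ?thesis using no by simp
qed

end

locale distinct_extremal_measure = extremal_measure +
  assumes distinct: "as_distinct_labels \<mu>"
begin

lemma AE_inj: "AE \<omega> in \<mu>. inj (fst \<omega>)"
proof -
  have "AE \<omega> in \<mu>. \<omega> \<notin> {(x, r) \<in> Omega. \<exists>i j. i \<noteq> j \<and> x i = x j}"
    using distinct by (intro AE_not_in) (simp add: as_distinct_labels_def)
  then show ?thesis
    by (rule AE_mp) (auto intro!: AE_I2 simp: space_eq inj_def, blast)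
qed

text \<open>
  The label of an element together with the set of labels below it does not depend on the
  enumeration, so neither does the existence, or the number, of elements for which they have a
  given property.
\<close>

lemma zero_one_exists:
  assumes [measurable]: "\<And>i. Measurable.pred Omega_space (\<lambda>\<omega>. \<Phi> (fst \<omega> i) (down \<omega> i))"
  shows "(AE \<omega> in \<mu>. \<exists>i. \<Phi> (fst \<omega> i) (down \<omega> i)) \<or> (AE \<omega> in \<mu>. \<not> (\<exists>i. \<Phi> (fst \<omega> i) (down \<omega> i)))"
proof (rule zero_one_AE)
  fix \<omega> n l assume l: "linear_extension n (snd \<omega>) l" and "\<exists>i. \<Phi> (fst \<omega> i) (down \<omega> i)"
  then obtain i where i: "\<Phi> (fst \<omega> i) (down \<omega> i)" by blast
  have "surj l" using l by (auto simp: linear_extension_def permutes_surj)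
  then obtain j where "i = l j" by (metis surjD)
  then show "\<exists>i. \<Phi> (fst (relabel l \<omega>) i) (down (relabel l \<omega>) i)"
    using i by (auto simp: down_relabel[OF l])
qed measurable

lemma zero_one_infinite:
  assumes [measurable]: "\<And>i. Measurable.pred Omega_space (\<lambda>\<omega>. \<Phi> (fst \<omega> i) (down \<omega> i))"
  shows "(AE \<omega> in \<mu>. infinite {i. \<Phi> (fst \<omega> i) (down \<omega> i)}) \<or>
    (AE \<omega> in \<mu>. \<not> infinite {i. \<Phi> (fst \<omega> i) (down \<omega> i)})"
proof (rule zero_one_AE)
  show "Measurable.pred Omega_space (\<lambda>\<omega>. infinite {i. \<Phi> (fst \<omega> i) (down \<omega> i)})"
    unfolding infinite_nat_iff_unbounded by measurable
  fix \<omega> n l assume l: "linear_extension n (snd \<omega>) l" and inf: "infinite {i. \<Phi> (fst \<omega> i) (down \<omega> i)}"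
  have "surj l" using l by (auto simp: linear_extension_def permutes_surj)
  then have "{i. \<Phi> (fst \<omega> i) (down \<omega> i)} = l ` {i. \<Phi> (fst (relabel l \<omega>) i) (down (relabel l \<omega>) i)}"
    by (auto simp: down_relabel[OF l] image_iff surj_def)
  then show "infinite {i. \<Phi> (fst (relabel l \<omega>) i) (down (relabel l \<omega>) i)}"
    using inf by (metis finite_imageI)
qed

text \<open>
  The labels of the unmarked elements of the poset \<open>Q\<close> to be constructed.
\<close>

definition fixed_labels :: "real set" where
  "fixed_labels = {p. AE \<omega> in \<mu>. p \<in> range (fst \<omega>)}"

lemma AE_not_fixed: "p \<notin> fixed_labels \<Longrightarrow> AE \<omega> in \<mu>. p \<notin> range (fst \<omega>)"
  using zero_one_exists[of "\<lambda>x D. x = p"] by (auto simp: fixed_labels_def image_iff eq_commute)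

lemma AE_Omega: "AE \<omega> in \<mu>. \<omega> \<in> Omega"
  by (rule AE_I2) (simp add: space_eq)

lemma fixed_labels_unit: "fixed_labels \<subseteq> {0..1}"
proof
  fix p assume "p \<in> fixed_labels"
  then have "AE \<omega> in \<mu>. p \<in> range (fst \<omega>)" by (simp add: fixed_labels_def)
  with AE_Omega have "AE \<omega> in \<mu>. p \<in> range (fst \<omega>) \<and> \<omega> \<in> Omega" by eventually_elim simp
  then show "p \<in> {0..1}" using AE_ex Omega_label by blast
qed

lemma countable_fixed_labels: "countable fixed_labels"
proof -
  let ?d = "\<lambda>i. distr \<mu> borel (\<lambda>\<omega>. fst \<omega> i)"
  have "fixed_labels \<subseteq> (\<Union>i. {p. measure (?d i) {p} \<noteq> 0})"
  proof
    fix p assume p: "p \<in> fixed_labels"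
    show "p \<in> (\<Union>i. {p. measure (?d i) {p} \<noteq> 0})"
    proof (rule ccontr)
      assume "\<not> ?thesis"
      then have "measure (?d i) {p} = 0" for i by auto
      then have "measure \<mu> {\<omega> \<in> space \<mu>. fst \<omega> i = p} = 0" for i
        by (subst (asm) measure_distr) (auto simp: vimage_def Int_def conj_commute)
      then have "AE \<omega> in \<mu>. fst \<omega> i \<noteq> p" for i
        by (subst (asm) prob_eq_0) (auto elim!: AE_mp)
      then have "AE \<omega> in \<mu>. \<forall>i. fst \<omega> i \<noteq> p" by (simp add: AE_all_countable)
      moreover have "AE \<omega> in \<mu>. p \<in> range (fst \<omega>)" using p by (simp add: fixed_labels_def)
      ultimately have "AE \<omega> in \<mu>. False" by eventually_elim auto
      then show False by simp
    qed
  qed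
  moreover have "countable {p. measure (?d i) {p} \<noteq> 0}" for i
  proof -
    interpret d: prob_space "?d i" by (rule prob_space_distr) measurable
    show ?thesis by (rule d.countable_support)
  qed
  ultimately show ?thesis by (meson countable_UN countable_subset countableI_type)
qed

lemma fixed_labels_borel [measurable]: "fixed_labels \<in> sets borel"
  using countable_fixed_labels by (rule sets.countable[rotated]) auto

section \<open>Elements that are not maximal\<close>

text \<open>
  The key estimate. Squares of probabilities are at most limits of mean squared frequencies, and
  these are bounded by \<open>avg_followed_square_le\<close> for the partition of the label space into intervals
  of length \<open>1 / m\<close>. The sum of the squared probabilities is at most the largest probability, which
  is small because \<open>\<kappa>\<close>, the distribution of the label at position \<open>k\<close> on the event that it is not
  fixed, has no atoms.
\<close>

lemma prefix_followed_null:
  "prefix_event k ds (\<lambda>\<omega>. fst \<omega> k \<notin> fixed_labels \<and> followed k t \<omega>) \<in> null_sets \<mu>" (is "?B \<in> _")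
proof -
  have B [measurable]: "?B \<in> sets Omega_space" by measurable
  define E where "E = prefix_event k ds (\<lambda>\<omega>. fst \<omega> k \<notin> fixed_labels)"
  have E [measurable]: "E \<in> sets Omega_space" unfolding E_def by measurable
  define \<kappa> where "\<kappa> = distr (density \<mu> (indicator E)) borel (\<lambda>\<omega>. fst \<omega> k)"
  have em: "emeasure \<kappa> X = emeasure \<mu> {\<omega> \<in> E. fst \<omega> k \<in> X}" if [measurable]: "X \<in> sets borel" for X
  proof -
    have EO: "E \<subseteq> space \<mu>" by (auto simp: E_def prefix_event_def space_eq)
    have [measurable]: "(\<lambda>\<omega>. fst \<omega> k) -` X \<inter> space \<mu> \<in> sets \<mu>"
      by (rule measurable_sets[OF _ that]) measurable
    have "emeasure \<kappa> X = emeasure (density \<mu> (indicator E)) ((\<lambda>\<omega>. fst \<omega> k) -` X \<inter> space \<mu>)"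
      unfolding \<kappa>_def by (subst emeasure_distr) auto
    also have "\<dots> = (\<integral>\<^sup>+\<omega>. indicator E \<omega> * indicator ((\<lambda>\<omega>. fst \<omega> k) -` X \<inter> space \<mu>) \<omega> \<partial>\<mu>)"
      by (rule emeasure_density) measurable
    also have "\<dots> = (\<integral>\<^sup>+\<omega>. indicator (E \<inter> ((\<lambda>\<omega>. fst \<omega> k) -` X \<inter> space \<mu>)) \<omega> \<partial>\<mu>)"
      by (intro nn_integral_cong) (simp split: split_indicator)
    also have "\<dots> = emeasure \<mu> (E \<inter> ((\<lambda>\<omega>. fst \<omega> k) -` X \<inter> space \<mu>))" by simp
    also have "E \<inter> ((\<lambda>\<omega>. fst \<omega> k) -` X \<inter> space \<mu>) = {\<omega> \<in> E. fst \<omega> k \<in> X}" using EO by auto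
    finally show ?thesis .
  qed
  have ms: "measure \<kappa> X = measure \<mu> {\<omega> \<in> E. fst \<omega> k \<in> X}" if "X \<in> sets borel" for X
    using em[OF that] by (simp add: measure_def)
  have fin: "finite_measure \<kappa>"
  proof
    show "emeasure \<kappa> (space \<kappa>) \<noteq> \<infinity>" using em[of UNIV] by (simp add: \<kappa>_def)
  qed
  have atomless: "measure \<kappa> {p} = 0" for p
  proof (cases "p \<in> fixed_labels")
    case True
    then have e: "{\<omega> \<in> E. fst \<omega> k \<in> {p}} = {}" by (auto simp: E_def prefix_event_def)
    have "measure \<kappa> {p} = measure \<mu> {\<omega> \<in> E. fst \<omega> k \<in> {p}}" by (rule ms) simp
    then show ?thesis by (simp only: e measure_empty)
  next
    case False
    have "AE \<omega> in \<mu>. \<omega> \<notin> {\<omega> \<in> E. fst \<omega> k \<in> {p}}"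
      using AE_not_fixed[OF False] by eventually_elim auto
    moreover have "{\<omega> \<in> E. fst \<omega> k \<in> {p}} = prefix_event k ds (\<lambda>\<omega>. fst \<omega> k \<notin> fixed_labels \<and> fst \<omega> k = p)"
      by (auto simp: E_def prefix_event_def)
    then have "{\<omega> \<in> E. fst \<omega> k \<in> {p}} \<in> sets \<mu>" by (simp add: sets_eq)
    ultimately have "measure \<mu> {\<omega> \<in> E. fst \<omega> k \<in> {p}} = 0" by (simp only: prob_eq_0)
    then show ?thesis using ms[of "{p}"] by simp
  qed
  have bound: "(measure \<mu> ?B)\<^sup>2 \<le> real t * e" if "0 < e" for e
  proof -
    have "sets \<kappa> = sets borel" by (simp add: \<kappa>_def)
    then obtain m where m: "0 < m" and small: "\<And>i. i \<le> m \<Longrightarrow> measure \<kappa> {(real i - 1) / real m <.. real i / real m} \<le> e"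
      using atomless_small_intervals[OF fin _ atomless \<open>0 < e\<close>] by blast
    define c where "c x = nat \<lceil>real m * x\<rceil>" for x
    have [measurable]: "Measurable.pred Omega_space (\<lambda>\<omega>. c (fst \<omega> k) = i)" for i
      unfolding c_def by measurable
    have c_less: "c x < Suc m" if "x \<in> {0..1}" for x
    proof -
      have "real m * x \<le> real m" using that by (simp add: mult_left_le)
      then have "\<lceil>real m * x\<rceil> \<le> int m" by (simp add: ceiling_le_iff)
      then show ?thesis by (simp add: c_def nat_le_iff less_Suc_eq_le)
    qed
    define A where "A i = prefix_event k ds (\<lambda>\<omega>. fst \<omega> k \<notin> fixed_labels \<and> c (fst \<omega> k) = i)" for i
    have A [measurable]: "A i \<in> sets Omega_space" for i unfolding A_def by measurable
    have A_small: "measure \<mu> (A i) \<le> e" if "i < Suc m" for i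
    proof -
      let ?I = "{(real i - 1) / real m <.. real i / real m}"
      have "fst \<omega> k \<in> ?I" if "\<omega> \<in> A i" for \<omega>
      proof -
        have x: "0 \<le> fst \<omega> k" and ci: "nat \<lceil>real m * fst \<omega> k\<rceil> = i"
          using that Omega_label[of \<omega> k] by (auto simp: A_def prefix_event_def c_def)
        have "0 \<le> real m * fst \<omega> k" using x by simp
        then have "\<lceil>real m * fst \<omega> k\<rceil> = int i" using ci by linarith
        then have "real i - 1 < real m * fst \<omega> k" "real m * fst \<omega> k \<le> real i" by linarith+
        then show ?thesis using m by (simp add: field_simps)
      qed
      then have "A i \<subseteq> {\<omega> \<in> E. fst \<omega> k \<in> ?I}" by (auto simp: A_def E_def prefix_event_def)
      moreover have "{\<omega> \<in> E. fst \<omega> k \<in> ?I} \<in> sets \<mu>"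
      proof -
        have "{\<omega> \<in> E. fst \<omega> k \<in> ?I} = prefix_event k ds (\<lambda>\<omega>. fst \<omega> k \<notin> fixed_labels \<and> fst \<omega> k \<in> ?I)"
          by (auto simp: E_def prefix_event_def)
        then show ?thesis by (simp add: sets_eq)
      qed
      ultimately have "measure \<mu> (A i) \<le> measure \<mu> {\<omega> \<in> E. fst \<omega> k \<in> ?I}"
        by (rule finite_measure_mono)
      also have "\<dots> \<le> e" using ms[of ?I] small[of i] that by simp
      finally show ?thesis .
    qed
    have "(measure \<mu> ?B)\<^sup>2 \<le> real t * (\<Sum>i<Suc m. (measure \<mu> (A i))\<^sup>2)"
    proof (rule tendsto_lowerbound)
      show "(\<lambda>n. real t * (\<Sum>i<Suc m. \<integral>\<omega>. (avg n (A i) \<omega>)\<^sup>2 \<partial>\<mu>)) \<longlonglongrightarrow> real t * (\<Sum>i<Suc m. (measure \<mu> (A i))\<^sup>2)"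
        by (intro tendsto_mult tendsto_const tendsto_sum integral_avg_square_tendsto A)
      show "\<forall>\<^sub>F n in sequentially. (measure \<mu> ?B)\<^sup>2 \<le> real t * (\<Sum>i<Suc m. \<integral>\<omega>. (avg n (A i) \<omega>)\<^sup>2 \<partial>\<mu>)"
        using eventually_gt_at_top[of "k + t"]
      proof eventually_elim
        case (elim n)
        have "(measure \<mu> ?B)\<^sup>2 \<le> (\<integral>\<omega>. (avg n ?B \<omega>)\<^sup>2 \<partial>\<mu>)"
          by (rule measure_square_le_integral_avg[OF B])
        also have "\<dots> \<le> (\<integral>\<omega>. real t * (\<Sum>i<Suc m. (avg n (A i) \<omega>)\<^sup>2) \<partial>\<mu>)"
        proof (rule integral_mono_AE)
          show "integrable \<mu> (\<lambda>\<omega>. (avg n ?B \<omega>)\<^sup>2)" by (rule integrable_avg_square[OF B])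
          show "integrable \<mu> (\<lambda>\<omega>. real t * (\<Sum>i<Suc m. (avg n (A i) \<omega>)\<^sup>2))"
            by (intro integrable_mult_right Bochner_Integration.integrable_sum integrable_avg_square A)
          show "AE \<omega> in \<mu>. (avg n ?B \<omega>)\<^sup>2 \<le> real t * (\<Sum>i<Suc m. (avg n (A i) \<omega>)\<^sup>2)"
            using AE_inj AE_Omega
          proof eventually_elim
            case w: (elim \<omega>)
            show ?case unfolding A_def
              by (rule avg_followed_square_le[OF w(2,1) elim c_less])
          qed
        qed
        also have "\<dots> = real t * (\<Sum>i<Suc m. \<integral>\<omega>. (avg n (A i) \<omega>)\<^sup>2 \<partial>\<mu>)"
        proof -
          have "(\<integral>\<omega>. real t * (\<Sum>i<Suc m. (avg n (A i) \<omega>)\<^sup>2) \<partial>\<mu>) =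
              real t * (\<integral>\<omega>. (\<Sum>i<Suc m. (avg n (A i) \<omega>)\<^sup>2) \<partial>\<mu>)"
            by (intro Bochner_Integration.integral_mult_right Bochner_Integration.integrable_sum integrable_avg_square A)
          also have "(\<integral>\<omega>. (\<Sum>i<Suc m. (avg n (A i) \<omega>)\<^sup>2) \<partial>\<mu>) = (\<Sum>i<Suc m. \<integral>\<omega>. (avg n (A i) \<omega>)\<^sup>2 \<partial>\<mu>)"
            by (intro Bochner_Integration.integral_sum integrable_avg_square A)
          finally show ?thesis .
        qed
        finally show ?case .
      qed
    qed simp
    also have "(\<Sum>i<Suc m. (measure \<mu> (A i))\<^sup>2) \<le> (\<Sum>i<Suc m. e * measure \<mu> (A i))"
      unfolding power2_eq_square by (intro sum_mono mult_right_mono A_small) auto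
    also have "\<dots> = e * (\<Sum>i<Suc m. measure \<mu> (A i))" by (simp only: sum_distrib_left)
    also have "(\<Sum>i<Suc m. measure \<mu> (A i)) = measure \<mu> (\<Union>i\<in>{..<Suc m}. A i)"
    proof (rule finite_measure_finite_Union[symmetric])
      have "A i \<inter> A j = {}" if "i \<noteq> j" for i j
        using that by (auto simp: A_def prefix_event_def)
      then show "disjoint_family_on A {..<Suc m}" by (simp add: disjoint_family_on_def)
    qed (use A in \<open>auto simp: sets_eq\<close>)
    also have "e * \<dots> \<le> e * 1" using \<open>0 < e\<close> by (intro mult_left_mono) auto
    finally show ?thesis by (simp add: mult_left_mono)
  qed
  have "(measure \<mu> ?B)\<^sup>2 \<le> 0"
  proof (rule field_le_epsilon)
    fix e :: real assume "0 < e"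
    \<comment> \<open>The denominator is \<open>t + 1\<close> rather than \<open>t\<close> to allow \<open>t = 0\<close>.\<close>
    have "(measure \<mu> ?B)\<^sup>2 \<le> real t * (e / (real t + 1))" using \<open>0 < e\<close> by (intro bound) simp
    also have "\<dots> \<le> e" using \<open>0 < e\<close> by (simp add: field_simps)
    finally show "(measure \<mu> ?B)\<^sup>2 \<le> 0 + e" by simp
  qed
  then have "measure \<mu> ?B = 0" by simp
  then show ?thesis by (simp add: null_sets_def sets_eq emeasure_eq_measure)
qed

text \<open>
  Suppose that \<open>i\<close> is below \<open>j\<close> and does not have a fixed label. The first such index \<open>m\<close> below \<open>j\<close> has
  only fixed labels below it. Listing the elements below \<open>m\<close> first, then \<open>m\<close>, then the others, is a
  re-enumeration of the first \<open>j + 1\<close> elements, and it leads into one of the countably many null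
  events of \<open>prefix_followed_null\<close>; by order-invariance this is almost surely impossible.
\<close>

lemma AE_nonmaximal_fixed:
  "AE \<omega> in \<mu>. \<forall>i j. (i, j) \<in> snd \<omega> \<longrightarrow> fst \<omega> i \<in> fixed_labels"
proof -
  let ?F = "fixed_labels"
  define B where "B ds t = prefix_event (length ds) (\<lambda>i. ds ! i) (\<lambda>\<omega>. fst \<omega> (length ds) \<notin> ?F \<and> followed (length ds) t \<omega>)"
    for ds t
  define N where "N = (\<Union>ds\<in>lists ?F. \<Union>t. B ds t)"
  have "countable (lists ?F)" by (rule countable_lists[OF countable_fixed_labels])
  then have "N \<in> null_sets \<mu>" unfolding N_def B_def
    by (intro null_sets_UN' prefix_followed_null) auto
  from AE_relabel[OF this] AE_Omega show ?thesis
  proof eventually_elim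
    case (elim \<omega>)
    note w = elim(2)
    show ?case
    proof (intro allI impI, rule ccontr)
      fix i j assume ij: "(i, j) \<in> snd \<omega>" and "fst \<omega> i \<notin> ?F"
      \<comment> \<open>The order only relates smaller to larger indices, so the least index is minimal in the order.\<close>
      define m where "m = (LEAST i. fst \<omega> i \<notin> ?F \<and> (i, j) \<in> snd \<omega>)"
      have m: "fst \<omega> m \<notin> ?F" "(m, j) \<in> snd \<omega>"
        using LeastI[of "\<lambda>i. fst \<omega> i \<notin> ?F \<and> (i, j) \<in> snd \<omega>" i] ij \<open>fst \<omega> i \<notin> ?F\<close> by (simp_all add: m_def)
      have belowF: "fst \<omega> l \<in> ?F" if "(l, m) \<in> snd \<omega>" for l
      proof (rule ccontr)
        assume "fst \<omega> l \<notin> ?F"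
        moreover have "(l, j) \<in> snd \<omega>" using Omega_trans[OF w that m(2)] .
        ultimately have "m \<le> l" unfolding m_def by (intro Least_le) simp
        then show False using Omega_less[OF w that] by simp
      qed
      define n where "n = Suc j"
      have mn: "m < n" using Omega_less[OF w m(2)] by (simp add: n_def)
      define D where "D = {l. (l, m) \<in> snd \<omega>}"
      define E where "E = {..<n} - D - {m}"
      have Dm: "D \<subseteq> {..<m}" using Omega_less[OF w] by (auto simp: D_def)
      have fin: "finite D" "finite E" using Dm by (auto simp: E_def intro: finite_subset)
      let ?p = "sorted_list_of_set D" and ?q = "sorted_list_of_set E"
      let ?xs = "?p @ m # ?q"
      have sorted: "sorted_wrt (\<lambda>a b. (b, a) \<notin> snd \<omega>) (sorted_list_of_set X)" for X
        using strict_sorted_list_of_set[of X]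
        by (rule sorted_wrt_mono_rel[rotated]) (auto dest: Omega_less[OF w])
      have 1: "(m, a) \<notin> snd \<omega>" if "a \<in> D" for a
        using that Omega_less[OF w, of m a] Omega_less[OF w, of a m] by (auto simp: D_def)
      have 2: "(b, a) \<notin> snd \<omega>" if "a \<in> D" "b \<in> E" for a b
        using that Omega_trans[OF w, of b a m] by (auto simp: D_def E_def)
      have 3: "(b, m) \<notin> snd \<omega>" if "b \<in> E" for b
        using that by (auto simp: D_def E_def)
      have xs: "?xs \<in> lin_exts (snd \<omega>) {..<n}"
      proof -
        have "D \<union> insert m E = {..<n}" "m \<notin> D" "m \<notin> E" "D \<inter> E = {}"
          using Dm mn by (auto simp: E_def)
        then show ?thesis using fin sorted 1 2 3 by (auto simp: lin_exts_def sorted_wrt_append)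
      qed
      define l where "l = (\<lambda>i. if i < n then ?xs ! i else i)"
      have l: "linear_extension n (snd \<omega>) l"
        unfolding l_def by (rule linear_extension_of_list[OF xs Omega_less[OF w]])
      let ?k = "length ?p"
      have len: "length ?xs = n" using length_lin_ext[OF xs] by simp
      then have kn: "?k < n" by simp
      have lk: "l ?k = m" using kn by (simp add: l_def nth_append)
      have "j \<in> set ?xs" using xs by (simp add: lin_exts_def n_def)
      then obtain j' where j': "j' < n" "?xs ! j' = j" using len by (metis in_set_conv_nth)
      then have lj: "l j' = j" by (simp add: l_def)
      have lkj: "(l ?k, l j') \<in> snd \<omega>" unfolding lk lj by (rule m(2))
      have "?k < j'"
        by (rule linear_extension_less[OF l Omega_less[OF w] lkj])
      then have "followed ?k n (relabel l \<omega>)"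
        using j'(1) lk lj m(2) by (auto simp: followed_def intro!: exI[of _ j'])
      moreover have "fst (relabel l \<omega>) i = map (fst \<omega>) ?p ! i" if "i < ?k" for i
        using that kn by (simp add: l_def nth_append)
      moreover have "relabel l \<omega> \<in> Omega" by (rule relabel_Omega[OF w l])
      moreover have "fst (relabel l \<omega>) ?k \<notin> ?F" using lk m(1) by simp
      ultimately have "relabel l \<omega> \<in> B (map (fst \<omega>) ?p) n"
        unfolding B_def prefix_event_def by (simp only: length_map) blast
      moreover have "map (fst \<omega>) ?p \<in> lists ?F" using belowF fin by (auto simp: D_def)
      ultimately have "relabel l \<omega> \<in> N" unfolding N_def by blast
      with elim(1) l show False by blast
    qed
  qed
qed

section \<open>Types of the remaining elements\<close>

text \<open>
  If there were only finitely many such elements, the least of their labels would be an invariant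
  random variable, hence almost surely equal to a constant \<open>c\<close>; then \<open>c\<close> occurs almost surely and
  is a fixed label, although it is the label of an element whose label is not fixed.
\<close>

lemma AE_infinite_type:
  assumes "finite D" and ex: "AE \<omega> in \<mu>. \<exists>i. fst \<omega> i \<notin> fixed_labels \<and> down \<omega> i = D"
  shows "AE \<omega> in \<mu>. infinite {i. fst \<omega> i \<notin> fixed_labels \<and> down \<omega> i = D}"
proof (rule ccontr)
  let ?F = "fixed_labels"
  note [measurable] = down_eq_measurable[OF assms(1)]
  define T where "T \<omega> = fst \<omega> ` {i. fst \<omega> i \<notin> ?F \<and> down \<omega> i = D}" for \<omega> :: "(nat \<Rightarrow> real) \<times> nat rel"
  \<comment> \<open>The value 0 for an empty set keeps \<open>Y\<close> bounded, hence integrable.\<close>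
  define Y where "Y \<omega> = (if T \<omega> = {} then 0 else Inf (T \<omega>))" for \<omega>
  assume "\<not> (AE \<omega> in \<mu>. infinite {i. fst \<omega> i \<notin> ?F \<and> down \<omega> i = D})"
  then have fin: "AE \<omega> in \<mu>. finite {i. fst \<omega> i \<notin> ?F \<and> down \<omega> i = D}"
    using zero_one_infinite[of "\<lambda>x E. x \<notin> ?F \<and> E = D"] by simp
  have T01: "T \<omega> \<subseteq> {0..1}" if "\<omega> \<in> Omega" for \<omega> using Omega_label[OF that] unfolding T_def by blast
  have Yless: "Y \<omega> < a \<longleftrightarrow> (if \<exists>i. fst \<omega> i \<notin> ?F \<and> down \<omega> i = D then \<exists>i. fst \<omega> i \<notin> ?F \<and> down \<omega> i = D \<and> fst \<omega> i < a else 0 < a)"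
    if w: "\<omega> \<in> Omega" for \<omega> a
  proof (cases "T \<omega> = {}")
    case True
    then show ?thesis by (auto simp: Y_def T_def)
  next
    case False
    have "bdd_below (T \<omega>)" using T01[OF w] by (meson bdd_below_Icc bdd_below_mono)
    then have "Y \<omega> < a \<longleftrightarrow> (\<exists>x\<in>T \<omega>. x < a)" using False by (simp add: Y_def cInf_less_iff)
    then show ?thesis using False by (auto simp: T_def)
  qed
  have "{\<omega> \<in> space Omega_space. Y \<omega> < a} = {\<omega> \<in> space Omega_space.
      if \<exists>i. fst \<omega> i \<notin> ?F \<and> down \<omega> i = D then \<exists>i. fst \<omega> i \<notin> ?F \<and> down \<omega> i = D \<and> fst \<omega> i < a else 0 < a}" for a
    by (intro Collect_cong conj_cong refl) (simp only: space_Omega_space Yless)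
  then have Ym: "Y \<in> borel_measurable Omega_space"
    by (intro borel_measurableI_less) simp
  have Yinv: "Y (relabel l \<omega>) = Y \<omega>" if l: "linear_extension n (snd \<omega>) l" for \<omega> n l
  proof -
    have "surj l" using l by (auto simp: linear_extension_def permutes_surj)
    then have "T (relabel l \<omega>) = T \<omega>"
      by (auto simp: T_def down_relabel[OF l] image_iff surj_def) metis
    then show ?thesis by (simp add: Y_def)
  qed
  have "\<bar>Y \<omega>\<bar> \<le> 1" if w: "\<omega> \<in> Omega" for \<omega>
  proof (cases "T \<omega> = {}")
    case False
    have "0 \<le> Inf (T \<omega>)" using T01[OF w] False by (intro cInf_greatest) auto
    moreover obtain x where x: "x \<in> T \<omega>" using False by blast
    have "bdd_below (T \<omega>)" using T01[OF w] by (meson bdd_below_Icc bdd_below_mono)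
    then have "Inf (T \<omega>) \<le> x" by (rule cInf_lower[OF x])
    moreover have "x \<le> 1" using x T01[OF w] by auto
    ultimately show ?thesis using False by (simp add: Y_def)
  qed (simp add: Y_def)
  then have Yint: "integrable \<mu> Y" by (rule integrable_bounded[OF Ym])
  define c where "c = (\<integral>\<omega>. Y \<omega> \<partial>\<mu>)"
  have "AE \<omega> in \<mu>. Y \<omega> = c" unfolding c_def
    using Ym Yinv Yint by (intro invariant_AE_const) auto
  with fin ex have mem: "AE \<omega> in \<mu>. c \<in> T \<omega>"
  proof eventually_elim
    case (elim \<omega>)
    then have "finite (T \<omega>)" "T \<omega> \<noteq> {}" by (auto simp: T_def)
    then have "Inf (T \<omega>) \<in> T \<omega>" by (simp add: cInf_eq_Min)
    then show ?case using elim(3) \<open>T \<omega> \<noteq> {}\<close> by (simp add: Y_def)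
  qed
  then have "AE \<omega> in \<mu>. c \<in> range (fst \<omega>)" by eventually_elim (auto simp: T_def)
  then have "c \<in> ?F" by (simp add: fixed_labels_def)
  moreover from AE_ex[OF mem] have "c \<notin> ?F" by (auto simp: T_def)
  ultimately show False by simp
qed

definition fixed_order :: "real rel" where
  "fixed_order = {(p, q). p \<in> fixed_labels \<and> q \<in> fixed_labels \<and>
     (AE \<omega> in \<mu>. \<exists>i. fst \<omega> i = q \<and> p \<in> down \<omega> i)}"

text \<open>
  The sets of fixed labels that occur as lower sets of elements without a fixed label. Each of
  them contributes one marked element to \<open>Q\<close>.
\<close>

definition types :: "real set set" where
  "types = {D. finite D \<and> D \<subseteq> fixed_labels \<and> (AE \<omega> in \<mu>. \<exists>i. fst \<omega> i \<notin> fixed_labels \<and> down \<omega> i = D)}"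

lemma countable_types: "countable types"
  by (rule countable_subset[OF _ countable_Collect_finite_subset[OF countable_fixed_labels]])
    (auto simp: types_def)

text \<open>
  The almost sure facts behind the final construction, gathered into one statement. Properties
  of \<open>Q\<close> itself are non-random and can be read off from a single \<open>\<omega>\<close> of this kind.
\<close>

lemma AE_structure:
  "AE \<omega> in \<mu>. \<omega> \<in> Omega \<and> inj (fst \<omega>) \<and> fixed_labels \<subseteq> range (fst \<omega>) \<and>
     (\<forall>i j. (i, j) \<in> snd \<omega> \<longrightarrow> fst \<omega> i \<in> fixed_labels) \<and>
     (\<forall>i j. fst \<omega> j \<in> fixed_labels \<longrightarrow> (i, j) \<in> snd \<omega> \<longleftrightarrow> (fst \<omega> i, fst \<omega> j) \<in> fixed_order) \<and>
     (\<forall>i. fst \<omega> i \<notin> fixed_labels \<longrightarrow> down \<omega> i \<in> types) \<and>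
     (\<forall>D\<in>types. infinite {i. fst \<omega> i \<notin> fixed_labels \<and> down \<omega> i = D})"
proof -
  let ?F = "fixed_labels"
  have cF: "countable ?F" by (rule countable_fixed_labels)
  have 1: "AE \<omega> in \<mu>. \<forall>p\<in>?F. p \<in> range (fst \<omega>)"
    using cF by (subst AE_ball_countable) (auto simp: fixed_labels_def)
  have 2: "AE \<omega> in \<mu>. \<forall>p\<in>?F. \<forall>q\<in>?F. (\<exists>i. fst \<omega> i = q \<and> p \<in> down \<omega> i) \<longleftrightarrow> (p, q) \<in> fixed_order"
  proof (subst AE_ball_countable[OF cF], intro ballI, subst AE_ball_countable[OF cF], intro ballI)
    fix p q assume "p \<in> ?F" "q \<in> ?F"
    then show "AE \<omega> in \<mu>. (\<exists>i. fst \<omega> i = q \<and> p \<in> down \<omega> i) \<longleftrightarrow> (p, q) \<in> fixed_order"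
      using AE_iff_AE[OF zero_one_exists[of "\<lambda>x D. x = q \<and> p \<in> D"]] by (simp add: fixed_order_def)
  qed
  have 3: "AE \<omega> in \<mu>. \<forall>D\<in>{D. finite D \<and> D \<subseteq> ?F}. (\<exists>i. fst \<omega> i \<notin> ?F \<and> down \<omega> i = D) \<longrightarrow> D \<in> types"
  proof (subst AE_ball_countable[OF countable_Collect_finite_subset[OF cF]], intro ballI)
    fix D assume D: "D \<in> {D. finite D \<and> D \<subseteq> ?F}"
    then have [measurable]: "Measurable.pred Omega_space (\<lambda>\<omega>. down \<omega> i = D)" for i
      by (simp add: down_eq_measurable)
    have "AE \<omega> in \<mu>. (\<exists>i. fst \<omega> i \<notin> ?F \<and> down \<omega> i = D) \<longleftrightarrow> (AE \<omega> in \<mu>. \<exists>i. fst \<omega> i \<notin> ?F \<and> down \<omega> i = D)"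
      by (rule AE_iff_AE[OF zero_one_exists[of "\<lambda>x E. x \<notin> ?F \<and> E = D"]]) measurable
    then show "AE \<omega> in \<mu>. (\<exists>i. fst \<omega> i \<notin> ?F \<and> down \<omega> i = D) \<longrightarrow> D \<in> types"
      by eventually_elim (use D in \<open>simp add: types_def\<close>)
  qed
  have 4: "AE \<omega> in \<mu>. \<forall>D\<in>types. infinite {i. fst \<omega> i \<notin> ?F \<and> down \<omega> i = D}"
  proof (subst AE_ball_countable[OF countable_types], intro ballI)
    fix D assume "D \<in> types"
    then show "AE \<omega> in \<mu>. infinite {i. fst \<omega> i \<notin> ?F \<and> down \<omega> i = D}"
      by (intro AE_infinite_type) (simp_all add: types_def)
  qed
  from AE_Omega AE_inj 1 AE_nonmaximal_fixed 2 3 4 show ?thesis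
  proof eventually_elim
    case (elim \<omega>)
    note w = elim(1) and inj = elim(2) and F = elim(3) and low = elim(4) and ord = elim(5) and ty = elim(6)
    have mem: "fst \<omega> i \<in> down \<omega> j \<longleftrightarrow> (i, j) \<in> snd \<omega>" for i j
      using injD[OF inj] by (auto simp: down_def)
    have downF: "down \<omega> i \<subseteq> ?F" for i using low by (auto simp: down_def)
    have "(i, j) \<in> snd \<omega> \<longleftrightarrow> (fst \<omega> i, fst \<omega> j) \<in> fixed_order" if j: "fst \<omega> j \<in> ?F" for i j
    proof (cases "fst \<omega> i \<in> ?F")
      case True
      have "(i, j) \<in> snd \<omega> \<longleftrightarrow> (\<exists>j'. fst \<omega> j' = fst \<omega> j \<and> fst \<omega> i \<in> down \<omega> j')"
        unfolding mem using injD[OF inj] by metis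
      then show ?thesis using ord True j by blast
    next
      case False
      then show ?thesis using low by (auto simp: fixed_order_def)
    qed
    moreover have "down \<omega> i \<in> types" if "fst \<omega> i \<notin> ?F" for i
      using ty downF finite_down[OF w, of i] that by blast
    ultimately show ?case using w inj F low elim(7) by blast
  qed
qed

text \<open>
  The marked element for the type \<open>D\<close> is a real number \<open>z D \<ge> 2\<close>, which keeps it apart from all
  labels, and the antichain replacing it consists of the elements without a fixed label whose
  lower set is \<open>D\<close>.
\<close>

lemma poset_description:
  "\<exists>(Z :: real set) (r :: real rel) (M :: real set).
      (causal_set Z r \<or> finite Z \<and> poset_on Z r) \<and>
      M \<subseteq> Z \<and> (\<forall>z\<in>M. \<forall>y\<in>Z. (z, y) \<notin> r) \<and> Z - M \<subseteq> {0..1} \<and>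
      (AE \<omega> in \<mu>. \<exists>A :: real \<Rightarrow> real set.
         (\<forall>z\<in>M. countable (A z) \<and> infinite (A z) \<and> A z \<subseteq> {0..1} \<and> A z \<inter> (Z - M) = {}) \<and>
         disjoint_family_on A M \<and>
         generated_poset \<omega> = replace_by_antichains Z r M A)"
proof -
  let ?F = "fixed_labels"
  define z where "z D = 2 + real (to_nat_on types D)" for D
  have z_inj: "z D = z D' \<Longrightarrow> D = D'" if "D \<in> types" "D' \<in> types" for D D'
    using that inj_on_to_nat_on[OF countable_types] by (auto simp: z_def inj_on_def)
  have z_large: "2 \<le> z D" for D by (simp add: z_def)
  have zF: "z D \<notin> ?F" for D using fixed_labels_unit z_large[of D] by force
  define M where "M = z ` types"
  define Z where "Z = ?F \<union> M"
  define r where "r = fixed_order \<union> {(y, z D) | y D. D \<in> types \<and> y \<in> D}"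
  have MF: "M \<inter> ?F = {}" using zF by (auto simp: M_def)
  then have ZM: "Z - M = ?F" by (auto simp: Z_def)
  have ordF: "fixed_order \<subseteq> ?F \<times> ?F" by (auto simp: fixed_order_def)
  have typF: "finite D" "D \<subseteq> ?F" if "D \<in> types" for D using that by (auto simp: types_def)
  \<comment> \<open>\<open>fixed_order\<close> and \<open>types\<close> are non-random, so one realization suffices to see that \<open>r\<close> is a suitable order.\<close>
  obtain \<omega> where w: "\<omega> \<in> Omega" and inj: "inj (fst \<omega>)" and F: "?F \<subseteq> range (fst \<omega>)"
    and ord: "\<And>i j. fst \<omega> j \<in> ?F \<Longrightarrow> (i, j) \<in> snd \<omega> \<longleftrightarrow> (fst \<omega> i, fst \<omega> j) \<in> fixed_order"
    and inf: "\<And>D. D \<in> types \<Longrightarrow> infinite {i. fst \<omega> i \<notin> ?F \<and> down \<omega> i = D}"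
    using AE_ex[OF AE_structure] by blast
  have fo_irrefl: "(p, p) \<notin> fixed_order" for p
  proof
    assume p: "(p, p) \<in> fixed_order"
    then obtain i where i: "fst \<omega> i = p" "p \<in> ?F" using ordF F by blast
    then have "(i, i) \<in> snd \<omega>" using ord[of i i] p by simp
    then show False using Omega_less[OF w] by blast
  qed
  have fo_trans: "(p, s) \<in> fixed_order" if pq: "(p, q) \<in> fixed_order" and qs: "(q, s) \<in> fixed_order" for p q s
  proof -
    have "p \<in> ?F" "q \<in> ?F" "s \<in> ?F" using pq qs ordF by auto
    then obtain a b c where abc: "fst \<omega> a = p" "fst \<omega> b = q" "fst \<omega> c = s" using F by blast
    then have "(a, b) \<in> snd \<omega>" "(b, c) \<in> snd \<omega>"
      using ord[of b a] ord[of c b] pq qs ordF by auto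
    then have "(a, c) \<in> snd \<omega>" by (rule Omega_trans[OF w])
    then show ?thesis using ord[of c a] abc \<open>s \<in> ?F\<close> by simp
  qed
  \<comment> \<open>Types are closed downwards in the order of the fixed labels; this gives transitivity below the marked elements.\<close>
  have fo_type: "p \<in> D" if pq: "(p, q) \<in> fixed_order" and D: "D \<in> types" "q \<in> D" for p q D
  proof -
    have "{i. fst \<omega> i \<notin> ?F \<and> down \<omega> i = D} \<noteq> {}" using inf[OF D(1)] by (metis finite.emptyI)
    then obtain i where i: "down \<omega> i = D" by blast
    then obtain b where b: "(b, i) \<in> snd \<omega>" "q = fst \<omega> b" using D(2) by (auto simp: down_def)
    have "p \<in> ?F" "q \<in> ?F" using pq ordF by auto
    then obtain a where a: "fst \<omega> a = p" using F by blast
    have "(a, b) \<in> snd \<omega>" using ord[of b a] a b pq \<open>q \<in> ?F\<close> by simp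
    then have "(a, i) \<in> snd \<omega>" using b by (blast intro: Omega_trans[OF w])
    then show ?thesis using a i by (auto simp: down_def)
  qed
  have r_cases: "(x, y) \<in> fixed_order \<or> (\<exists>D\<in>types. y = z D \<and> x \<in> D)" if "(x, y) \<in> r" for x y
    using that by (auto simp: r_def)
  have r_sub: "x \<in> ?F \<and> y \<in> Z" if "(x, y) \<in> r" for x y
    using r_cases[OF that]
  proof
    assume "(x, y) \<in> fixed_order"
    then show ?thesis using ordF by (auto simp: Z_def)
  next
    assume "\<exists>D\<in>types. y = z D \<and> x \<in> D"
    then obtain D where "D \<in> types" "y = z D" "x \<in> D" by blast
    then show ?thesis using typF(2)[of D] by (auto simp: Z_def M_def)
  qed
  have rM: "(x, y) \<notin> r" if "x \<in> M" for x y
    using r_sub that MF by blast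
  have poset: "poset_on Z r"
    unfolding poset_on_def
  proof (intro conjI)
    show "r \<subseteq> Z \<times> Z" using r_sub by (auto simp: Z_def)
    show "irrefl r"
    proof (unfold irrefl_def, intro allI notI)
      fix x assume x: "(x, x) \<in> r"
      then have "x \<in> ?F" using r_sub by blast
      then show False using r_cases[OF x] fo_irrefl zF by auto
    qed
    show "trans r"
    proof (rule transI)
      fix x y u assume xy: "(x, y) \<in> r" and yu: "(y, u) \<in> r"
      have "y \<notin> M" using rM yu by blast
      then have f: "(x, y) \<in> fixed_order" using r_cases[OF xy] by (auto simp: M_def)
      from r_cases[OF yu] show "(x, u) \<in> r"
        using fo_trans[OF f] fo_type[OF f] by (auto simp: r_def)
    qed
  qed
  have count: "countable Z" using countable_fixed_labels countable_types by (simp add: Z_def M_def)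
  have finite_below: "finite {y. (y, u) \<in> r}" for u
  proof (cases "u \<in> M")
    case True
    then obtain D where D: "D \<in> types" "u = z D" by (auto simp: M_def)
    have "{y. (y, u) \<in> r} \<subseteq> D"
    proof
      fix y assume "y \<in> {y. (y, u) \<in> r}"
      then have "(y, u) \<in> fixed_order \<or> (\<exists>D'\<in>types. u = z D' \<and> y \<in> D')" using r_cases by blast
      then show "y \<in> D" using D ordF zF z_inj by blast
    qed
    then show ?thesis using typF(1)[OF D(1)] by (rule finite_subset)
  next
    case False
    show ?thesis
    proof (cases "u \<in> ?F")
      case True
      then obtain c where c: "fst \<omega> c = u" using F by blast
      have "{y. (y, u) \<in> r} \<subseteq> fst \<omega> ` {..<c}"
      proof
        fix y assume "y \<in> {y. (y, u) \<in> r}"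
        then have f: "(y, u) \<in> fixed_order" using r_cases False by (auto simp: M_def)
        then obtain a where a: "fst \<omega> a = y" using F ordF by blast
        have "(a, c) \<in> snd \<omega>" using ord[of c a] c a f True by simp
        then show "y \<in> fst \<omega> ` {..<c}" using a Omega_less[OF w] by auto
      qed
      then show ?thesis by (rule finite_subset) simp
    next
      case F: False
      then have "u \<notin> Z" using False by (simp add: Z_def)
      then have "{y. (y, u) \<in> r} = {}" using r_sub by blast
      then show ?thesis by simp
    qed
  qed
  have "causal_set Z r \<or> finite Z \<and> poset_on Z r"
    using poset count finite_below by (auto simp: causal_set_def)
  moreover have "M \<subseteq> Z" by (simp add: Z_def)
  moreover have "\<forall>z\<in>M. \<forall>y\<in>Z. (z, y) \<notin> r" using rM by blast
  moreover have "Z - M \<subseteq> {0..1}" using ZM fixed_labels_unit by simp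
  moreover have "AE \<omega> in \<mu>. \<exists>A :: real \<Rightarrow> real set.
         (\<forall>z\<in>M. countable (A z) \<and> infinite (A z) \<and> A z \<subseteq> {0..1} \<and> A z \<inter> (Z - M) = {}) \<and>
         disjoint_family_on A M \<and>
         generated_poset \<omega> = replace_by_antichains Z r M A"
    using AE_structure
  proof eventually_elim
    case (elim \<omega>)
    then have w: "\<omega> \<in> Omega" and inj: "inj (fst \<omega>)" and F: "?F \<subseteq> range (fst \<omega>)"
      and low: "\<And>i j. (i, j) \<in> snd \<omega> \<Longrightarrow> fst \<omega> i \<in> ?F"
      and ord: "\<And>i j. fst \<omega> j \<in> ?F \<Longrightarrow> (i, j) \<in> snd \<omega> \<longleftrightarrow> (fst \<omega> i, fst \<omega> j) \<in> fixed_order"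
      and ty: "\<And>i. fst \<omega> i \<notin> ?F \<Longrightarrow> down \<omega> i \<in> types"
      and inf: "\<And>D. D \<in> types \<Longrightarrow> infinite {i. fst \<omega> i \<notin> ?F \<and> down \<omega> i = D}"
      by blast+
    define A where "A v = fst \<omega> ` {i. fst \<omega> i \<notin> ?F \<and> z (down \<omega> i) = v}" for v
    have memA: "fst \<omega> i \<in> A v \<longleftrightarrow> fst \<omega> i \<notin> ?F \<and> z (down \<omega> i) = v" for i v
      using injD[OF inj] by (auto simp: A_def)
    have memd: "fst \<omega> i \<in> down \<omega> j \<longleftrightarrow> (i, j) \<in> snd \<omega>" for i j
      using injD[OF inj] by (auto simp: down_def)
    have Ainf: "infinite (A (z D))" if D: "D \<in> types" for D
    proof
      assume "finite (A (z D))"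
      then have "finite {i. fst \<omega> i \<notin> ?F \<and> z (down \<omega> i) = z D}"
        unfolding A_def by (rule finite_imageD) (rule inj_on_subset[OF inj], simp)
      then have "finite {i. fst \<omega> i \<notin> ?F \<and> down \<omega> i = D}" by (rule finite_subset[rotated]) auto
      then show False using inf[OF D] by simp
    qed
    have "\<forall>z\<in>M. countable (A z) \<and> infinite (A z) \<and> A z \<subseteq> {0..1} \<and> A z \<inter> (Z - M) = {}"
      using Ainf Omega_label[OF w] unfolding ZM by (auto simp: M_def A_def)
    moreover have "disjoint_family_on A M"
      using injD[OF inj] by (fastforce simp: disjoint_family_on_def A_def)
    moreover have "generated_poset \<omega> = replace_by_antichains Z r M A"
    proof -
      have gp: "generated_poset \<omega> = (range (fst \<omega>), {(fst \<omega> i, fst \<omega> j) | i j. (i, j) \<in> snd \<omega>})"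
        by (simp add: generated_poset_def case_prod_beta)
      have ground: "range (fst \<omega>) = ?F \<union> (\<Union>v\<in>M. A v)"
      proof (intro equalityI subsetI)
        fix x assume "x \<in> range (fst \<omega>)"
        then obtain i where x: "x = fst \<omega> i" by blast
        show "x \<in> ?F \<union> (\<Union>v\<in>M. A v)"
          unfolding x using memA[of i] ty[of i] by (auto simp: M_def)
      qed (use F in \<open>auto simp: A_def\<close>)
      have iff: "(\<exists>i j. x = fst \<omega> i \<and> y = fst \<omega> j \<and> (i, j) \<in> snd \<omega>) \<longleftrightarrow>
         ((x, y) \<in> r \<and> x \<in> ?F \<and> y \<in> ?F) \<or> (x \<in> ?F \<and> (\<exists>v\<in>M. y \<in> A v \<and> (x, v) \<in> r))" (is "?L \<longleftrightarrow> ?R") for x y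
      proof
        assume ?L
        then obtain i j where ij: "x = fst \<omega> i" "y = fst \<omega> j" "(i, j) \<in> snd \<omega>" by blast
        have xF: "x \<in> ?F" using low ij by blast
        show ?R
        proof (cases "y \<in> ?F")
          case True
          then show ?thesis using xF ij ord[of j i] by (auto simp: r_def)
        next
          case False
          then have D: "down \<omega> j \<in> types" using ty ij by simp
          have "x \<in> down \<omega> j" using ij memd by simp
          then have "(x, z (down \<omega> j)) \<in> r" using D by (auto simp: r_def)
          moreover have "y \<in> A (z (down \<omega> j))" using memA[of j] False ij by simp
          ultimately show ?thesis using xF D by (auto simp: M_def)
        qed
      next
        assume ?R
        then show ?L
        proof
          assume *: "(x, y) \<in> r \<and> x \<in> ?F \<and> y \<in> ?F"
          then have f: "(x, y) \<in> fixed_order" using r_cases[of x y] zF by auto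
          obtain i j where ij: "x = fst \<omega> i" "y = fst \<omega> j" using * F by blast
          then show ?L using ord[of j i] f * by blast
        next
          assume "x \<in> ?F \<and> (\<exists>v\<in>M. y \<in> A v \<and> (x, v) \<in> r)"
          then obtain v where v: "v \<in> M" "y \<in> A v" "(x, v) \<in> r" by blast
          then obtain j where j: "y = fst \<omega> j" "fst \<omega> j \<notin> ?F" "z (down \<omega> j) = v" by (auto simp: A_def)
          have "v \<notin> ?F" using v(1) MF by blast
          then obtain D where D: "D \<in> types" "v = z D" "x \<in> D" using r_cases[OF v(3)] ordF by blast
          then have "x \<in> down \<omega> j" using z_inj[of "down \<omega> j" D] ty[OF j(2)] j(3) by simp
          then show ?L using j(1) by (auto simp: down_def)
        qed
      qed
      have "{(fst \<omega> i, fst \<omega> j) | i j. (i, j) \<in> snd \<omega>} =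
          r \<inter> ?F \<times> ?F \<union> {(y, a) | y a v. y \<in> ?F \<and> v \<in> M \<and> a \<in> A v \<and> (y, v) \<in> r}"
        by (intro subset_antisym subrelI) (use iff in blast)+
      then show ?thesis
        unfolding gp replace_by_antichains_def ZM using ground by simp
    qed
    ultimately show ?case by blast
  qed
  ultimately show ?thesis by blast
qed

end

section \<open>The shape of the generated poset\<close>

theorem theorem8p1:
  fixes \<mu> :: "((nat \<Rightarrow> real) \<times> nat rel) measure"
  assumes "extremal_order_invariant \<mu>"
    and "as_distinct_labels \<mu>"
  shows "\<exists>(Z :: real set) (r :: real rel) (M :: real set).
      (causal_set Z r \<or> finite Z \<and> poset_on Z r) \<and>
      M \<subseteq> Z \<and> (\<forall>z\<in>M. \<forall>y\<in>Z. (z, y) \<notin> r) \<and> Z - M \<subseteq> {0..1} \<and>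
      (AE \<omega> in \<mu>. \<exists>A :: real \<Rightarrow> real set.
         (\<forall>z\<in>M. countable (A z) \<and> infinite (A z) \<and> A z \<subseteq> {0..1} \<and> A z \<inter> (Z - M) = {}) \<and>
         disjoint_family_on A M \<and>
         generated_poset \<omega> = replace_by_antichains Z r M A)"
proof -
  have inv: "order_invariant \<mu>" using assms(1) by (simp add: extremal_order_invariant_def)
  interpret prob_space \<mu> using inv by (simp add: order_invariant_def)
  interpret distinct_extremal_measure \<mu>
    using inv assms by unfold_locales (auto simp: order_invariant_def)
  show ?thesis by (rule poset_description)
qed

end
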